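(* Assume that $A$ is $\gamma$-periodic with $\gamma>0$, i.e. $A_{t+\gamma}=A_t$ for all $t\in I$. Assume moreover that there exist probability measures $(\nu_s)_{s\in I}$ with $\nu_s\in\mathcal M_1(E_s)$ for each $s\in I$, and constants $t_0\in I$, $t_0>0$, $c_1>0$, $c_2>0$, such that (A'1) for all $s\in I$ and $x\in E_s$, $\mathbb P_{s,x}(X_{s+t_0}\in\cdot\mid\tau_A>s+t_0)\ge c_1\,\nu_{s+t_0}$; (A'2) for all $s\le t$ in $I$ and all $x\in E_s$, $\mathbb P_{s,\nu_s}(\tau_A>t)\ge c_2\,\mathbb P_{s,x}(\tau_A>t)$. Then for every $\mu\in\mathcal M_1(E_0)$, $$\frac1t\int_0^t\mathbb P_\mu(X_s\in\cdot\mid\tau_A>t)\,ds\longrightarrow\frac1\gamma\int_0^\gamma\mathbb Q_{0,\beta_\gamma}(X_s\in\cdot)\,ds\quad\text{weakly as }t\to\infty,$$ where $\beta_\gamma\in\mathcal M_1(E_0)$ is the invariant probability measure of $(X_{n\gamma})_{n\in\mathbb N}$ under the $Q$-process laws $\mathbb Q_{0,\cdot}$, i.e. for all $n\in\mathbb N$, $$\beta_\gamma=\mathbb Q_{0,\beta_\gamma}(X_{n\gamma}\in\cdot)=\int_{E_0}\beta_\gamma(dx)\,\mathbb Q_{0,x}(X_{n\gamma}\in\cdot).$$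
   Context: Here $I=\mathbb R_+$ (when $I=\mathbb Z_+$, $\gamma$ is a positive integer and integrals are read as sums: $\frac1t\int_0^t$ as $\frac1n\sum_{k=0}^n$ and $\frac1\gamma\int_0^\gamma$ as $\frac1\gamma\sum_{k=0}^{\gamma-1}$). $(X_t)_{t\in I}$ is a time-homogeneous Markov process on a metric space $(E,d)$ equipped with a $\sigma$-algebra $\mathcal E$, and $\mathcal F_t=\sigma(X_u,\,0\le u\le t)$. For $s\in I$, $x\in E$, $\mathbb P_{s,x}$ is the law of the process started from $x$ at time $s$ ($\mathbb P_{s,x}(X_s=x)=1$; by time-homogeneity $(X_{s+u})_{u\in I}$ under $\mathbb P_{s,x}$ has the law of $(X_u)_{u\in I}$ under $\mathbb P_{0,x}$). Put $\mathbb P_{s,\mu}=\int\mathbb P_{s,x}\,\mu(dx)$ and $\mathbb P_\mu=\mathbb P_{0,\mu}$, with expectations $\mathbb E_{s,x}$, etc. For $F\subset E$, $\mathcal M_1(F)$ is the set of probability measures on $F$. For each $t\in I$, $A_t\in\mathcal E$ is the absorbing subset at time $t$, $E_t=E\setminus A_t$, and $\tau_A=\inf\{t\in I: X_t\in A_t\}$ (under $\mathbb P_{s,\cdot}$ the infimum is over $t\ge s$). It is assumed throughout that $\tau_A$ is an $(\mathcal F_t)$-stopping time, that $\mathbb P_{s,x}(\tau_A<\infty)=1$ for all $s\in I$, $x\in E_s$, and that $\mathbb P_{s,x}(\tau_A>t)>0$ for all $s\le t$, $x\in E_s$. $Q$-process: under (A'1)-(A'2), for all $s\le t$ and $x\in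 E_s$ the conditional law $\mathbb P_{s,x}(X_{[s,t]}\in\cdot\mid\tau_A>T)$ of the trajectory $X_{[s,t]}$ between times $s$ and $t$ converges weakly as $T\to\infty$ to a law denoted $\mathbb Q_{s,x}(X_{[s,t]}\in\cdot)$. It is given by $\mathbb Q_{s,x}(X_{[s,t]}\in\cdot)=\mathbb E_{s,x}\big(\mathbf 1_{X_{[s,t]}\in\cdot,\ \tau_A>t}\,\eta_t(X_t)/\eta_s(x)\big)$, where $\eta_s:E_s\to(0,\infty)$ are bounded functions with $\lim_{t\to\infty}\mathbb P_{s,x}(\tau_A>t)/\mathbb P_{s,y}(\tau_A>t)=\eta_s(x)/\eta_s(y)$ and $\mathbb E_{s,x}(\mathbf 1_{\tau_A>t}\eta_t(X_t))=\eta_s(x)$. For $\mu\in\mathcal M_1(E_s)$, $\mathbb Q_{s,\mu}=\int_{E_s}\mathbb Q_{s,x}\,\mu(dx)$. *)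

theory Defs
  imports "HOL-Probability.Probability"
begin

text \<open>
  A process absorbed by a moving boundary. Time is a set of reals: \<open>{0..}\<close> for continuous
  time, \<open>\<nat>\<close> for discrete time. The laws \<open>Pr S s x\<close> (the process starts from \<open>x\<close> at time \<open>s\<close>)
  live on one common sample space; under \<open>Pr S s x\<close> only the coordinates at times \<open>u \<ge> s\<close>
  are meaningful. The maps \<open>shift S s\<close> are the usual shift operators on the sample space.
\<close>

record ('w, 'e) process =
  Time :: "real set"
  Sample :: "'w measure"
  State :: "'e measure"
  coord :: "real \<Rightarrow> 'w \<Rightarrow> 'e"
  shift :: "real \<Rightarrow> 'w \<Rightarrow> 'w"
  Pr :: "real \<Rightarrow> 'e \<Rightarrow> 'w measure"
  absorbing :: "real \<Rightarrow> 'e set"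

definition alive :: "('w, 'e) process \<Rightarrow> real \<Rightarrow> 'e set" where
  "alive S t = space (State S) - absorbing S t"

definition hit :: "('w, 'e) process \<Rightarrow> real \<Rightarrow> 'w \<Rightarrow> ereal" where
  "hit S s w = (INF t\<in>{t \<in> Time S. s \<le> t \<and> coord S t w \<in> absorbing S t}. ereal t)"

text \<open>The event \<open>\<tau>\<^sub>A > t\<close>, with the infimum defining \<open>\<tau>\<^sub>A\<close> taken over times \<open>\<ge> s\<close>.\<close>

definition surviving :: "('w, 'e) process \<Rightarrow> real \<Rightarrow> real \<Rightarrow> 'w set" where
  "surviving S s t = {w \<in> space (Sample S). ereal t < hit S s w}"

text \<open>The \<open>\<sigma>\<close>-algebra generated by the coordinates at the times in \<open>J\<close>.\<close>

definition generated :: "('w, 'e) process \<Rightarrow> real set \<Rightarrow> 'w measure" where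
  "generated S J = sigma (space (Sample S))
     {coord S u -` B \<inter> space (Sample S) | u B. u \<in> Time S \<inter> J \<and> B \<in> sets (State S)}"

text \<open>
  The assumption \<open>coord_measurable\<close> asks for joint measurability in time and sample point:
  without it the time averages of the laws of the process need not make sense. For discrete
  time it says no more than that each coordinate is a random variable.
  The \<open>\<sigma>\<close>-algebra of the metric space is not required to be the Borel one.

  Homogeneity goes through the shifts, rather than through the image laws on the product
  space \<open>Pi\<^sub>M (Time S) (\<lambda>_. State S)\<close>, because in continuous time a law on the product space
  does not determine the law of \<open>\<tau>\<^sub>A\<close>.
\<close>

locale absorbed_markov_process =
  fixes S :: "('w, 'e::metric_space) process"
  assumes time: "Time S = {0..} \<or> Time S = \<nat>"
    and state_space: "space (State S) = UNIV"
    and coord_measurable: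
      "(\<lambda>(t, w). coord S t w)
         \<in> restrict_space borel (Time S) \<Otimes>\<^sub>M Sample S \<rightarrow>\<^sub>M State S"
    and Pr_kernel: "\<And>s. s \<in> Time S \<Longrightarrow> Pr S s \<in> State S \<rightarrow>\<^sub>M prob_algebra (Sample S)"
    and Pr_start: "\<And>s x. s \<in> Time S \<Longrightarrow> AE w in Pr S s x. coord S s w = x"
    and shift_space: "\<And>s w. s \<in> Time S \<Longrightarrow> w \<in> space (Sample S) \<Longrightarrow>
      shift S s w \<in> space (Sample S)"
    and coord_shift: "\<And>s u w. s \<in> Time S \<Longrightarrow> u \<in> Time S \<Longrightarrow> w \<in> space (Sample S) \<Longrightarrow>
      coord S u (shift S s w) = coord S (s + u) w"
    and homogeneous: "\<And>s x B. s \<in> Time S \<Longrightarrow> B \<in> sets (generated S UNIV) \<Longrightarrow>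
      measure (Pr S s x) (shift S s -` B \<inter> space (Sample S)) = measure (Pr S 0 x) B"
    and markov: "\<And>s t x B. s \<in> Time S \<Longrightarrow> t \<in> Time S \<Longrightarrow> s \<le> t \<Longrightarrow>
      B \<in> sets (generated S {t..}) \<Longrightarrow>
      AE w in Pr S s x.
        real_cond_exp (Pr S s x) (generated S {s..t}) (indicator B) w =
        measure (Pr S t (coord S t w)) B"
    and absorbing_sets: "\<And>t. t \<in> Time S \<Longrightarrow> absorbing S t \<in> sets (State S)"
    and hit_stopping_time: "\<And>s t. s \<in> Time S \<Longrightarrow> t \<in> Time S \<Longrightarrow>
      {w \<in> space (Sample S). hit S s w \<le> ereal t} \<in> sets (generated S {s..t})"
    and hit_finite: "\<And>s x. s \<in> Time S \<Longrightarrow> x \<in> alive S s \<Longrightarrow>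
      AE w in Pr S s x. hit S s w < \<infinity>"
    and survival_pos: "\<And>s t x. s \<in> Time S \<Longrightarrow> t \<in> Time S \<Longrightarrow> s \<le> t \<Longrightarrow> x \<in> alive S s \<Longrightarrow>
      0 < measure (Pr S s x) (surviving S s t)"

text \<open>\<open>\<M>\<^sub>1(F)\<close>, as probability measures on the whole state space concentrated on \<open>F\<close>.\<close>

definition probs_on :: "('w, 'e) process \<Rightarrow> 'e set \<Rightarrow> 'e measure set" where
  "probs_on S F = {\<mu> \<in> space (prob_algebra (State S)). emeasure \<mu> F = 1}"

definition Pr_mix :: "('w, 'e) process \<Rightarrow> real \<Rightarrow> 'e measure \<Rightarrow> 'w measure" where
  "Pr_mix S s \<mu> = \<mu> \<bind> Pr S s"

text \<open>The law of \<open>X\<^sub>t\<close> under \<open>N\<close> conditionally on survival from time \<open>s\<close> up to time \<open>T\<close>.\<close>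

definition cond_law ::
    "('w, 'e) process \<Rightarrow> 'w measure \<Rightarrow> real \<Rightarrow> real \<Rightarrow> real \<Rightarrow> 'e measure" where
  "cond_law S N s T t = distr (uniform_measure N (surviving S s T)) (State S) (coord S t)"

definition path_space :: "('w, 'e) process \<Rightarrow> real \<Rightarrow> real \<Rightarrow> (real \<Rightarrow> 'e) measure" where
  "path_space S s t = Pi\<^sub>M (Time S \<inter> {s..t}) (\<lambda>_. State S)"

definition path :: "('w, 'e) process \<Rightarrow> real \<Rightarrow> real \<Rightarrow> 'w \<Rightarrow> real \<Rightarrow> 'e" where
  "path S s t w = (\<lambda>u\<in>Time S \<inter> {s..t}. coord S u w)"

definition cond_path_law ::
    "('w, 'e) process \<Rightarrow> 'w measure \<Rightarrow> real \<Rightarrow> real \<Rightarrow> real \<Rightarrow> (real \<Rightarrow> 'e) measure" where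
  "cond_path_law S N s T t =
     distr (uniform_measure N (surviving S s T)) (path_space S s t) (path S s t)"

text \<open>
  Weak convergence, tested on the bounded continuous functions that are measurable for the
  given \<open>\<sigma>\<close>-algebra.
\<close>

definition weakly_converges ::
    "'a topology \<Rightarrow> ('i \<Rightarrow> 'a measure) \<Rightarrow> 'a measure \<Rightarrow> 'i filter \<Rightarrow> bool" where
  "weakly_converges T M N F \<longleftrightarrow>
     (\<forall>f::'a \<Rightarrow> real. continuous_map T euclideanreal f \<and> f \<in> borel_measurable N \<and>
        bounded (f ` topspace T) \<longrightarrow>
        ((\<lambda>i. \<integral>x. f x \<partial>M i) \<longlongrightarrow> (\<integral>x. f x \<partial>N)) F)"

definition time_at_top :: "('w, 'e) process \<Rightarrow> real filter" where
  "time_at_top S = inf at_top (principal (Time S))"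

definition survival_profile ::
    "('w, 'e) process \<Rightarrow> (real \<Rightarrow> 'e \<Rightarrow> real) \<Rightarrow> bool" where
  "survival_profile S \<eta> \<longleftrightarrow> (\<forall>s\<in>Time S.
     \<eta> s \<in> borel_measurable (restrict_space (State S) (alive S s)) \<and>
     bounded (\<eta> s ` alive S s) \<and>
     (\<forall>x\<in>alive S s. 0 < \<eta> s x) \<and>
     (\<forall>x\<in>alive S s. \<forall>y\<in>alive S s.
        ((\<lambda>t. measure (Pr S s x) (surviving S s t) / measure (Pr S s y) (surviving S s t))
           \<longlongrightarrow> \<eta> s x / \<eta> s y) (time_at_top S)) \<and>
     (\<forall>t\<in>Time S. \<forall>x\<in>alive S s. s \<le> t \<longrightarrow>
        (\<integral>w. indicator (surviving S s t) w * \<eta> t (coord S t w) \<partial>Pr S s x) = \<eta> s x))"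

text \<open>
  \<open>Q s t x\<close> is the law \<open>\<Q>\<^sub>s\<^sub>,\<^sub>x(X\<^bsub>[s,t]\<^esub> \<in> \<cdot>)\<close>. The weak limit is taken for the topology of
  pointwise convergence of trajectories. As this limit need not determine a measure when
  the \<open>\<sigma>\<close>-algebra is not the Borel one, the explicit formula is part of the definition.
\<close>

definition Q_process ::
    "('w, 'e::metric_space) process \<Rightarrow> (real \<Rightarrow> real \<Rightarrow> 'e \<Rightarrow> (real \<Rightarrow> 'e) measure) \<Rightarrow> bool" where
  "Q_process S Q \<longleftrightarrow>
     (\<forall>s\<in>Time S. \<forall>t\<in>Time S. \<forall>x\<in>alive S s. s \<le> t \<longrightarrow>
        weakly_converges (product_topology (\<lambda>_. euclidean) (Time S \<inter> {s..t}))
          (\<lambda>T. cond_path_law S (Pr S s x) s T t) (Q s t x) (time_at_top S)) \<and>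
     (\<exists>\<eta>. survival_profile S \<eta> \<and>
        (\<forall>s\<in>Time S. \<forall>t\<in>Time S. \<forall>x\<in>alive S s. s \<le> t \<longrightarrow>
           Q s t x =
             distr (density (Pr S s x)
                      (\<lambda>w. ennreal (indicator (surviving S s t) w * \<eta> t (coord S t w) / \<eta> s x)))
               (path_space S s t) (path S s t)))"

text \<open>
  The law \<open>\<Q>\<^sub>s\<^sub>,\<^sub>\<mu>(X\<^sub>t \<in> \<cdot>)\<close>; mixing is over \<open>E\<^sub>s\<close> only, since \<open>Q s t x\<close> is arbitrary for \<open>x\<close>
  outside \<open>E\<^sub>s\<close>.
\<close>

definition Q_law ::
    "('w, 'e) process \<Rightarrow> (real \<Rightarrow> real \<Rightarrow> 'e \<Rightarrow> (real \<Rightarrow> 'e) measure) \<Rightarrow>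
     real \<Rightarrow> 'e measure \<Rightarrow> real \<Rightarrow> 'e measure" where
  "Q_law S Q s \<mu> t =
     distr (restrict_space \<mu> (alive S s) \<bind> Q s t) (State S) (\<lambda>p. p t)"

definition Q_invariant ::
    "('w, 'e) process \<Rightarrow> (real \<Rightarrow> real \<Rightarrow> 'e \<Rightarrow> (real \<Rightarrow> 'e) measure) \<Rightarrow>
     real \<Rightarrow> 'e measure \<Rightarrow> bool" where
  "Q_invariant S Q \<gamma> \<beta> \<longleftrightarrow>
     \<beta> \<in> probs_on S (alive S 0) \<and> (\<forall>n::nat. \<beta> = Q_law S Q 0 \<beta> (real n * \<gamma>))"

definition clock :: "('w, 'e) process \<Rightarrow> real measure" where
  "clock S = (if Time S = \<nat> then count_space \<nat> else lborel)"

text \<open>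
  The measure \<open>(1/a) \<integral>\<^sub>J \<kappa>\<^sub>s(\<cdot>) ds\<close>. With \<open>J = {0..t}\<close>, \<open>a = t\<close> in discrete time this is
  \<open>(1/n) \<Sum>k=0..n\<close>, of total mass \<open>(n+1)/n\<close>; with \<open>J = {0..<\<gamma>}\<close>, \<open>a = \<gamma>\<close> it is
  \<open>(1/\<gamma>) \<Sum>k<\<gamma>\<close>.
\<close>

definition time_average ::
    "('w, 'e) process \<Rightarrow> real \<Rightarrow> real set \<Rightarrow> (real \<Rightarrow> 'e measure) \<Rightarrow> 'e measure" where
  "time_average S a J \<kappa> = measure_of (space (State S)) (sets (State S))
     (\<lambda>B. ennreal (1 / a) * (\<integral>\<^sup>+s\<in>J. emeasure (\<kappa> s) B \<partial>clock S))"

end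

theory Submission
  imports Defs
begin

text \<open>
  Let \<open>Z s T x\<close> be the probability of surviving up to \<open>T\<close> from \<open>x\<close> at time \<open>s\<close>. Conditioning on
  survival up to \<open>T\<close> is the Doob transform of the killed semigroup by \<open>h s = Z s T\<close>, and by (A'1)
  and (A'2) every such transform satisfies a Doeblin condition with constant \<open>c = c\<^sub>1 * c\<^sub>2\<close> over
  each time step \<open>t\<^sub>0\<close>: it contracts oscillations by the factor \<open>1 - c\<close>. Applied to the
  ratios \<open>Z s T' / Z s T\<close>, the contraction shows that \<open>Z s T x / Z s T y\<close> converges uniformly
  and geometrically fast as \<open>T\<close> grows, which yields the functions \<open>\<eta>\<close>; these satisfy (A'2) in
  turn, so that the \<open>Q\<close>-process contracts as well.

  Hence the law of \<open>X\<^sub>s\<close> conditionally on survival up to \<open>T\<close> is close to the law of \<open>X\<^sub>s\<close> under the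
  \<open>Q\<close>-process if \<open>T - s\<close> is large, and the latter forgets its initial law if \<open>s\<close> is large.
  Periodicity makes the \<open>Q\<close>-process started from the invariant measure \<open>\<beta>\<close> of its
  \<open>\<gamma>\<close>-skeleton periodic in \<open>s\<close>. Away from both ends of \<open>[0, T]\<close> the conditional laws are thus close
  to a \<open>\<gamma>\<close>-periodic function of \<open>s\<close>, and their time average converges to its mean over a period.
\<close>

section \<open>Bounded measurable functions\<close>

text \<open>Doeblin's condition is out of reach for the killed kernels, whose mass decays at a rate
  depending on the starting state; in their transforms this decay cancels. The numerator of
  \<open>P s t (\<lambda>y. g y * h t y) x / h s x\<close> is at least \<open>c1 * Z s t x\<close>
  times the mean of \<open>g * h t\<close> under \<open>\<nu> t\<close> by (A'1), and (A'2) for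
  \<open>h\<close> bounds \<open>h s x\<close> by \<open>Z s t x / c2\<close> times the mean of
  \<open>h t\<close>: hence \<open>c1 * c2\<close>. Likewise survival probabilities are compared up
  to factors \<open>1 + err n\<close>, because an additive error is useless for quantities that may
  tend to 0. A profile \<open>\<eta>\<close> need not be \<open>\<gamma>\<close>-periodic: a period
  may multiply it by a constant. The transform ignores such factors, but its periodicity has to be
  inherited from the conditioned semigroups of which it is the limit. As the
  \<open>Q\<close>-process of the theorem brings a profile of its own, everything after the
  existence proof is done for an arbitrary profile. No compactness of laws is at hand, so the
  invariant measure is built as a limit of laws that is uniform over all measurable sets.\<close>

definition bounded_measurable :: "'a measure \<Rightarrow> ('a \<Rightarrow> real) \<Rightarrow> bool" where
  "bounded_measurable M f \<longleftrightarrow> f \<in> borel_measurable M \<and> (\<exists>b. \<forall>x\<in>space M. \<bar>f x\<bar> \<le> b)"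

lemma bounded_measurableI:
  "f \<in> borel_measurable M \<Longrightarrow> (\<And>x. x \<in> space M \<Longrightarrow> \<bar>f x\<bar> \<le> b) \<Longrightarrow> bounded_measurable M f"
  unfolding bounded_measurable_def by blast

lemma bounded_measurableD [dest]: "bounded_measurable M f \<Longrightarrow> f \<in> borel_measurable M"
  unfolding bounded_measurable_def by blast

lemma bounded_measurable_bound:
  assumes "bounded_measurable M f"
  obtains b where "0 < b" "\<And>x. x \<in> space M \<Longrightarrow> \<bar>f x\<bar> \<le> b"
proof -
  from assms obtain b where "\<And>x. x \<in> space M \<Longrightarrow> \<bar>f x\<bar> \<le> b"
    unfolding bounded_measurable_def by blast
  then have "\<And>x. x \<in> space M \<Longrightarrow> \<bar>f x\<bar> \<le> \<bar>b\<bar> + 1" by force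
  then show ?thesis by (intro that[of "\<bar>b\<bar> + 1"]) auto
qed

lemma bounded_measurable_const [simp, intro]: "bounded_measurable M (\<lambda>_. c)"
  by (rule bounded_measurableI[where b = "\<bar>c\<bar>"]) auto

lemma bounded_measurable_indicator [simp, intro]:
  "B \<in> sets M \<Longrightarrow> bounded_measurable M (indicator B)"
  by (rule bounded_measurableI[where b = 1]) (auto simp: indicator_def)

lemma bounded_measurable_add [intro]:
  assumes "bounded_measurable M f" "bounded_measurable M g"
  shows "bounded_measurable M (\<lambda>x. f x + g x)"
proof -
  obtain a b where a: "\<And>x. x \<in> space M \<Longrightarrow> \<bar>f x\<bar> \<le> a" and b: "\<And>x. x \<in> space M \<Longrightarrow> \<bar>g x\<bar> \<le> b"
    using assms unfolding bounded_measurable_def by meson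
  have "\<bar>f x + g x\<bar> \<le> a + b" if "x \<in> space M" for x
    using a[OF that] b[OF that] by linarith
  then show ?thesis
    using assms by (intro bounded_measurableI[where b = "a + b"] borel_measurable_add) auto
qed

lemma bounded_measurable_mult [intro]:
  assumes "bounded_measurable M f" "bounded_measurable M g"
  shows "bounded_measurable M (\<lambda>x. f x * g x)"
proof -
  obtain a b where a: "\<And>x. x \<in> space M \<Longrightarrow> \<bar>f x\<bar> \<le> a" and b: "\<And>x. x \<in> space M \<Longrightarrow> \<bar>g x\<bar> \<le> b"
    using assms unfolding bounded_measurable_def by meson
  have "\<bar>f x * g x\<bar> \<le> a * b" if "x \<in> space M" for x
    unfolding abs_mult using a[OF that] b[OF that] by (intro mult_mono) auto
  then show ?thesis
    using assms by (intro bounded_measurableI[where b = "a * b"] borel_measurable_times) auto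
qed

lemma bounded_measurable_uminus [intro]:
  "bounded_measurable M f \<Longrightarrow> bounded_measurable M (\<lambda>x. - f x)"
  unfolding bounded_measurable_def by auto

lemma bounded_measurable_diff [intro]:
  "bounded_measurable M f \<Longrightarrow> bounded_measurable M g \<Longrightarrow> bounded_measurable M (\<lambda>x. f x - g x)"
  using bounded_measurable_add[of M f "\<lambda>x. - g x"] by auto

lemma bounded_measurable_divide_const [intro]:
  "bounded_measurable M f \<Longrightarrow> bounded_measurable M (\<lambda>x. f x / c)"
  using bounded_measurable_mult[of M f "\<lambda>x. 1 / c"] by auto

lemma bounded_measurable_abs [intro]:
  "bounded_measurable M f \<Longrightarrow> bounded_measurable M (\<lambda>x. \<bar>f x\<bar>)"
  unfolding bounded_measurable_def by auto

lemma bounded_measurable_compose: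
  assumes "bounded_measurable N f" "g \<in> M \<rightarrow>\<^sub>M N"
  shows "bounded_measurable M (\<lambda>x. f (g x))"
  using assms measurable_space[OF assms(2)] unfolding bounded_measurable_def by auto

lemma bounded_measurable_cong_sets:
  assumes "sets M = sets N"
  shows "bounded_measurable M f = bounded_measurable N f"
  unfolding bounded_measurable_def sets_eq_imp_space_eq[OF assms] measurable_cong_sets[OF assms refl] ..

lemma integrable_bounded_measurable:
  assumes "finite_measure N" "sets N = sets M" "bounded_measurable M f"
  shows "integrable N f"
proof -
  interpret finite_measure N by fact
  have "bounded_measurable N f" using assms(3) bounded_measurable_cong_sets[OF assms(2)] by blast
  then obtain b where "\<And>x. x \<in> space N \<Longrightarrow> \<bar>f x\<bar> \<le> b" "f \<in> borel_measurable N"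
    using bounded_measurable_def by metis
  then show ?thesis by (intro integrable_const_bound[of _ b]) auto
qed

text \<open>Compares the extended integrals through the scaled measure
  \<open>scale_measure k L \<le> N\<close>. This is how (A'1), stated for sets, becomes a bound for
  functions.\<close>

lemma integral_mono_measure_bounded:
  assumes "finite_measure N" "finite_measure L" "sets N = sets M" "sets L = sets M"
    and f: "bounded_measurable M f" "\<And>x. x \<in> space M \<Longrightarrow> 0 \<le> f x" and "0 \<le> k"
    and le: "\<And>B. B \<in> sets M \<Longrightarrow> k * measure L B \<le> measure N B"
  shows "k * (\<integral>x. f x \<partial>L) \<le> (\<integral>x. f x \<partial>N)"
proof -
  interpret N: finite_measure N by fact
  interpret L: finite_measure L by fact
  have [simp]: "space N = space M" "space L = space M"
    by (rule sets_eq_imp_space_eq[OF assms(3)], rule sets_eq_imp_space_eq[OF assms(4)])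
  have fm: "f \<in> borel_measurable N" "f \<in> borel_measurable L"
    using f assms(3,4) by (auto simp: bounded_measurable_def cong: measurable_cong_sets)
  let ?L = "scale_measure (ennreal k) L"
  have "(\<integral>\<^sup>+x. f x \<partial>?L) \<le> (\<integral>\<^sup>+x. f x \<partial>N)"
  proof (rule nn_integral_mono_measure)
    have sets: "sets ?L = sets N" by (simp only: sets_scale_measure assms(3,4))
    show "sets ?L = sets N" by (rule sets)
    have "emeasure ?L B \<le> emeasure N B" if "B \<in> sets ?L" for B
    proof -
      have "k * measure L B \<le> measure N B" using that assms(4) by (intro le) simp
      then show ?thesis
        using \<open>0 \<le> k\<close>
        by (simp add: N.emeasure_eq_measure L.emeasure_eq_measure ennreal_mult'[symmetric] ennreal_leI)
    qed
    then show "?L \<le> N" unfolding le_measure[OF sets] by blast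
  qed
  moreover have "(\<integral>\<^sup>+x. f x \<partial>?L) = ennreal k * (\<integral>\<^sup>+x. f x \<partial>L)"
    using fm by (intro nn_integral_scale_measure) auto
  moreover have "(\<integral>\<^sup>+x. f x \<partial>L) = ennreal (\<integral>x. f x \<partial>L)"
    using f assms by (intro nn_integral_eq_integral integrable_bounded_measurable[where M=M]) auto
  moreover have "(\<integral>\<^sup>+x. f x \<partial>N) = ennreal (\<integral>x. f x \<partial>N)"
    using f assms by (intro nn_integral_eq_integral integrable_bounded_measurable[where M=M]) auto
  moreover have "0 \<le> (\<integral>x. f x \<partial>N)" "0 \<le> (\<integral>x. f x \<partial>L)"
    using f by (auto intro!: Bochner_Integration.integral_nonneg)
  ultimately show ?thesis
    using \<open>0 \<le> k\<close> by (simp add: ennreal_mult'[symmetric])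
qed

section \<open>Killed semigroups\<close>

text \<open>\<open>K s t x\<close> is the law of \<open>X\<^sub>t\<close> on the event of survival up to \<open>t\<close>, started from \<open>x\<close> at
  time \<open>s\<close>; functions on the set \<open>E s\<close> of alive states are extended by \<open>0\<close>.\<close>

locale conditioned_semigroup =
  fixes M :: "'e measure" and I :: "real set" and E :: "real \<Rightarrow> 'e set"
    and K :: "real \<Rightarrow> real \<Rightarrow> 'e \<Rightarrow> 'e measure" and \<nu> :: "real \<Rightarrow> 'e measure"
    and t0 c1 c2 :: real
  assumes I_cases: "I = {0..} \<or> I = \<nat>"
    and space_M [simp]: "space M = UNIV"
    and E_nonempty: "s \<in> I \<Longrightarrow> E s \<noteq> {}"
    and K_kernel: "s \<in> I \<Longrightarrow> t \<in> I \<Longrightarrow> s \<le> t \<Longrightarrow> K s t \<in> M \<rightarrow>\<^sub>M subprob_algebra M"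
    and K_Chapman: "s \<in> I \<Longrightarrow> t \<in> I \<Longrightarrow> u \<in> I \<Longrightarrow> s \<le> t \<Longrightarrow> t \<le> u \<Longrightarrow> K s u x = K s t x \<bind> K t u"
    and K_refl: "s \<in> I \<Longrightarrow> x \<in> E s \<Longrightarrow> K s s x = return M x"
    and K_dead: "s \<in> I \<Longrightarrow> t \<in> I \<Longrightarrow> s \<le> t \<Longrightarrow> x \<notin> E s \<Longrightarrow> measure (K s t x) UNIV = 0"
    and K_pos: "s \<in> I \<Longrightarrow> t \<in> I \<Longrightarrow> s \<le> t \<Longrightarrow> x \<in> E s \<Longrightarrow> 0 < measure (K s t x) UNIV"
    and t0: "t0 \<in> I" "0 < t0" and c1: "0 < c1" and c2: "0 < c2"
    and nu_prob: "s \<in> I \<Longrightarrow> prob_space (\<nu> s)" and nu_sets: "s \<in> I \<Longrightarrow> sets (\<nu> s) = sets M"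
    and A1: "s \<in> I \<Longrightarrow> x \<in> E s \<Longrightarrow> B \<in> sets M \<Longrightarrow>
      c1 * measure (K s (s + t0) x) UNIV * measure (\<nu> (s + t0)) B \<le> measure (K s (s + t0) x) B"
    and A2: "s \<in> I \<Longrightarrow> t \<in> I \<Longrightarrow> s \<le> t \<Longrightarrow> x \<in> E s \<Longrightarrow>
      c2 * measure (K s t x) UNIV \<le> (\<integral>y. measure (K s t y) UNIV \<partial>\<nu> s)"
begin

abbreviation "bm \<equiv> bounded_measurable M"

definition P :: "real \<Rightarrow> real \<Rightarrow> ('e \<Rightarrow> real) \<Rightarrow> 'e \<Rightarrow> real" where
  "P s t f x = (\<integral>y. f y \<partial>K s t x)"

definition Z :: "real \<Rightarrow> real \<Rightarrow> 'e \<Rightarrow> real" where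
  "Z s t x = measure (K s t x) UNIV"

lemma I_nonneg: "s \<in> I \<Longrightarrow> 0 \<le> s" using I_cases by (auto simp: Nats_altdef1)
lemma I_zero [simp]: "0 \<in> I" using I_cases by auto
lemma I_add: "s \<in> I \<Longrightarrow> t \<in> I \<Longrightarrow> s + t \<in> I" using I_cases by auto
lemma I_diff: "s \<in> I \<Longrightarrow> t \<in> I \<Longrightarrow> s \<le> t \<Longrightarrow> t - s \<in> I" using I_cases by auto
lemma I_mult: "t \<in> I \<Longrightarrow> real n * t \<in> I" using I_cases by auto
lemma I_step: "s \<in> I \<Longrightarrow> s + real n * t0 \<in> I" using t0 by (intro I_add I_mult)

context
  fixes s t assumes st: "s \<in> I" "t \<in> I" "s \<le> t"
begin

lemma K_sets [simp]: "sets (K s t x) = sets M" and K_subprob: "subprob_space (K s t x)"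
  using measurable_space[OF K_kernel[OF st], of x] by (auto simp: space_subprob_algebra)

lemma K_space [simp]: "space (K s t x) = UNIV"
  using sets_eq_imp_space_eq[OF K_sets[of x]] by simp

lemma K_finite: "finite_measure (K s t x)"
  using K_subprob[of x] by (simp add: subprob_space_def)

lemma K_integrable: "bm f \<Longrightarrow> integrable (K s t x) f"
  by (rule integrable_bounded_measurable[OF K_finite K_sets])

lemma P_mono: "bm f \<Longrightarrow> bm g \<Longrightarrow> (\<And>y. f y \<le> g y) \<Longrightarrow> P s t f x \<le> P s t g x"
  unfolding P_def by (intro integral_mono K_integrable) auto

lemma P_diff: "bm f \<Longrightarrow> bm g \<Longrightarrow> P s t (\<lambda>y. f y - g y) x = P s t f x - P s t g x"
  unfolding P_def by (intro Bochner_Integration.integral_diff K_integrable)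

lemma P_cmult: "P s t (\<lambda>y. c * f y) x = c * P s t f x"
  unfolding P_def by (rule integral_mult_right_zero)

lemma P_one: "P s t (\<lambda>_. 1) x = Z s t x"
  unfolding P_def Z_def by simp

lemma Z_nonneg: "0 \<le> Z s t x" unfolding Z_def by simp

lemma Z_le_1: "Z s t x \<le> 1"
  unfolding Z_def using subprob_space.subprob_measure_le_1[OF K_subprob] by simp

lemma Z_pos: "x \<in> E s \<Longrightarrow> 0 < Z s t x"
  unfolding Z_def using K_pos st by simp

lemma Z_dead: "x \<notin> E s \<Longrightarrow> Z s t x = 0"
  unfolding Z_def using K_dead st by simp

lemma P_dead:
  assumes "x \<notin> E s"
  shows "P s t f x = 0"
proof -
  interpret finite_measure "K s t x" by (rule K_finite)
  have "emeasure (K s t x) (space (K s t x)) = 0"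
    using K_dead[OF st assms] by (simp add: emeasure_eq_measure)
  then have "AE y in K s t x. f y = 0"
    by (meson AE_iff_null_sets emeasure_0_AE)
  then show ?thesis unfolding P_def
    using integral_eq_zero_AE by blast
qed

lemma P_measurable: "bm f \<Longrightarrow> P s t f \<in> borel_measurable M"
  unfolding P_def
  by (rule measurable_compose[OF K_kernel[OF st] integral_measurable_subprob_algebra]) auto

lemma P_bounds:
  assumes "bm f" "\<And>y. \<bar>f y\<bar> \<le> b"
  shows "\<bar>P s t f x\<bar> \<le> b * Z s t x"
proof -
  have "\<bar>P s t f x\<bar> \<le> (\<integral>y. b \<partial>K s t x)"
    unfolding P_def
    using assms
    by (intro order_trans[OF integral_abs_bound] integral_mono K_integrable)
      auto
  also have "\<dots> = b * Z s t x" unfolding Z_def by simp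
  finally show ?thesis .
qed

lemma bm_P: assumes "bm f" shows "bm (P s t f)"
proof -
  from assms obtain b where b: "0 < b" "\<And>x. \<bar>f x\<bar> \<le> b"
    using bounded_measurable_bound by (metis UNIV_I space_M)
  show ?thesis
  proof (rule bounded_measurableI[where b = b])
    fix x
    have "\<bar>P s t f x\<bar> \<le> b * Z s t x" using assms b by (intro P_bounds)
    also have "\<dots> \<le> b * 1" using b Z_le_1 by (intro mult_left_mono) auto
    finally show "\<bar>P s t f x\<bar> \<le> b" by simp
  qed (rule P_measurable[OF assms])
qed

lemma bm_Z: "bm (Z s t)"
proof -
  have "P s t (\<lambda>_. 1) = Z s t" by (rule ext) (rule P_one)
  then show ?thesis using bm_P[of "\<lambda>_. 1"] by simp
qed

end

lemma P_Chapman: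
  assumes "s \<in> I" "t \<in> I" "u \<in> I" "s \<le> t" "t \<le> u" "bm f"
  shows "P s u f x = P s t (P t u f) x"
proof -
  obtain b where b: "\<And>x. \<bar>f x\<bar> \<le> b" using bounded_measurable_bound[OF assms(6)] by (metis UNIV_I space_M)
  have tu: "K t u \<in> measurable (K s t x) (subprob_algebra M)"
    using K_kernel[of t u] K_sets[of s t x] assms by (simp cong: measurable_cong_sets)
  show ?thesis
    unfolding P_def K_Chapman[OF assms(1-5)]
    using assms b
    by (intro integral_bind[where K = M and B = b and B' = 1] tu K_finite)
       (auto intro!: AE_I2 subprob_space.subprob_emeasure_le_1 K_subprob)
qed

lemma P_Z: "s \<in> I \<Longrightarrow> t \<in> I \<Longrightarrow> u \<in> I \<Longrightarrow> s \<le> t \<Longrightarrow> t \<le> u \<Longrightarrow> P s t (Z t u) x = Z s u x"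
  using P_Chapman[of s t u "\<lambda>_. 1" x] by (simp add: P_def Z_def)

lemma P_refl: "s \<in> I \<Longrightarrow> bm f \<Longrightarrow> x \<in> E s \<Longrightarrow> P s s f x = f x"
  unfolding P_def using K_refl[of s x] by (simp add: integral_return bounded_measurableD)

lemma P_refl_cong:
  assumes "s \<in> I" "bm f" "bm g" "\<And>x. x \<in> E s \<Longrightarrow> f x = g x"
  shows "P s s f = P s s g"
proof
  fix x show "P s s f x = P s s g x"
    using assms by (cases "x \<in> E s") (simp_all add: P_refl P_dead)
qed

text \<open>By Chapman-Kolmogorov \<open>K t t\<close> may be appended at the end, and it erases the
  values of a function off \<open>E t\<close>; so \<open>K s t x\<close> charges only
  \<open>E t\<close>.\<close>

lemma P_cong:
  assumes "s \<in> I" "t \<in> I" "s \<le> t" "bm f" "bm g" "\<And>x. x \<in> E t \<Longrightarrow> f x = g x"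
  shows "P s t f x = P s t g x"
  using P_Chapman[of s t t f x] P_Chapman[of s t t g x] P_refl_cong[of t f g] assms by simp

lemma Z_refl: "s \<in> I \<Longrightarrow> Z s s x = indicator (E s) x"
  using P_refl[of s "\<lambda>_. 1" x] P_one[of s s x] Z_dead[of s s x] by (cases "x \<in> E s") auto

text \<open>At equal times the survival probability is the indicator of \<open>E s\<close>, so
  \<open>E s\<close> is a level set of a measurable function.\<close>

lemma E_sets: "s \<in> I \<Longrightarrow> E s \<in> sets M"
proof -
  assume s: "s \<in> I"
  have "E s = {x \<in> space M. Z s s x = 1}" using Z_refl[OF s] by (auto simp: indicator_def)
  also have "\<dots> \<in> sets M" using bm_Z[of s s] s by (intro borel_measurable_eq) auto
  finally show ?thesis .
qed

lemma nu_finite: "s \<in> I \<Longrightarrow> finite_measure (\<nu> s)"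
  using nu_prob by (simp add: prob_space_def)

lemma nu_integrable: "s \<in> I \<Longrightarrow> bm f \<Longrightarrow> integrable (\<nu> s) f"
  by (rule integrable_bounded_measurable[OF nu_finite nu_sets])

lemma nu_nonneg: "(\<And>y. 0 \<le> f y) \<Longrightarrow> 0 \<le> (\<integral>y. f y \<partial>\<nu> s)" for f :: "_ \<Rightarrow> real"
  by (rule Bochner_Integration.integral_nonneg) auto

lemma A2': "s \<in> I \<Longrightarrow> t \<in> I \<Longrightarrow> s \<le> t \<Longrightarrow> c2 * Z s t x \<le> (\<integral>y. Z s t y \<partial>\<nu> s)"
  using A2[of s t x] Z_dead[of s t x] nu_nonneg[of "Z s t" s] Z_nonneg[of s t]
  by (cases "x \<in> E s") (auto simp: Z_def)

lemma minorization_step: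
  assumes "s \<in> I" "bm f" "\<And>y. 0 \<le> f y"
  shows "c1 * Z s (s + t0) x * (\<integral>y. f y \<partial>\<nu> (s + t0)) \<le> P s (s + t0) f x"
proof (cases "x \<in> E s")
  case True
  have I: "s + t0 \<in> I" "s \<le> s + t0" using assms t0 I_add by auto
  show ?thesis
    unfolding P_def Z_def
    using assms I True c1
    by (intro integral_mono_measure_bounded[where M = M] K_finite nu_finite A1 K_sets nu_sets) auto
next
  case False
  then show ?thesis using assms t0 I_add by (simp add: Z_dead P_dead)
qed

text \<open>Only the last stretch of length \<open>t0\<close>, from \<open>r\<close> to
  \<open>t\<close>, is minorized. Averaging that bound over \<open>K s r x\<close> turns the factor
  \<open>Z r t\<close> into \<open>Z s t x\<close>, so the constant does not degrade with
  \<open>t - s\<close>.\<close>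

lemma minorization:
  assumes "s \<in> I" "t \<in> I" "s + t0 \<le> t" "bm f" "\<And>y. 0 \<le> f y"
  shows "c1 * Z s t x * (\<integral>y. f y \<partial>\<nu> t) \<le> P s t f x"
proof -
  define r where "r = t - t0"
  have r: "r \<in> I" "s \<le> r" "r \<le> t" "t = r + t0"
    using assms t0 I_nonneg[of s] unfolding r_def by (auto intro!: I_diff)
  let ?c = "c1 * (\<integral>y. f y \<partial>\<nu> t)"
  have "P s r (\<lambda>y. ?c * Z r t y) x \<le> P s r (P r t f) x"
    using assms r minorization_step[of r f]
    by (intro P_mono bm_P bounded_measurable_mult bm_Z) (auto simp: mult_ac)
  then show ?thesis
    using P_Chapman[of s r t f x] assms r P_Z[of s r t x] by (simp add: P_cmult mult_ac)
qed

definition c :: real where "c = c1 * c2"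

lemma c_pos: "0 < c" unfolding c_def using c1 c2 by simp

text \<open>Testing (A'1) on the constant function 1 gives \<open>c1 \<le> 1\<close>. Integrating
  (A'2) at \<open>s = t = 0\<close> against \<open>\<nu> 0\<close> gives
  \<open>c2 * m \<le> m\<close> with \<open>m\<close> the mean of \<open>Z 0 0\<close>, and
  \<open>m\<close> is positive by (A'2) at an alive state.\<close>

lemma c_le_1: "c \<le> 1"
proof -
  obtain x where x: "x \<in> E 0" using E_nonempty[of 0] by auto
  have I: "0 \<le> t0" "t0 \<in> I" using t0 by auto
  have "c1 * Z 0 t0 x * (\<integral>y. 1 \<partial>\<nu> t0) \<le> P 0 t0 (\<lambda>_. 1) x"
    using I by (intro minorization) auto
  then have 1: "c1 \<le> 1"
    using I x P_one[of 0 t0] Z_pos[of 0 t0 x] nu_prob[of t0] nu_sets[of t0] prob_space.prob_space[of "\<nu> t0"]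
    by simp
  have "(\<integral>y. c2 * Z 0 0 y \<partial>\<nu> 0) \<le> (\<integral>y. (\<integral>y. Z 0 0 y \<partial>\<nu> 0) \<partial>\<nu> 0)"
    by (intro integral_mono nu_integrable bounded_measurable_mult bm_Z A2') auto
  then have 2: "c2 * (\<integral>y. Z 0 0 y \<partial>\<nu> 0) \<le> (\<integral>y. Z 0 0 y \<partial>\<nu> 0)"
    using nu_prob[of 0] prob_space.prob_space[of "\<nu> 0"] by simp
  have "0 < c2 * Z 0 0 x" using x c2 Z_pos[of 0 0 x] by simp
  also have "\<dots> \<le> (\<integral>y. Z 0 0 y \<partial>\<nu> 0)" by (intro A2') auto
  finally have "c2 \<le> 1" using 2 by simp
  with 1 c1 c2 show ?thesis unfolding c_def by (simp add: mult_le_one)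
qed

section \<open>Contraction of the Doob transforms\<close>

text \<open>Space-time harmonic functions of the killed semigroup. The inequality with
  \<open>c2\<close> is (A'2) for \<open>h\<close>; it belongs to the notion because the minorization
  of the transform rests on it. The horizon \<open>T\<close> is there because \<open>Z r T\<close>
  is harmonic in \<open>r\<close> only up to \<open>T\<close>.\<close>

definition harmonic :: "real \<Rightarrow> (real \<Rightarrow> 'e \<Rightarrow> real) \<Rightarrow> bool" where
  "harmonic T h \<longleftrightarrow> (\<forall>r\<in>I. r \<le> T \<longrightarrow>
     bm (h r) \<and> (\<forall>x\<in>E r. 0 < h r x) \<and> (\<forall>x. x \<notin> E r \<longrightarrow> h r x = 0) \<and>
     (\<forall>x. c2 * h r x \<le> (\<integral>y. h r y \<partial>\<nu> r)) \<and>
     (\<forall>u\<in>I. r \<le> u \<longrightarrow> u \<le> T \<longrightarrow> (\<forall>x. P r u (h u) x = h r x)))"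

lemma harmonicD:
  assumes "harmonic T h" "r \<in> I" "r \<le> T"
  shows "bm (h r)" "x \<in> E r \<Longrightarrow> 0 < h r x" "x \<notin> E r \<Longrightarrow> h r x = 0" "0 \<le> h r x"
    "c2 * h r x \<le> (\<integral>y. h r y \<partial>\<nu> r)"
    "u \<in> I \<Longrightarrow> r \<le> u \<Longrightarrow> u \<le> T \<Longrightarrow> P r u (h u) x = h r x"
proof -
  from assms show "bm (h r)" and 1: "x \<in> E r \<Longrightarrow> 0 < h r x" and 2: "x \<notin> E r \<Longrightarrow> h r x = 0"
    and "c2 * h r x \<le> (\<integral>y. h r y \<partial>\<nu> r)"
    and "u \<in> I \<Longrightarrow> r \<le> u \<Longrightarrow> u \<le> T \<Longrightarrow> P r u (h u) x = h r x"
    unfolding harmonic_def by blast+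
  from 1 2 show "0 \<le> h r x" by (cases "x \<in> E r") auto
qed

lemma harmonic_Z: "T \<in> I \<Longrightarrow> harmonic T (\<lambda>r. Z r T)"
  unfolding harmonic_def
  by (intro ballI impI allI conjI) (auto simp: P_Z Z_dead intro!: bm_Z A2' Z_pos)

text \<open>Off \<open>E s\<close> numerator and denominator both vanish, and \<open>0 / 0 = 0\<close>. With \<open>h r = Z r T\<close> this is
  the semigroup conditioned on survival up to \<open>T\<close>; with \<open>h = \<eta>\<close> it is that of the \<open>Q\<close>-process.\<close>

definition doob :: "(real \<Rightarrow> 'e \<Rightarrow> real) \<Rightarrow> real \<Rightarrow> real \<Rightarrow> ('e \<Rightarrow> real) \<Rightarrow> 'e \<Rightarrow> real" where
  "doob h s u f x = P s u (\<lambda>y. f y * h u y) x / h s x"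

context
  fixes h u assumes h: "harmonic u h" and u: "u \<in> I"
begin

text \<open>Off \<open>E s\<close> both sides vanish, so the division can be undone without a case
  distinction on \<open>x\<close>.\<close>

lemma doob_mult:
  assumes "s \<in> I" "s \<le> u"
  shows "doob h s u f x * h s x = P s u (\<lambda>y. f y * h u y) x"
  using harmonicD(2,3)[OF h assms, of x] P_dead[of s u x] assms u
  by (cases "x \<in> E s") (auto simp: doob_def)

text \<open>Harmonicity, \<open>P s u (h u) = h s\<close>, makes the transform a Markov kernel on
  the alive states, and averages stay between the bounds.\<close>

lemma doob_bounds:
  assumes s: "s \<in> I" "s \<le> u" and f: "bm f" "\<And>x. x \<in> E u \<Longrightarrow> a \<le> f x \<and> f x \<le> b" and x: "x \<in> E s"
  shows "a \<le> doob h s u f x \<and> doob h s u f x \<le> b"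
proof -
  note hu = harmonicD[OF h u order.refl] and hs = harmonicD[OF h s]
  have ay: "a * h u y \<le> f y * h u y \<and> f y * h u y \<le> b * h u y" for y
    using f(2)[of y] hu(3,4)[of y] by (cases "y \<in> E u") (auto intro!: mult_right_mono)
  have "P s u (\<lambda>y. a * h u y) x \<le> P s u (\<lambda>y. f y * h u y) x"
    "P s u (\<lambda>y. f y * h u y) x \<le> P s u (\<lambda>y. b * h u y) x"
    using s u f(1) ay hu(1) by (auto intro!: P_mono)
  then have "a * h s x \<le> P s u (\<lambda>y. f y * h u y) x" "P s u (\<lambda>y. f y * h u y) x \<le> b * h s x"
    using hs(6)[OF u s(2) order.refl, of x] s u by (auto simp: P_cmult)
  then show ?thesis
    using hs(2)[OF x] by (simp add: doob_def pos_le_divide_eq pos_divide_le_eq)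
qed

lemma doob_off: "s \<in> I \<Longrightarrow> s \<le> u \<Longrightarrow> x \<notin> E s \<Longrightarrow> doob h s u f x = 0"
  using harmonicD(3)[OF h] by (simp add: doob_def)

lemma bm_doob:
  assumes s: "s \<in> I" "s \<le> u" and f: "bm f"
  shows "bm (doob h s u f)"
proof -
  obtain b where b: "0 < b" "\<And>x. \<bar>f x\<bar> \<le> b"
    using bounded_measurable_bound[OF f] by (metis UNIV_I space_M)
  show ?thesis
  proof (rule bounded_measurableI[where b = b])
    have "P s u (\<lambda>y. f y * h u y) \<in> borel_measurable M" "h s \<in> borel_measurable M"
      using s u f harmonicD(1)[OF h] by (auto intro!: P_measurable)
    then show "doob h s u f \<in> borel_measurable M"
      unfolding doob_def[abs_def] by (rule borel_measurable_divide)
    fix x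
    have "- b \<le> f x \<and> f x \<le> b" for x using b(2)[of x] by linarith
    then have "- b \<le> doob h s u f x \<and> doob h s u f x \<le> b" if "x \<in> E s"
      using that f s by (intro doob_bounds) auto
    then show "\<bar>doob h s u f x\<bar> \<le> b"
      using b(1) s doob_off[of s x] by (cases "x \<in> E s") auto
  qed
qed

text \<open>The outer transform multiplies by the \<open>h r\<close> that the inner one divides by,
  and Chapman-Kolmogorov for \<open>P\<close> remains.\<close>

lemma doob_Chapman:
  assumes "s \<in> I" "r \<in> I" "s \<le> r" "r \<le> u" "bm f"
  shows "doob h s u f x = doob h s r (doob h r u f) x"
proof -
  have "P s u (\<lambda>y. f y * h u y) x = P s r (P r u (\<lambda>y. f y * h u y)) x"
    using assms u harmonicD(1)[OF h u order.refl] by (intro P_Chapman) auto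
  then show ?thesis
    using assms u unfolding doob_def[of h s] by (simp add: doob_mult)
qed

end

lemma harmonic_le: "harmonic T h \<Longrightarrow> r \<le> T \<Longrightarrow> harmonic r h"
  unfolding harmonic_def by (meson order_trans)

text \<open>Both \<open>f - a\<close> and \<open>b - f\<close> are nonnegative on alive states, and
  the minorization \<open>key\<close> keeps at least the share \<open>c\<close> of their means under
  \<open>\<nu>\<close> weighted by \<open>h\<close>. These means are \<open>m / n - a\<close> and
  \<open>b - m / n\<close>; they add up to \<open>b - a\<close> wherever \<open>m / n\<close> lies,
  so the interval loses exactly \<open>c * (b - a)\<close>. Its ends do not depend on
  \<open>x\<close>.\<close>

lemma doob_step:
  assumes h: "harmonic (s + t0) h" and s: "s \<in> I"
    and f: "bm f" "\<And>x. x \<in> E (s + t0) \<Longrightarrow> a \<le> f x \<and> f x \<le> b"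
  shows "\<exists>a' b'. b' - a' = (1 - c) * (b - a) \<and>
    (\<forall>x\<in>E s. a' \<le> doob h s (s + t0) f x \<and> doob h s (s + t0) f x \<le> b')"
proof -
  define t where "t = s + t0"
  have t: "t \<in> I" "s \<le> t" using s t0 I_add by (auto simp: t_def)
  note ht = harmonicD[OF h[folded t_def] t(1) order.refl] and hs = harmonicD[OF h[folded t_def] s t(2)]
  define n where "n = (\<integral>y. h t y \<partial>\<nu> t)"
  define m where "m = (\<integral>y. f y * h t y \<partial>\<nu> t)"
  \<comment> \<open>The mean \<open>n\<close> is a denominator below; (A'2) for \<open>h\<close> at
    any alive state makes it positive.\<close>
  obtain x0 where "x0 \<in> E t" using E_nonempty[OF t(1)] by auto
  then have n: "0 < n" using ht(2,5)[of x0] c2 unfolding n_def by (smt (verit) mult_pos_pos)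
  \<comment> \<open>Doeblin minorization: (A'2) bounds \<open>h s x\<close> by \<open>Z s t x\<close> times the mean \<open>n\<close> of \<open>h t\<close> under \<open>\<nu> t\<close>\<close>
  have key: "c * (\<integral>y. g y * h t y \<partial>\<nu> t) / n \<le> doob h s t g x"
    if g: "bm g" "\<And>y. y \<in> E t \<Longrightarrow> 0 \<le> g y" and x: "x \<in> E s" for g x
  proof -
    have nn: "0 \<le> g y * h t y" for y
      using g(2)[of y] ht(3,4)[of y] by (cases "y \<in> E t") auto
    have "h s x = P s t (h t) x" using hs(6) t by simp
    also have "\<dots> \<le> P s t (\<lambda>_. n / c2) x"
      using ht(1,5) c2 t s by (intro P_mono) (auto simp: n_def field_simps)
    also have "\<dots> = n / c2 * Z s t x" using P_cmult[OF s t, of "n / c2" "\<lambda>_. 1" x] P_one[OF s t] by simp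
    finally have hZ: "h s x * c2 / n \<le> Z s t x" using n c2 by (simp add: field_simps)
    have "c1 * (h s x * c2 / n) * (\<integral>y. g y * h t y \<partial>\<nu> t) \<le> c1 * Z s t x * (\<integral>y. g y * h t y \<partial>\<nu> t)"
      using hZ c1 nu_nonneg[OF nn] by (intro mult_right_mono mult_left_mono) auto
    also have "\<dots> \<le> P s t (\<lambda>y. g y * h t y) x"
      using s g ht(1) nn minorization_step[of s "\<lambda>y. g y * h t y" x] by (auto simp: t_def)
    finally show ?thesis using hs(2)[OF x] by (simp add: doob_def c_def field_simps)
  qed
  have lin: "doob h s t (\<lambda>y. f y - k) x = doob h s t f x - k"
    "doob h s t (\<lambda>y. k - f y) x = k - doob h s t f x" if "x \<in> E s" for k x
  proof -
    have "P s t (\<lambda>y. f y * h t y - k * h t y) x = P s t (\<lambda>y. f y * h t y) x - k * h s x"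
      "P s t (\<lambda>y. k * h t y - f y * h t y) x = k * h s x - P s t (\<lambda>y. f y * h t y) x"
      using s t f(1) ht(1) hs(6)[of t x] by (subst P_diff; auto simp: P_cmult)+
    then show "doob h s t (\<lambda>y. f y - k) x = doob h s t f x - k"
      "doob h s t (\<lambda>y. k - f y) x = k - doob h s t f x"
      using hs(2)[OF that] by (auto simp: doob_def diff_divide_distrib left_diff_distrib)
  qed
  have nlin: "(\<integral>y. (f y - k) * h t y \<partial>\<nu> t) = m - k * n" "(\<integral>y. (k - f y) * h t y \<partial>\<nu> t) = k * n - m" for k
    using t f(1) ht(1) unfolding m_def n_def left_diff_distrib
    by (subst Bochner_Integration.integral_diff; auto intro!: nu_integrable)+
  show ?thesis
  proof (intro exI conjI ballI)
    fix x assume x: "x \<in> E s"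
    have "c * (m - a * n) / n \<le> doob h s t f x - a"
      unfolding nlin[symmetric] lin(1)[OF x, symmetric]
      using f x by (intro key) (auto simp: t_def)
    moreover have "c * (b * n - m) / n \<le> b - doob h s t f x"
      unfolding nlin[symmetric] lin(2)[OF x, symmetric]
      using f x by (intro key) (auto simp: t_def)
    ultimately show "a + c * (m / n - a) \<le> doob h s (s + t0) f x"
      "doob h s (s + t0) f x \<le> b - c * (b - m / n)"
      using n by (auto simp: t_def field_simps)
  qed (simp add: algebra_simps)
qed

text \<open>Each induction step peels off the first stretch of length \<open>t0\<close>. The base
  case uses only that the transform averages, so time left over beyond the \<open>n\<close>
  stretches costs nothing.\<close>

lemma contraction:
  assumes u: "u \<in> I" and h: "harmonic u h" and f: "bm f" "\<And>x. x \<in> E u \<Longrightarrow> a \<le> f x \<and> f x \<le> b"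
  shows "s \<in> I \<Longrightarrow> s + real n * t0 \<le> u \<Longrightarrow> \<exists>a' b'. b' - a' = (1 - c) ^ n * (b - a) \<and>
    (\<forall>x\<in>E s. a' \<le> doob h s u f x \<and> doob h s u f x \<le> b')"
proof (induction n arbitrary: s)
  case 0
  have "a \<le> doob h s u f x \<and> doob h s u f x \<le> b" if "x \<in> E s" for x
    using 0 f that by (intro doob_bounds[OF h u]) auto
  then show ?case by (intro exI[of _ a] exI[of _ b]) auto
next
  case (Suc n)
  define r where "r = s + t0"
  have le: "0 \<le> real n * t0" using t0 by simp
  have rn: "r + real n * t0 \<le> u" using Suc.prems(2) by (simp add: r_def algebra_simps)
  have "r \<le> u" using rn le by linarith
  then have r: "r \<in> I" "s \<le> r" "r + real n * t0 \<le> u" "r \<le> u"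
    using Suc.prems(1) t0 I_add[of s t0] rn by (simp_all add: r_def)
  obtain a1 b1 where 1: "b1 - a1 = (1 - c) ^ n * (b - a)"
    "\<And>x. x \<in> E r \<Longrightarrow> a1 \<le> doob h r u f x \<and> doob h r u f x \<le> b1"
    using Suc.IH[OF r(1,3)] by blast
  obtain a2 b2 where 2: "b2 - a2 = (1 - c) * (b1 - a1)"
    "\<And>x. x \<in> E s \<Longrightarrow> a2 \<le> doob h s r (doob h r u f) x \<and> doob h s r (doob h r u f) x \<le> b2"
    using doob_step[of s h "doob h r u f" a1 b1] harmonic_le[OF h r(4)] Suc.prems(1) 1(2)
      bm_doob[OF h u r(1,4) f(1)] unfolding r_def by blast
  show ?case
    using 1(1) 2 r Suc.prems doob_Chapman[OF h u Suc.prems(1) r(1,2,4) f(1)]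
    by (intro exI[of _ a2] exI[of _ b2]) auto
qed

section \<open>Geometric convergence of the survival ratios, uniformly in the starting state\<close>

definition err :: "nat \<Rightarrow> real" where "err n = (1 - c) ^ n / c"

lemma err_nonneg: "0 \<le> err n" using c_pos c_le_1 by (simp add: err_def)

lemma rate_tendsto: "(\<lambda>n. (1 - c) ^ n) \<longlonglongrightarrow> 0"
  using c_pos c_le_1 by (intro LIMSEQ_power_zero) auto

lemma err_tendsto: "err \<longlonglongrightarrow> 0"
  unfolding err_def using tendsto_divide[OF rate_tendsto tendsto_const[of c]] c_pos by simp

text \<open>The quotient of \<open>Z s T' x\<close> by \<open>Z s T x\<close> is the transform of
  \<open>f = Z T T'\<close>. By (A'2) \<open>f\<close> is at most \<open>N / c2\<close>, so
  contraction confines the quotients to an interval of length \<open>(1 - c) ^ n * (N / c2)\<close>.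
  By (A'1) each quotient is at least \<open>c1 * N\<close>. Thus \<open>N\<close> cancels and the
  additive bound becomes the relative error \<open>err n\<close>; this is the origin of the division
  by \<open>c\<close> in \<open>err\<close>.\<close>

lemma Z_compare:
  assumes s: "s \<in> I" and T: "T \<in> I" "T' \<in> I" "s + t0 \<le> T" "s + real n * t0 \<le> T" "T \<le> T'"
    and x: "x \<in> E s" and y: "y \<in> E s"
  shows "Z s T' x * Z s T y \<le> (1 + err n) * (Z s T x * Z s T' y)"
proof -
  have sT: "s \<le> T" "s \<le> T'" using T t0 by auto
  define f where "f = Z T T'"
  define N where "N = (\<integral>y. f y \<partial>\<nu> T)"
  have f: "bm f" "\<And>x. 0 \<le> f x" "\<And>x. c2 * f x \<le> N"
    using T by (auto simp: f_def N_def Z_nonneg intro!: bm_Z A2')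
  have d: "doob (\<lambda>r. Z r T) s T f z = Z s T' z / Z s T z" for z
  proof -
    \<comment> \<open>\<open>Z T T\<close> is the indicator of \<open>E T\<close>, which carries
      \<open>K s T z\<close>.\<close>
    have "P s T (\<lambda>y. f y * Z T T y) z = P s T f z"
    proof (rule P_cong)
      show "bm (\<lambda>y. f y * Z T T y)" using f T by (intro bounded_measurable_mult bm_Z) auto
    qed (use s T sT f in \<open>auto simp: Z_refl\<close>)
    then show ?thesis using s T sT by (simp add: doob_def f_def P_Z)
  qed
  obtain a b where ab: "b - a = (1 - c) ^ n * (N / c2 - 0)"
    "\<And>z. z \<in> E s \<Longrightarrow> a \<le> Z s T' z / Z s T z \<and> Z s T' z / Z s T z \<le> b"
  proof -
    have "0 \<le> f z \<and> f z \<le> N / c2" for z using f(2,3)[of z] c2 by (simp add: field_simps)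
    then show ?thesis
      using contraction[OF T(1) harmonic_Z[OF T(1)] f(1), of 0 "N / c2" s n] s T(4) that
      unfolding d by blast
  qed
  have "c1 * Z s T y * N \<le> P s T f y"
    unfolding N_def using s T f by (intro minorization) auto
  then have "c1 * Z s T y * N \<le> Z s T' y" using s T sT by (simp add: f_def P_Z)
  moreover have Zp: "0 < Z s T y" "0 < Z s T x" using s T sT x y by (auto intro: Z_pos)
  ultimately have low: "c1 * N \<le> Z s T' y / Z s T y" by (simp add: field_simps)
  have "Z s T' x / Z s T x \<le> Z s T' y / Z s T y + (1 - c) ^ n * (N / c2)"
    using ab(1) ab(2)[OF x] ab(2)[OF y] by simp
  also have "(1 - c) ^ n * (N / c2) = err n * (c1 * N)"
    using c1 c2 by (simp add: err_def c_def)
  also have "\<dots> \<le> err n * (Z s T' y / Z s T y)"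
    using low err_nonneg by (intro mult_left_mono)
  finally have "Z s T' x / Z s T x \<le> (1 + err n) * (Z s T' y / Z s T y)"
    by (simp only: distrib_right mult_1)
  then show ?thesis using Zp by (simp add: field_simps)
qed

definition F :: "real filter" where "F = inf at_top (principal I)"

lemma eventually_F: "eventually Q F \<longleftrightarrow> (\<exists>N. \<forall>t\<in>I. N \<le> t \<longrightarrow> Q t)"
  unfolding F_def eventually_inf_principal eventually_at_top_linorder by blast

lemma I_unbounded: "\<exists>t\<in>I. N \<le> t"
proof -
  obtain n where "N < real n * t0" using ex_less_of_nat_mult[OF t0(2)] by blast
  then show ?thesis using I_mult[OF t0(1), of n] by (intro bexI[of _ "real n * t0"]) auto
qed

lemma F_neq_bot [simp]: "F \<noteq> bot"
  using eventually_F[of "\<lambda>_. False"] I_unbounded unfolding trivial_limit_def by auto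

lemma eventually_F_ge: "eventually (\<lambda>t. t \<in> I \<and> N \<le> t) F"
  unfolding eventually_F by blast

lemma filterlim_steps: "s \<in> I \<Longrightarrow> filterlim (\<lambda>n. s + real n * t0) F sequentially"
proof -
  assume s: "s \<in> I"
  have "filterlim (\<lambda>n. s + real n * t0) at_top sequentially"
    by (rule filterlim_tendsto_add_at_top[OF tendsto_const])
      (rule filterlim_at_top_mult_tendsto_pos[OF tendsto_const t0(2) filterlim_real_sequentially])
  then show ?thesis
    unfolding F_def filterlim_inf filterlim_principal using I_step[OF s] by auto
qed

text \<open>This fixes \<open>l\<close> only up to a positive factor. The factors that make the
  family over all \<open>s\<close> harmonic are chosen in \<open>ex_profile\<close>.\<close>

definition ratio_limit :: "real \<Rightarrow> ('e \<Rightarrow> real) \<Rightarrow> bool" where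
  "ratio_limit s l \<longleftrightarrow> bm l \<and> (\<forall>x\<in>E s. 0 < l x) \<and> (\<forall>x. x \<notin> E s \<longrightarrow> l x = 0) \<and>
     (\<forall>x\<in>E s. \<forall>y\<in>E s. ((\<lambda>t. Z s t x / Z s t y) \<longlongrightarrow> l x / l y) F)"

lemma ratio_limitD:
  assumes "ratio_limit s l"
  shows "bm l" "x \<in> E s \<Longrightarrow> 0 < l x" "x \<notin> E s \<Longrightarrow> l x = 0" "0 \<le> l x"
    "x \<in> E s \<Longrightarrow> y \<in> E s \<Longrightarrow> ((\<lambda>t. Z s t x / Z s t y) \<longlongrightarrow> l x / l y) F"
proof -
  from assms show "bm l" and 1: "x \<in> E s \<Longrightarrow> 0 < l x" and 2: "x \<notin> E s \<Longrightarrow> l x = 0"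
    and "x \<in> E s \<Longrightarrow> y \<in> E s \<Longrightarrow> ((\<lambda>t. Z s t x / Z s t y) \<longlongrightarrow> l x / l y) F"
    unfolding ratio_limit_def by blast+
  from 1 2 show "0 \<le> l x" by (cases "x \<in> E s") auto
qed

text \<open>\<open>Z_compare\<close> as the later horizon tends to infinity. Exchanging
  \<open>x\<close> and \<open>y\<close> gives the reverse bound, and if one of them is dead the left
  side vanishes, so the comparison can be integrated in either variable.\<close>

lemma ratio_limit_compare:
  assumes l: "ratio_limit s l" and s: "s \<in> I" and T: "T \<in> I" "s + t0 \<le> T" "s + real n * t0 \<le> T"
  shows "l x * Z s T y \<le> (1 + err n) * (Z s T x * l y)"
proof (cases "x \<in> E s \<and> y \<in> E s")
  case True
  then have x: "x \<in> E s" and y: "y \<in> E s" by auto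
  have Zp: "0 < Z s T x" "0 < Z s T y" using x y s T t0 by (auto intro!: Z_pos)
  have "l x / l y \<le> (1 + err n) * (Z s T x / Z s T y)"
  proof (rule tendsto_upperbound[OF ratio_limitD(5)[OF l x y] _ F_neq_bot])
    show "\<forall>\<^sub>F t in F. Z s t x / Z s t y \<le> (1 + err n) * (Z s T x / Z s T y)"
      using eventually_F_ge[of T]
    proof eventually_elim
      case (elim t)
      have "0 < Z s t y" using y s T t0 elim by (intro Z_pos) auto
      then show ?case
        using Z_compare[of s T t n x y] s T x y elim Zp by (simp add: field_simps)
    qed
  qed
  then show ?thesis using Zp ratio_limitD(2)[OF l y] by (simp add: field_simps)
next
  case False
  then show ?thesis
    using s T t0 ratio_limitD(3,4)[OF l] err_nonneg[of n]
    by (auto simp: Z_dead Z_nonneg)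
qed

text \<open>Survival probabilities are normalized by a reference state \<open>y\<close>.
  \<open>Z_compare\<close> in both directions keeps \<open>r t\<close> within the factor
  \<open>1 + err n\<close> of \<open>r (T n)\<close> for all \<open>t\<close> beyond
  \<open>T n\<close>. Together with the bound \<open>C\<close> this is a Cauchy estimate uniform in
  \<open>x\<close> and \<open>t\<close>, so the limit along \<open>T n\<close> is the limit along
  all times.\<close>

lemma ex_ratio_limit:
  assumes s: "s \<in> I"
  shows "\<exists>l. ratio_limit s l"
proof -
  obtain y where y: "y \<in> E s" using E_nonempty[OF s] by auto
  define T where "T n = s + real n * t0" for n
  define r where "r t x = Z s t x / Z s t y" for t x
  define l where "l x = lim (\<lambda>n. r (T n) x)" for x
  have T: "T n \<in> I" "s \<le> T n" for n using I_step[OF s] t0 by (auto simp: T_def)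
  have T1: "s + t0 \<le> T n" if "1 \<le> n" for n using that t0 unfolding T_def by simp
  have Zy: "0 < Z s t y" if "t \<in> I" "s \<le> t" for t using y s that by (intro Z_pos) auto
  have r0: "0 \<le> r t x" if "t \<in> I" "s \<le> t" for t x
    using that s by (auto simp: r_def Z_nonneg)
  have cmp: "r t x \<le> (1 + err n) * r (T n) x" "r (T n) x \<le> (1 + err n) * r t x"
    if "1 \<le> n" "t \<in> I" "T n \<le> t" for n t x
  proof -
    have st: "s \<le> t" using T(2)[of n] that by linarith
    have "r t x \<le> (1 + err n) * r (T n) x \<and> r (T n) x \<le> (1 + err n) * r t x"
    proof (cases "x \<in> E s")
      case True
      then show ?thesis
        using Z_compare[OF s T(1)[of n] that(2) T1[OF that(1)] _ that(3), of n x y]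
          Z_compare[OF s T(1)[of n] that(2) T1[OF that(1)] _ that(3), of n y x] y
          Zy[OF that(2) st] Zy[OF T(1,2)[of n]]
        by (auto simp: r_def T_def field_simps)
    qed (use s T st that in \<open>simp_all add: r_def Z_dead\<close>)
    then show "r t x \<le> (1 + err n) * r (T n) x" "r (T n) x \<le> (1 + err n) * r t x" by auto
  qed
  \<comment> \<open>\<open>Z\<close> is at most 1 at time \<open>T 1\<close>, and the comparison
    from \<open>T 1\<close> on carries the bound to all later times. Index 1 is the first at which
    \<open>Z_compare\<close> applies, since it demands \<open>s + t0 \<le> T n\<close>.\<close>
  define C where "C = (1 + err 1) * (1 / Z s (T 1) y)"
  have C: "r t x \<le> C" if "t \<in> I" "T 1 \<le> t" for t x
  proof -
    have "r (T 1) x \<le> 1 / Z s (T 1) y"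
      unfolding r_def using T[of 1] s Z_le_1 Zy[OF T(1,2)[of 1]] by (auto intro!: divide_right_mono)
    then have "(1 + err 1) * r (T 1) x \<le> C"
      unfolding C_def using err_nonneg[of 1] by (intro mult_left_mono) auto
    then show ?thesis using cmp(1)[of 1 t x] that by simp
  qed
  have T_mono: "m \<le> n \<Longrightarrow> T m \<le> T n" for m n unfolding T_def using t0 by simp
  have diff: "\<bar>r t x - r (T n) x\<bar> \<le> err n * C" if "1 \<le> n" "t \<in> I" "T n \<le> t" for n t x
  proof -
    have "T 1 \<le> T n" using T_mono that by simp
    then have "err n * r (T n) x \<le> err n * C" "err n * r t x \<le> err n * C"
      using that T err_nonneg[of n] by (auto intro!: mult_left_mono C)
    then show ?thesis using cmp[OF that, of x] by (auto simp: algebra_simps abs_le_iff)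
  qed
  have eC: "(\<lambda>n. err n * C) \<longlonglongrightarrow> 0"
    using tendsto_mult[OF err_tendsto tendsto_const[of C]] by simp
  have conv: "(\<lambda>n. r (T n) x) \<longlonglongrightarrow> l x" for x
  proof -
    have "Cauchy (\<lambda>n. r (T n) x)"
    proof (rule CauchyI')
      fix e :: real assume "0 < e"
      then have "\<forall>\<^sub>F n in sequentially. err n * C < e" by (rule order_tendstoD(2)[OF eC])
      then obtain N where N: "\<And>n. N \<le> n \<Longrightarrow> err n * C < e" unfolding eventually_sequentially by blast
      show "\<exists>M. \<forall>m\<ge>M. \<forall>n>m. dist (r (T m) x) (r (T n) x) < e"
      proof (intro exI[of _ "max 1 N"] allI impI)
        fix m n assume "max 1 N \<le> m" "m < n"
        then have "\<bar>r (T n) x - r (T m) x\<bar> \<le> err m * C" "err m * C < e"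
          using T T_mono by (auto intro!: diff N)
        then show "dist (r (T m) x) (r (T n) x) < e" by (simp add: dist_real_def abs_minus_commute)
      qed
    qed
    then show ?thesis unfolding l_def using Cauchy_convergent convergent_LIMSEQ_iff by blast
  qed
  \<comment> \<open>A limit of positive numbers could be 0; the relative comparison with time
    \<open>T 1\<close> rules this out.\<close>
  have low: "r (T 1) x \<le> (1 + err 1) * l x" for x
  proof (rule tendsto_lowerbound[OF tendsto_mult[OF tendsto_const conv]])
    show "\<forall>\<^sub>F n in sequentially. r (T 1) x \<le> (1 + err 1) * r (T n) x"
      using eventually_ge_at_top[of 1] by eventually_elim (auto intro!: cmp T T_mono)
  qed simp
  have "((\<lambda>t. r t x) \<longlongrightarrow> l x) F" for x
  proof (rule tendstoI)
    fix e :: real assume e: "0 < e"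
    have "\<forall>\<^sub>F n in sequentially. err n * C < e / 2 \<and> dist (r (T n) x) (l x) < e / 2 \<and> 1 \<le> n"
      using e
      by (intro eventually_conj eventually_ge_at_top order_tendstoD(2)[OF eC] tendstoD[OF conv]) simp_all
    then obtain n where n: "err n * C < e / 2" "dist (r (T n) x) (l x) < e / 2" "1 \<le> n"
      by (metis (no_types, lifting) eventually_sequentially order.refl)
    show "\<forall>\<^sub>F t in F. dist (r t x) (l x) < e"
      using eventually_F_ge[of "T n"]
    proof eventually_elim
      case (elim t)
      then show ?case using diff[of n t x] n unfolding dist_real_def by linarith
    qed
  qed
  note lim = this
  have lpos: "0 < l x" if "x \<in> E s" for x
  proof -
    have "0 < r (T 1) x" unfolding r_def using that s T y by (auto intro!: divide_pos_pos Z_pos)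
    then show ?thesis using low[of x] err_nonneg[of 1] by (smt (verit) zero_less_mult_iff)
  qed
  have "ratio_limit s l"
    unfolding ratio_limit_def
  proof (intro conjI ballI allI impI)
    show "bm l"
    proof (rule bounded_measurableI[where b = C])
      show "l \<in> borel_measurable M"
      proof (rule borel_measurable_LIMSEQ_real[OF conv])
        fix n show "r (T n) \<in> borel_measurable M"
          unfolding r_def[abs_def] using s T by (intro borel_measurable_divide bounded_measurableD[OF bm_Z]) auto
      qed
      fix x
      have "0 \<le> l x"
        by (rule tendsto_lowerbound[OF conv]) (auto intro!: always_eventually r0 T)
      moreover have "l x \<le> C"
      proof (rule tendsto_upperbound[OF conv])
        show "\<forall>\<^sub>F n in sequentially. r (T n) x \<le> C"
          using eventually_ge_at_top[of 1] by eventually_elim (auto intro!: C T T_mono)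
      qed simp
      ultimately show "\<bar>l x\<bar> \<le> C" by simp
    qed
    fix x assume "x \<notin> E s"
    then have "r (T n) x = 0" for n using s T by (simp add: r_def Z_dead)
    then show "l x = 0" using conv[of x] LIMSEQ_unique[of "\<lambda>_. 0" "l x" 0] by simp
  next
    fix x z assume xz: "x \<in> E s" "z \<in> E s"
    have "((\<lambda>t. r t x / r t z) \<longlongrightarrow> l x / l z) F"
      using lpos[OF xz(2)] by (intro tendsto_divide lim) auto
    then show "((\<lambda>t. Z s t x / Z s t z) \<longlongrightarrow> l x / l z) F"
    proof (rule Lim_transform_eventually)
      show "\<forall>\<^sub>F t in F. r t x / r t z = Z s t x / Z s t z"
        using eventually_F_ge[of s] by eventually_elim (use Zy in \<open>force simp: r_def\<close>)
    qed
  qed (rule lpos)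
  then show ?thesis by blast
qed

end

text \<open>The weights \<open>Zf\<close> and \<open>k * h\<close> agree up to the factor
  \<open>e\<close>. Replacing one by the other changes numerator and denominator by errors
  proportional to \<open>(e - 1) * (k * H)\<close>, whence the 2, and dividing by the mass of
  \<open>Zf\<close> rather than that of \<open>k * h\<close> costs the last \<open>e\<close>. The
  scale \<open>k\<close> cancels in the quotients, so it may be arbitrarily small.\<close>

lemma ratio_stability:
  fixes F Zf h :: "'a \<Rightarrow> real"
  assumes N: "finite_measure N"
    and bm: "bounded_measurable N F" "bounded_measurable N Zf" "bounded_measurable N h"
    and F: "\<And>w. w \<in> space N \<Longrightarrow> \<bar>F w\<bar> \<le> b" and h0: "\<And>w. w \<in> space N \<Longrightarrow> 0 \<le> h w"
    and lo: "\<And>w. w \<in> space N \<Longrightarrow> k * h w \<le> e * Zf w"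
    and hi: "\<And>w. w \<in> space N \<Longrightarrow> Zf w \<le> e * (k * h w)"
    and e: "1 \<le> e" and k: "0 < k" and b: "0 \<le> b" and H: "0 < (\<integral>w. h w \<partial>N)"
  shows "\<bar>(\<integral>w. F w * Zf w \<partial>N) / (\<integral>w. Zf w \<partial>N) - (\<integral>w. F w * h w \<partial>N) / (\<integral>w. h w \<partial>N)\<bar> \<le> 2 * b * (e - 1) * e"
proof -
  note int = integrable_bounded_measurable[OF N refl]
  define A where "A = (\<integral>w. F w * Zf w \<partial>N)"
  define A' where "A' = (\<integral>w. F w * h w \<partial>N)"
  define B where "B = (\<integral>w. Zf w \<partial>N)"
  define H where "H = (\<integral>w. h w \<partial>N)"
  have H0: "0 < H" using assms(12) by (simp add: H_def)
  have close: "\<bar>Zf w - k * h w\<bar> \<le> (e - 1) * (k * h w)" if w: "w \<in> space N" for w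
  proof -
    have kh: "0 \<le> k * h w" using h0[OF w] k by simp
    \<comment> \<open>By \<open>lo\<close> the value \<open>Zf w\<close> is at least
      \<open>k * h w / e\<close>. Since \<open>(e - 1)\<^sup>2 \<ge> 0\<close> means
      \<open>2 - e \<le> 1 / e\<close>, the deviation downwards is at most \<open>e - 1\<close> as
      well.\<close>
    have "e * Zf w \<ge> (2 - e) * e * (k * h w)"
    proof -
      have "0 \<le> (e - 1)\<^sup>2 * (k * h w)" using kh by simp
      then show ?thesis using lo[OF w] by (simp add: power2_eq_square algebra_simps)
    qed
    then have "e * ((2 - e) * (k * h w)) \<le> e * Zf w" by (simp add: mult_ac)
    then have "(2 - e) * (k * h w) \<le> Zf w" using e by (subst (asm) mult_le_cancel_left_pos) auto
    then show ?thesis using hi[OF w] by (simp add: abs_le_iff algebra_simps)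
  qed
  have "\<bar>A - k * A'\<bar> = \<bar>\<integral>w. F w * (Zf w - k * h w) \<partial>N\<bar>"
  proof -
    have "(\<integral>w. F w * Zf w - k * (F w * h w) \<partial>N) = A - k * A'"
      unfolding A_def A'_def using bm
      by (subst Bochner_Integration.integral_diff) (auto intro!: int)
    then show ?thesis by (simp add: algebra_simps)
  qed
  also have "\<dots> \<le> (\<integral>w. b * ((e - 1) * (k * h w)) \<partial>N)"
  proof (rule order_trans[OF integral_abs_bound integral_mono])
    fix w assume w: "w \<in> space N"
    show "\<bar>F w * (Zf w - k * h w)\<bar> \<le> b * ((e - 1) * (k * h w))"
      unfolding abs_mult using F[OF w] close[OF w] b by (intro mult_mono) auto
  qed (intro int bounded_measurable_abs bounded_measurable_mult bounded_measurable_diff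
    bounded_measurable_const bm)+
  finally have 1: "\<bar>A - k * A'\<bar> \<le> b * (e - 1) * (k * H)" by (simp add: H_def mult_ac)
  have "\<bar>B - k * H\<bar> = \<bar>\<integral>w. Zf w - k * h w \<partial>N\<bar>"
    unfolding B_def H_def using bm
    by (subst Bochner_Integration.integral_diff) (auto intro!: int)
  also have "\<dots> \<le> (\<integral>w. (e - 1) * (k * h w) \<partial>N)"
    by (intro order_trans[OF integral_abs_bound integral_mono] int close bounded_measurable_abs
        bounded_measurable_mult bounded_measurable_diff bounded_measurable_const bm)
  finally have 2: "\<bar>B - k * H\<bar> \<le> (e - 1) * (k * H)" by (simp add: H_def mult_ac)
  have "(\<integral>w. k * h w \<partial>N) \<le> (\<integral>w. e * Zf w \<partial>N)"
    using bm lo by (intro integral_mono int) auto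
  then have 3: "k * H \<le> e * B" by (simp add: H_def B_def)
  have kH: "0 < k * H" using k H0 by simp
  then have B0: "0 < B" using 3 e by (smt (verit) zero_less_mult_iff)
  have 4: "\<bar>A'\<bar> \<le> b * H"
  proof -
    have "\<bar>A'\<bar> \<le> (\<integral>w. b * h w \<partial>N)"
      unfolding A'_def
    proof (rule order_trans[OF integral_abs_bound integral_mono])
      fix w assume w: "w \<in> space N"
      show "\<bar>F w * h w\<bar> \<le> b * h w"
        unfolding abs_mult using F[OF w] h0[OF w] by (simp add: mult_right_mono)
    qed (use bm in \<open>auto intro!: int\<close>)
    then show ?thesis by (simp add: H_def)
  qed
  have "A / B - A' / H = (A - k * A') / B + (A' / H) * ((k * H - B) / B)"
    using B0 H0 by (simp add: field_simps)
  also have "\<bar>\<dots>\<bar> \<le> \<bar>(A - k * A') / B\<bar> + \<bar>(A' / H) * ((k * H - B) / B)\<bar>" by (rule abs_triangle_ineq)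
  also have "\<dots> = \<bar>A - k * A'\<bar> / B + (\<bar>A'\<bar> / H) * (\<bar>B - k * H\<bar> / B)"
    using B0 H0 by (simp add: abs_mult abs_divide abs_minus_commute)
  also have "\<dots> \<le> b * (e - 1) * (k * H) / B + b * ((e - 1) * (k * H) / B)"
    using 1 2 4 B0 H0 b by (intro add_mono divide_right_mono mult_mono) (auto simp: field_simps)
  also have "\<dots> = 2 * b * (e - 1) * ((k * H) / B)" by simp
  also have "\<dots> \<le> 2 * b * (e - 1) * e"
  proof (rule mult_left_mono)
    show "(k * H) / B \<le> e" using 3 B0 by (simp add: field_simps)
  qed (use b e in simp)
  finally show ?thesis unfolding A_def A'_def B_def H_def .
qed

section \<open>Survival profiles\<close>

context conditioned_semigroup
begin

text \<open>The counterpart of \<open>survival_profile\<close> in which, through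
  \<open>ratio_limit\<close>, the functions vanish off \<open>E s\<close> and are measurable on the
  whole space. Off \<open>E s\<close> the harmonic identity is automatic, both sides being
  0.\<close>

definition profile :: "(real \<Rightarrow> 'e \<Rightarrow> real) \<Rightarrow> bool" where
  "profile \<eta> \<longleftrightarrow> (\<forall>s\<in>I. ratio_limit s (\<eta> s)) \<and>
     (\<forall>s\<in>I. \<forall>t\<in>I. s \<le> t \<longrightarrow> (\<forall>x\<in>E s. P s t (\<eta> t) x = \<eta> s x))"

text \<open>Integrating the uniform two-sided comparison of \<open>Z t T\<close> with \<open>l\<close> shows that
  \<open>P s t l\<close> has the same ratios as \<open>Z s T\<close> in the limit.\<close>

lemma P_ratio_limit_le:
  assumes l: "ratio_limit t l" and l': "ratio_limit s l'"
    and st: "s \<in> I" "t \<in> I" "s \<le> t" and x: "x \<in> E s" and y: "y \<in> E s"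
  shows "P s t l x * l' y \<le> l' x * P s t l y"
proof -
  obtain z where z: "z \<in> E t" using E_nonempty[OF st(2)] by auto
  note lD = ratio_limitD[OF l] and l'D = ratio_limitD[OF l']
  \<comment> \<open>One stretch more than \<open>n\<close>, so that \<open>t + t0 \<le> T n\<close>
    holds for \<open>n = 0\<close> too.\<close>
  define T where "T n = t + real (Suc n) * t0" for n
  have T: "T n \<in> I" "t \<le> T n" "t + t0 \<le> T n" "t + real n * t0 \<le> T n" "s \<le> T n" for n
  proof -
    have nn: "0 \<le> real n * t0" using t0 by simp
    then have "s \<le> t + (t0 + real n * t0)" using t0 st by linarith
    with nn show "T n \<in> I" "t \<le> T n" "t + t0 \<le> T n" "t + real n * t0 \<le> T n" "s \<le> T n"
      using I_step[OF st(2), of "Suc n"] t0 st unfolding T_def by (simp_all add: distrib_right)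
  qed
  have key: "P s t l x * Z s (T n) y \<le> (1 + err n)\<^sup>2 * (Z s (T n) x * P s t l y)" for n
  proof -
    \<comment> \<open>The factor between \<open>l\<close> and \<open>Z t (T n)\<close>, read off at
      the reference state \<open>z\<close>; it enters both comparisons and cancels in their
      product.\<close>
    define k where "k = Z t (T n) z / l z"
    have k: "0 < k" using Z_pos[OF st(2) T(1,2) z] lD(2)[OF z] by (simp add: k_def)
    have "k * l w \<le> (1 + err n) * Z t (T n) w" "Z t (T n) w \<le> (1 + err n) * k * l w" for w
      using ratio_limit_compare[OF l st(2) T(1,3,4), of w n z]
        ratio_limit_compare[OF l st(2) T(1,3,4), of z n w] lD(2)[OF z]
      by (simp_all add: k_def field_simps)
    then have "P s t (\<lambda>w. k * l w) x \<le> P s t (\<lambda>w. (1 + err n) * Z t (T n) w) x"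
      "P s t (Z t (T n)) y \<le> P s t (\<lambda>w. (1 + err n) * k * l w) y"
      using st T lD(1) by (auto intro!: P_mono bm_Z)
    then have "k * P s t l x \<le> (1 + err n) * Z s (T n) x" "Z s (T n) y \<le> (1 + err n) * k * P s t l y"
      using st T by (auto simp: P_cmult P_Z)
    then have "(k * P s t l x) * Z s (T n) y \<le> ((1 + err n) * Z s (T n) x) * ((1 + err n) * k * P s t l y)"
      by (rule mult_mono) (use err_nonneg[of n] st T in \<open>auto simp: Z_nonneg\<close>)
    then have "k * (P s t l x * Z s (T n) y) \<le> k * ((1 + err n)\<^sup>2 * (Z s (T n) x * P s t l y))"
      by (simp add: power2_eq_square mult_ac)
    then show ?thesis using k by simp
  qed
  have "filterlim T F sequentially"
    unfolding T_def using filterlim_compose[OF filterlim_steps[OF st(2)] filterlim_Suc] by simp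
  then have "(\<lambda>n. Z s (T n) x / Z s (T n) y) \<longlonglongrightarrow> l' x / l' y"
    by (rule filterlim_compose[OF l'D(5)[OF x y]])
  then have "(\<lambda>n. (1 + err n)\<^sup>2 * (Z s (T n) x / Z s (T n) y * P s t l y)) \<longlonglongrightarrow> (1 + 0)\<^sup>2 * (l' x / l' y * P s t l y)"
    by (intro tendsto_mult tendsto_power tendsto_add tendsto_const err_tendsto)
  then have "P s t l x \<le> (1 + 0)\<^sup>2 * (l' x / l' y * P s t l y)"
  proof (rule tendsto_lowerbound)
    have "0 < Z s (T n) y" for n using st T y by (intro Z_pos) auto
    then show "\<forall>\<^sub>F n in sequentially. P s t l x \<le> (1 + err n)\<^sup>2 * (Z s (T n) x / Z s (T n) y * P s t l y)"
      using key by (auto simp: field_simps)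
  qed simp
  then show ?thesis using l'D(2)[OF y] by (simp add: field_simps)
qed

text \<open>By \<open>P_ratio_limit_le\<close> in both directions \<open>P s t (l t)\<close> is a
  constant multiple \<open>k\<close> of \<open>l s\<close>. Dividing \<open>l t\<close> by its
  integral \<open>a t\<close>, taken from a fixed state at time 0, turns every such multiple into 1,
  because Chapman-Kolmogorov gives \<open>a t = k * a s\<close>.\<close>

lemma ex_profile: "\<exists>\<eta>. profile \<eta>"
proof -
  have "\<exists>l. \<forall>s\<in>I. ratio_limit s (l s)" using ex_ratio_limit by (intro bchoice) blast
  then obtain l where l: "\<And>s. s \<in> I \<Longrightarrow> ratio_limit s (l s)" by blast
  note lD = ratio_limitD[OF l]
  obtain x0 where x0: "x0 \<in> E 0" using E_nonempty[of 0] by auto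
  define a where "a t = P 0 t (l t) x0" for t
  define \<eta> where "\<eta> t x = l t x / a t" for t x
  have eq: "P s t (l t) x * l s y = l s x * P s t (l t) y"
    if "s \<in> I" "t \<in> I" "s \<le> t" "x \<in> E s" "y \<in> E s" for s t x y
    using P_ratio_limit_le[OF l[OF that(2)] l[OF that(1)] that]
      P_ratio_limit_le[OF l[OF that(2)] l[OF that(1)] that(1-3) that(5,4)]
    by (intro antisym) (auto simp: mult_ac)
  \<comment> \<open>\<open>l t\<close> dominates a positive multiple of \<open>Z t T\<close>, whose
    integral is the survival probability \<open>Z 0 T x0\<close>.\<close>
  have a_pos: "0 < a t" if t: "t \<in> I" for t
  proof -
    obtain y where y: "y \<in> E t" using E_nonempty[OF t] by auto
    define T where "T = t + t0"
    have T: "T \<in> I" "t \<le> T" "t + t0 \<le> T" "t + real 1 * t0 \<le> T" using t t0 I_add by (auto simp: T_def)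
    have t_nn: "0 \<le> t" using I_nonneg[OF t] .
    have "Z 0 T x0 * l t y = P 0 t (\<lambda>w. l t y * Z t T w) x0" using t T t_nn by (simp add: P_cmult P_Z)
    also have "\<dots> \<le> P 0 t (\<lambda>w. (1 + err 1) * Z t T y * l t w) x0"
      using t T t_nn ratio_limit_compare[OF l[OF t] t T(1,3,4), of y] lD(1)[OF t]
      by (intro P_mono bounded_measurable_mult bm_Z) (auto simp: mult_ac)
    also have "\<dots> = (1 + err 1) * Z t T y * a t" using t t_nn by (simp add: P_cmult a_def)
    finally have "Z 0 T x0 * l t y \<le> (1 + err 1) * Z t T y * a t" .
    moreover have "0 < Z 0 T x0 * l t y"
      using x0 T t_nn lD(2)[OF t y] by (auto intro!: mult_pos_pos Z_pos)
    moreover have "0 \<le> (1 + err 1) * Z t T y" using err_nonneg[of 1] t T by (simp add: Z_nonneg)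
    ultimately show ?thesis by (smt (verit) mult_nonneg_nonpos)
  qed
  have "profile \<eta>"
    unfolding profile_def
  proof (intro conjI ballI impI)
    fix s assume s: "s \<in> I"
    have "\<eta> s x / \<eta> s y = l s x / l s y" for x y using a_pos[OF s] by (simp add: \<eta>_def)
    then show "ratio_limit s (\<eta> s)"
      using l[OF s] a_pos[OF s] unfolding ratio_limit_def by (auto simp: \<eta>_def[abs_def])
  next
    fix s t x assume st: "s \<in> I" "t \<in> I" "s \<le> t" and x: "x \<in> E s"
    define k where "k = P s t (l t) x / l s x"
    have s0: "0 \<le> s" using I_nonneg[OF st(1)] .
    have "P s t (l t) y = k * l s y" for y
      using eq[OF st, of y x] lD(2)[OF st(1) x] lD(3)[OF st(1), of y] x st
      by (cases "y \<in> E s") (auto simp: k_def field_simps P_dead)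
    then have "P s t (l t) = (\<lambda>y. k * l s y)" by auto
    then have "a t = k * a s"
      unfolding a_def using st s0 lD(1)[OF st(2)] by (subst P_Chapman[of 0 s t]) (auto simp: P_cmult)
    moreover have "P s t (\<eta> t) x = P s t (l t) x / a t"
      unfolding \<eta>_def[abs_def] using P_cmult[OF st, of "1 / a t" "l t" x] by simp
    moreover have "P s t (l t) x = k * l s x" using lD(2)[OF st(1) x] by (simp add: k_def)
    ultimately show "P s t (\<eta> t) x = \<eta> s x"
      using a_pos[OF st(2)] by (auto simp: \<eta>_def)
  qed
  then show ?thesis by blast
qed

context
  fixes \<eta> assumes \<eta>: "profile \<eta>"
begin

lemma profile_ratio_limit: "s \<in> I \<Longrightarrow> ratio_limit s (\<eta> s)"
  using \<eta> unfolding profile_def by blast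

lemmas profileD = ratio_limitD[OF profile_ratio_limit]

lemma profile_P: "s \<in> I \<Longrightarrow> t \<in> I \<Longrightarrow> s \<le> t \<Longrightarrow> P s t (\<eta> t) x = \<eta> s x"
  using \<eta> profileD(3)[of s x] P_dead[of s t x] unfolding profile_def by (cases "x \<in> E s") auto

text \<open>(A'2) for \<open>Z s T\<close> is carried over to \<open>\<eta> s\<close> by integrating
  the comparison of the two under \<open>\<nu> s\<close>; letting \<open>n\<close> grow removes the
  factor \<open>1 + err n\<close>. It makes the contraction available for the
  \<open>Q\<close>-process with the same constant \<open>c\<close>.\<close>

lemma profile_nu:
  assumes s: "s \<in> I"
  shows "c2 * \<eta> s x \<le> (\<integral>y. \<eta> s y \<partial>\<nu> s)"
proof (cases "x \<in> E s")
  case x: True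
  have "c2 * \<eta> s x \<le> (1 + err n) * (\<integral>y. \<eta> s y \<partial>\<nu> s)" for n
  proof -
    define T where "T = s + real (Suc n) * t0"
    have T: "T \<in> I" "s \<le> T" "s + t0 \<le> T" "s + real n * t0 \<le> T"
      using I_step[OF s, of "Suc n"] t0 unfolding T_def by (auto simp: distrib_right)
    have Zp: "0 < Z s T x" using s T x by (intro Z_pos)
    have "(\<integral>y. \<eta> s x * Z s T y \<partial>\<nu> s) \<le> (\<integral>y. (1 + err n) * Z s T x * \<eta> s y \<partial>\<nu> s)"
      using ratio_limit_compare[OF profile_ratio_limit[OF s] s T(1,3,4), of x] s T profileD(1)[OF s]
      by (intro integral_mono nu_integrable bounded_measurable_mult bm_Z) (auto simp: mult_ac)
    then have "\<eta> s x * (\<integral>y. Z s T y \<partial>\<nu> s) \<le> (1 + err n) * Z s T x * (\<integral>y. \<eta> s y \<partial>\<nu> s)"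
      by simp
    moreover have "\<eta> s x * (c2 * Z s T x) \<le> \<eta> s x * (\<integral>y. Z s T y \<partial>\<nu> s)"
      using s T profileD(4)[OF s] by (intro mult_left_mono A2') auto
    ultimately have "Z s T x * (c2 * \<eta> s x) \<le> Z s T x * ((1 + err n) * (\<integral>y. \<eta> s y \<partial>\<nu> s))"
      by (simp add: mult_ac)
    then show ?thesis using Zp by simp
  qed
  moreover have "(\<lambda>n. (1 + err n) * (\<integral>y. \<eta> s y \<partial>\<nu> s)) \<longlonglongrightarrow> (1 + 0) * (\<integral>y. \<eta> s y \<partial>\<nu> s)"
    by (intro tendsto_intros err_tendsto)
  ultimately have "c2 * \<eta> s x \<le> (1 + 0) * (\<integral>y. \<eta> s y \<partial>\<nu> s)"
    by (intro tendsto_lowerbound[where F = sequentially]) auto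
  then show ?thesis by simp
next
  case False
  then show ?thesis using profileD(3,4)[OF s] nu_nonneg[of "\<eta> s" s] by simp
qed

lemma harmonic_profile: "harmonic T \<eta>"
  unfolding harmonic_def using profile_nu profile_P profileD by auto

text \<open>The bound of \<open>ratio_stability\<close> for \<open>e = 1 + err n\<close>, per unit
  of \<open>b\<close>.\<close>

definition gap :: "nat \<Rightarrow> real" where "gap n = 2 * err n * (1 + err n)"

lemma gap_tendsto: "gap \<longlonglongrightarrow> 0"
proof -
  have "(\<lambda>n. 2 * err n * (1 + err n)) \<longlonglongrightarrow> 2 * 0 * (1 + 0)"
    by (intro tendsto_intros err_tendsto)
  then show ?thesis unfolding gap_def[abs_def] by simp
qed

text \<open>Stated for an arbitrary finite measure \<open>N\<close> and an observed state
  \<open>Y\<close>, so that one estimate serves killed kernels, mixtures over an initial law and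
  laws of whole trajectories. The bound depends on neither \<open>N\<close> nor
  \<open>Y\<close>.\<close>

lemma survival_weight_vs_profile:
  assumes N: "finite_measure N" and Y: "Y \<in> N \<rightarrow>\<^sub>M M"
    and f: "bounded_measurable N f" "\<And>w. w \<in> space N \<Longrightarrow> \<bar>f w\<bar> \<le> b" "0 \<le> b"
    and s: "s \<in> I" and T: "T \<in> I" "s + t0 \<le> T" "s + real n * t0 \<le> T"
    and pos: "0 < (\<integral>w. \<eta> s (Y w) \<partial>N)"
  shows "\<bar>(\<integral>w. f w * Z s T (Y w) \<partial>N) / (\<integral>w. Z s T (Y w) \<partial>N) -
    (\<integral>w. f w * \<eta> s (Y w) \<partial>N) / (\<integral>w. \<eta> s (Y w) \<partial>N)\<bar> \<le> b * gap n"
proof -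
  obtain z where z: "z \<in> E s" using E_nonempty[OF s] by auto
  have sT: "s \<le> T" using T t0 by simp
  define k where "k = Z s T z / \<eta> s z"
  have k: "0 < k" using Z_pos[OF s T(1) sT z] profileD(2)[OF s z] by (simp add: k_def)
  have "k * \<eta> s w \<le> (1 + err n) * Z s T w" "Z s T w \<le> (1 + err n) * (k * \<eta> s w)" for w
    using ratio_limit_compare[OF profile_ratio_limit[OF s] s T, of w z]
      ratio_limit_compare[OF profile_ratio_limit[OF s] s T, of z w] profileD(2)[OF s z]
    by (simp_all add: k_def field_simps)
  then have "\<bar>(\<integral>w. f w * Z s T (Y w) \<partial>N) / (\<integral>w. Z s T (Y w) \<partial>N) -
    (\<integral>w. f w * \<eta> s (Y w) \<partial>N) / (\<integral>w. \<eta> s (Y w) \<partial>N)\<bar> \<le> 2 * b * ((1 + err n) - 1) * (1 + err n)"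
    using s T sT profileD(1,4)[OF s] f k err_nonneg[of n] pos
    by (intro ratio_stability[OF N, where k = k])
       (auto intro!: bounded_measurable_compose[OF _ Y] bm_Z)
  then show ?thesis by (simp add: gap_def mult_ac)
qed

lemma survival_weight_tendsto:
  assumes N: "finite_measure N" and Y: "Y \<in> N \<rightarrow>\<^sub>M M"
    and f: "bounded_measurable N f" and s: "s \<in> I"
    and pos: "0 < (\<integral>w. \<eta> s (Y w) \<partial>N)"
  shows "((\<lambda>T. (\<integral>w. f w * Z s T (Y w) \<partial>N) / (\<integral>w. Z s T (Y w) \<partial>N)) \<longlongrightarrow>
    (\<integral>w. f w * \<eta> s (Y w) \<partial>N) / (\<integral>w. \<eta> s (Y w) \<partial>N)) F"
proof (rule tendstoI)
  fix e :: real assume e: "0 < e"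
  obtain b where b: "0 < b" "\<And>x. x \<in> space N \<Longrightarrow> \<bar>f x\<bar> \<le> b" using bounded_measurable_bound[OF f] by blast
  have "(\<lambda>n. b * gap n) \<longlonglongrightarrow> b * 0" by (intro tendsto_intros gap_tendsto)
  then have "\<forall>\<^sub>F n in sequentially. b * gap n < e" using e by (intro order_tendstoD(2)) auto
  then obtain n where n: "b * gap n < e" by (meson eventually_happens trivial_limit_sequentially)
  show "\<forall>\<^sub>F T in F. dist ((\<integral>w. f w * Z s T (Y w) \<partial>N) / (\<integral>w. Z s T (Y w) \<partial>N))
    ((\<integral>w. f w * \<eta> s (Y w) \<partial>N) / (\<integral>w. \<eta> s (Y w) \<partial>N)) < e"
    using eventually_F_ge[of "s + t0"] eventually_F_ge[of "s + real n * t0"]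
  proof eventually_elim
    case (elim T)
    then show ?case
      using survival_weight_vs_profile[OF N Y f b(2) _ s _ _ _ pos, of T n] b(1) n
      by (simp add: dist_real_def)
  qed
qed

text \<open>\<open>survival_weight_tendsto\<close> for the killed kernel itself. It serves to carry
  identities between conditioned semigroups over to the \<open>Q\<close>-process.\<close>

lemma doob_Z_tendsto:
  assumes "r \<in> I" "s \<in> I" "r \<le> s" "bm f" "x \<in> E r"
  shows "((\<lambda>T. doob (\<lambda>t. Z t T) r s f x) \<longlongrightarrow> doob \<eta> r s f x) F"
proof -
  have K: "finite_measure (K r s x)" "sets (K r s x) = sets M"
    using assms by (auto intro!: K_finite)
  have id: "(\<lambda>y. y) \<in> K r s x \<rightarrow>\<^sub>M M" using K(2) by (simp add: measurable_ident_sets)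
  have f: "bounded_measurable (K r s x) f" using assms(4) bounded_measurable_cong_sets[OF K(2)] by blast
  have eta: "(\<integral>y. \<eta> s y \<partial>K r s x) = \<eta> r x" using profile_P[OF assms(1-3), of x] by (simp add: P_def)
  have "((\<lambda>T. (\<integral>w. f w * Z s T w \<partial>K r s x) / (\<integral>w. Z s T w \<partial>K r s x)) \<longlongrightarrow> doob \<eta> r s f x) F"
    using survival_weight_tendsto[OF K(1) id f assms(2)] profileD(2)[OF assms(1,5)]
    unfolding eta doob_def P_def by simp
  then show ?thesis
  proof (rule Lim_transform_eventually)
    show "\<forall>\<^sub>F T in F. (\<integral>w. f w * Z s T w \<partial>K r s x) / (\<integral>w. Z s T w \<partial>K r s x) = doob (\<lambda>t. Z t T) r s f x"
      using eventually_F_ge[of s]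
    proof eventually_elim
      case (elim T)
      then show ?case using P_Z[of r s T x] assms by (simp add: doob_def P_def)
    qed
  qed
qed

end

end

section \<open>Shifts by multiples of the period\<close>

locale periodic_semigroup = conditioned_semigroup M I E K \<nu> t0 c1 c2
  for M :: "'e measure" and I E K \<nu> t0 c1 c2 +
  fixes \<gamma> :: real
  assumes period: "\<gamma> \<in> I" "0 < \<gamma>"
    and E_periodic: "E (real n * \<gamma>) = E 0"
    and P_periodic: "s \<in> I \<Longrightarrow> T \<in> I \<Longrightarrow> s \<le> T \<Longrightarrow> bm f \<Longrightarrow>
      P (real n * \<gamma>) (real n * \<gamma> + s) (\<lambda>y. f y * Z (real n * \<gamma> + s) (real n * \<gamma> + T) y) x
        = P 0 s (\<lambda>y. f y * Z s T y) x"
begin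

lemma period_mult: "real n * \<gamma> \<in> I" "0 \<le> real n * \<gamma>"
  using I_mult[OF period(1)] period(2) by auto

context
  fixes \<eta> assumes \<eta>: "profile \<eta>"
begin

text \<open>\<open>\<eta>\<close> may pick up a factor over a period, so the formula for the
  transform does not show the identity. The semigroup conditioned on survival up to
  \<open>T\<close>, shifted by \<open>p\<close>, is the one conditioned on survival up to
  \<open>p + T\<close>, and the two sides are the limits of these as \<open>T\<close> grows.\<close>

lemma doob_shift:
  assumes s: "s \<in> I" and f: "bm f" and x: "x \<in> E 0"
  shows "doob \<eta> (real n * \<gamma>) (real n * \<gamma> + s) f x = doob \<eta> 0 s f x"
proof -
  define p where "p = real n * \<gamma>"
  have p: "p \<in> I" "0 \<le> p" "E p = E 0" using period_mult E_periodic by (auto simp: p_def)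
  have s0: "0 \<le> s" using I_nonneg[OF s] .
  have per: "P p (p + s) (\<lambda>y. g y * Z (p + s) (p + T) y) x = P 0 s (\<lambda>y. g y * Z s T y) x"
    if "T \<in> I" "s \<le> T" "bm g" for T g
    using P_periodic[of s T g n x] that s by (simp add: p_def)
  have lim: "((\<lambda>T. doob (\<lambda>t. Z t T) p (p + s) f x) \<longlongrightarrow> doob \<eta> p (p + s) f x) F"
    using s p s0 f x by (intro doob_Z_tendsto[OF \<eta>] I_add) auto
  have "filterlim (\<lambda>T. p + T) F F"
    unfolding filterlim_iff
  proof (intro allI impI)
    fix Q assume "eventually Q F"
    then obtain N where N: "\<And>t. t \<in> I \<Longrightarrow> N \<le> t \<Longrightarrow> Q t" unfolding eventually_F by blast
    show "\<forall>\<^sub>F t in F. Q (p + t)"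
      using eventually_F_ge[of N] by eventually_elim (use p I_add N in auto)
  qed
  from filterlim_compose[OF lim this]
  have "((\<lambda>T. doob (\<lambda>t. Z t (p + T)) p (p + s) f x) \<longlongrightarrow> doob \<eta> p (p + s) f x) F" .
  moreover have "((\<lambda>T. doob (\<lambda>t. Z t (p + T)) p (p + s) f x) \<longlongrightarrow> doob \<eta> 0 s f x) F"
  proof (rule Lim_transform_eventually)
    show "((\<lambda>T. doob (\<lambda>t. Z t T) 0 s f x) \<longlongrightarrow> doob \<eta> 0 s f x) F"
      using s s0 f x by (intro doob_Z_tendsto[OF \<eta>]) auto
    show "\<forall>\<^sub>F T in F. doob (\<lambda>t. Z t T) 0 s f x = doob (\<lambda>t. Z t (p + T)) p (p + s) f x"
      using eventually_F_ge[of s]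
    proof eventually_elim
      case (elim T)
      \<comment> \<open>The case \<open>f = 1\<close> of periodicity: the denominators agree as
        well.\<close>
      have "Z 0 T x = P 0 s (\<lambda>y. 1 * Z s T y) x" using elim s s0 by (simp add: P_Z)
      also have "\<dots> = P p (p + s) (\<lambda>y. 1 * Z (p + s) (p + T) y) x"
        using elim by (intro per[symmetric]) auto
      also have "\<dots> = Z p (p + T) x" using elim s s0 p by (simp add: P_Z I_add)
      finally have "Z p (p + T) x = Z 0 T x" ..
      then show ?case using per[of T f] elim f by (simp add: doob_def)
    qed
  qed
  ultimately show ?thesis unfolding p_def[symmetric] by (rule tendsto_unique[OF F_neq_bot])
qed

text \<open>After \<open>n\<close> periods the transform starts afresh. On multiples of
  \<open>\<gamma>\<close> it is therefore a homogeneous chain, so that an invariant measure can be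
  sought.\<close>

lemma doob_Chapman_period:
  assumes s: "s \<in> I" and f: "bm f"
  shows "doob \<eta> 0 (real n * \<gamma> + s) f x = doob \<eta> 0 (real n * \<gamma>) (doob \<eta> 0 s f) x"
proof -
  define p where "p = real n * \<gamma>"
  have p: "p \<in> I" "0 \<le> p" "E p = E 0" using period_mult E_periodic by (auto simp: p_def)
  have s0: "0 \<le> s" using I_nonneg[OF s] .
  note h = harmonic_profile[OF \<eta>]
  have "doob \<eta> p (p + s) f y = doob \<eta> 0 s f y" for y
    using doob_shift[OF s f, of y n] doob_off[OF h[of "p + s"] I_add[OF p(1) s] p(1), of y]
      doob_off[OF h[of s] s, of 0 y] p s0 unfolding p_def by (cases "y \<in> E 0") auto
  then have "doob \<eta> p (p + s) f = doob \<eta> 0 s f" by auto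
  then show ?thesis
    using doob_Chapman[OF h I_add[OF p(1) s], of 0 p f x] p s0 f by (simp add: p_def)
qed

end

end

section \<open>The invariant measure of the transformed chain\<close>

text \<open>\<open>u\<close> rounds \<open>f\<close> down to multiples of \<open>1 / i\<close> and
  has finitely many values; setwise convergence treats its level sets \<open>A v\<close>, and the
  rounding error \<open>1 / i < e / 3\<close> is the same for all the laws.\<close>

lemma integral_setwise_limit:
  assumes \<mu>: "\<And>n. prob_space (\<mu> n)" "\<And>n. sets (\<mu> n) = sets M"
    and N: "prob_space N" "sets N = sets M"
    and lim: "\<And>B. B \<in> sets M \<Longrightarrow> (\<lambda>n. measure (\<mu> n) B) \<longlonglongrightarrow> measure N B"
    and f: "bounded_measurable M f"
  shows "(\<lambda>n. \<integral>x. f x \<partial>\<mu> n) \<longlonglongrightarrow> (\<integral>x. f x \<partial>N)"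
proof (rule tendstoI)
  fix e :: real assume e: "0 < e"
  obtain b where b: "0 < b" "\<And>x. x \<in> space M \<Longrightarrow> \<bar>f x\<bar> \<le> b" using bounded_measurable_bound[OF f] by blast
  obtain i where i: "3 / e < real i" using reals_Archimedean2 by blast
  then have i0: "0 < real i" using e by (smt (verit) divide_pos_pos)
  have ie: "1 / real i < e / 3" using i i0 e by (simp add: field_simps)
  define V where "V = {\<lfloor>- real i * b\<rfloor> .. \<lfloor>real i * b\<rfloor>}"
  define A where "A v = {x \<in> space M. \<lfloor>real i * f x\<rfloor> = v}" for v
  define u where "u x = of_int \<lfloor>real i * f x\<rfloor> / real i" for x
  have fm[measurable]: "f \<in> borel_measurable M" using f by auto
  have A: "A v \<in> sets M" for v unfolding A_def by measurable
  have u: "u x = (\<Sum>v\<in>V. of_int v / real i * indicator (A v) x)" if x: "x \<in> space M" for x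
  proof -
    have "- b \<le> f x" "f x \<le> b" using b(2)[OF x] by auto
    then have "- real i * b \<le> real i * f x" "real i * f x \<le> real i * b"
      using mult_left_mono[of "- b" "f x" "real i"] i0 by (auto intro!: mult_left_mono)
    then have "\<lfloor>real i * f x\<rfloor> \<in> V" unfolding V_def by (auto intro!: floor_mono)
    moreover have "indicator (A v) x = (if v = \<lfloor>real i * f x\<rfloor> then 1 else 0 :: real)" for v
      using x by (auto simp: A_def)
    ultimately show ?thesis by (simp add: u_def V_def if_distrib[of "(*) _"] sum.delta cong: if_cong)
  qed
  have uf: "u x \<le> f x \<and> f x \<le> u x + 1 / real i" for x
  proof -
    have "of_int \<lfloor>real i * f x\<rfloor> \<le> real i * f x" "real i * f x \<le> of_int \<lfloor>real i * f x\<rfloor> + 1" by linarith+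
    then show ?thesis using i0 unfolding u_def by (simp add: field_simps)
  qed
  have bmu: "bounded_measurable M u"
  proof (rule bounded_measurableI[where b = "b + 1 / real i"])
    show "u \<in> borel_measurable M" unfolding u_def by measurable
    fix x assume "x \<in> space M"
    then show "\<bar>u x\<bar> \<le> b + 1 / real i" using b(2)[of x] uf[of x] by auto
  qed
  have u_int: "(\<integral>x. u x \<partial>L) = (\<Sum>v\<in>V. of_int v / real i * measure L (A v))"
    and near: "\<bar>(\<integral>x. f x \<partial>L) - (\<integral>x. u x \<partial>L)\<bar> \<le> 1 / real i"
    if L: "prob_space L" "sets L = sets M" for L
  proof -
    interpret L: prob_space L by (rule L)
    have sp: "space L = space M" by (rule sets_eq_imp_space_eq[OF L(2)])
    note int = integrable_bounded_measurable[OF L.finite_measure_axioms L(2)]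
    have "(\<integral>x. u x \<partial>L) = (\<integral>x. (\<Sum>v\<in>V. of_int v / real i * indicator (A v) x) \<partial>L)"
      using u sp by (intro Bochner_Integration.integral_cong) auto
    also have "\<dots> = (\<Sum>v\<in>V. (\<integral>x. of_int v / real i * indicator (A v) x \<partial>L))"
      using A by (intro Bochner_Integration.integral_sum int bounded_measurable_mult) auto
    also have "\<dots> = (\<Sum>v\<in>V. of_int v / real i * measure L (A v))"
      using A L(2) by (intro sum.cong) auto
    finally show "(\<integral>x. u x \<partial>L) = (\<Sum>v\<in>V. of_int v / real i * measure L (A v))" .
    have "(\<integral>x. u x \<partial>L) \<le> (\<integral>x. f x \<partial>L)" "(\<integral>x. f x \<partial>L) \<le> (\<integral>x. u x + 1 / real i \<partial>L)"
      using uf f bmu by (auto intro!: integral_mono int)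
    moreover have "(\<integral>x. u x + 1 / real i \<partial>L) = (\<integral>x. u x \<partial>L) + 1 / real i"
      using bmu by (subst Bochner_Integration.integral_add) (auto intro!: int simp: L.prob_space)
    ultimately show "\<bar>(\<integral>x. f x \<partial>L) - (\<integral>x. u x \<partial>L)\<bar> \<le> 1 / real i" by auto
  qed
  have "(\<lambda>n. \<integral>x. u x \<partial>\<mu> n) \<longlonglongrightarrow> (\<integral>x. u x \<partial>N)"
    unfolding u_int[OF \<mu>] u_int[OF N] by (intro tendsto_sum tendsto_mult tendsto_const lim A)
  then have "\<forall>\<^sub>F n in sequentially. dist (\<integral>x. u x \<partial>\<mu> n) (\<integral>x. u x \<partial>N) < e / 3"
    using e by (intro tendstoD) auto
  then show "\<forall>\<^sub>F n in sequentially. dist (\<integral>x. f x \<partial>\<mu> n) (\<integral>x. f x \<partial>N) < e"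
  proof eventually_elim
    case (elim n)
    show ?case using elim near[OF \<mu>, of n] near[OF N] ie unfolding dist_real_def by linarith
  qed
qed

text \<open>The rate \<open>\<delta> n\<close> is the same for all sets \<open>B\<close>. That
  yields continuity of the limit at the empty set: \<open>n\<close> is fixed by
  \<open>\<delta> n < e / 2\<close>, and only then do the sets \<open>A i\<close> shrink under the
  single measure \<open>\<mu> n\<close>. With finite additivity this gives countable
  additivity.\<close>

lemma ex_uniform_setwise_limit:
  assumes \<mu>: "\<And>n. prob_space (\<mu> n)" "\<And>n. sets (\<mu> n) = sets M"
    and cauchy: "\<And>n m B. n \<le> m \<Longrightarrow> B \<in> sets M \<Longrightarrow> \<bar>measure (\<mu> m) B - measure (\<mu> n) B\<bar> \<le> \<delta> n"
    and \<delta>: "\<delta> \<longlonglongrightarrow> (0::real)"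
  shows "\<exists>N. prob_space N \<and> sets N = sets M \<and> (\<forall>B\<in>sets M. (\<lambda>n. measure (\<mu> n) B) \<longlonglongrightarrow> measure N B)"
proof -
  define b where "b B = lim (\<lambda>n. measure (\<mu> n) B)" for B
  have conv: "(\<lambda>n. measure (\<mu> n) B) \<longlonglongrightarrow> b B" if B: "B \<in> sets M" for B
  proof -
    have "Cauchy (\<lambda>n. measure (\<mu> n) B)"
    proof (rule CauchyI')
      fix e :: real assume "0 < e"
      then have "\<forall>\<^sub>F n in sequentially. \<delta> n < e" by (rule order_tendstoD(2)[OF \<delta>])
      then obtain k where k: "\<And>n. k \<le> n \<Longrightarrow> \<delta> n < e" unfolding eventually_sequentially by blast
      show "\<exists>M. \<forall>m\<ge>M. \<forall>n>m. dist (measure (\<mu> m) B) (measure (\<mu> n) B) < e"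
      proof (intro exI[of _ k] allI impI)
        fix m n assume "k \<le> m" "m < n"
        then show "dist (measure (\<mu> m) B) (measure (\<mu> n) B) < e"
          using cauchy[of m n B] B k[of m] by (auto simp: dist_real_def abs_minus_commute)
      qed
    qed
    then show ?thesis unfolding b_def using Cauchy_convergent convergent_LIMSEQ_iff by blast
  qed
  have near: "b B \<le> measure (\<mu> n) B + \<delta> n" if B: "B \<in> sets M" for B n
  proof (rule tendsto_upperbound[OF conv[OF B]])
    show "\<forall>\<^sub>F m in sequentially. measure (\<mu> m) B \<le> measure (\<mu> n) B + \<delta> n"
      using eventually_ge_at_top[of n]
    proof eventually_elim
      case (elim m)
      then show ?case using cauchy[of n m B] B by linarith
    qed
  qed simp
  have b0: "0 \<le> b B" if "B \<in> sets M" for B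
    by (rule tendsto_lowerbound[OF conv[OF that]]) auto
  define N where "N = measure_of (space M) (sets M) (\<lambda>B. ennreal (b B))"
  have b_empty: "b {} = 0" using conv[of "{}"] LIMSEQ_unique[of "\<lambda>_. 0" "b {}" 0] by simp
  have pos: "positive (sets M) (\<lambda>B. ennreal (b B))" by (simp add: positive_def b_empty)
  have "countably_additive (sets M) (\<lambda>B. ennreal (b B))"
  proof (rule sets.empty_continuous_imp_countably_additive[OF pos])
    show "additive (sets M) (\<lambda>B. ennreal (b B))"
      unfolding additive_def
    proof (intro ballI impI)
      fix A B assume AB: "A \<in> sets M" "B \<in> sets M" "A \<inter> B = {}"
      have "measure (\<mu> n) (A \<union> B) = measure (\<mu> n) A + measure (\<mu> n) B" for n
      proof -
        interpret prob_space "\<mu> n" by (rule \<mu>)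
        show ?thesis using AB \<mu>(2) by (intro finite_measure_Union) auto
      qed
      then have "b (A \<union> B) = b A + b B"
        using conv[of "A \<union> B"] tendsto_add[OF conv[OF AB(1)] conv[OF AB(2)]] AB
        by (intro LIMSEQ_unique[OF conv]) auto
      then show "ennreal (b (A \<union> B)) = ennreal (b A) + ennreal (b B)"
        using b0 AB by (simp add: ennreal_plus)
    qed
    fix A :: "nat \<Rightarrow> 'a set" assume A: "range A \<subseteq> sets M" "decseq A" "(\<Inter>i. A i) = {}"
    have Ai: "A i \<in> sets M" for i using A(1) by auto
    have "(\<lambda>i. b (A i)) \<longlonglongrightarrow> 0"
    proof (rule tendstoI)
      fix e :: real assume e: "0 < e"
      then have "\<forall>\<^sub>F n in sequentially. \<delta> n < e / 2" by (intro order_tendstoD(2)[OF \<delta>]) simp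
      then obtain n where n: "\<delta> n < e / 2" by (meson eventually_happens trivial_limit_sequentially)
      interpret prob_space "\<mu> n" by (rule \<mu>)
      have "(\<lambda>i. measure (\<mu> n) (A i)) \<longlonglongrightarrow> measure (\<mu> n) (\<Inter>i. A i)"
        using A \<mu>(2) by (intro finite_Lim_measure_decseq) auto
      then have "(\<lambda>i. measure (\<mu> n) (A i)) \<longlonglongrightarrow> 0" using A(3) by simp
      then have "\<forall>\<^sub>F i in sequentially. measure (\<mu> n) (A i) < e / 2" using e by (intro order_tendstoD(2)) auto
      then show "\<forall>\<^sub>F i in sequentially. dist (b (A i)) 0 < e"
      proof eventually_elim
        case (elim i)
        then show ?case using near[OF Ai, of i n] n b0[OF Ai, of i] by (simp add: dist_real_def)
      qed
    qed
    then show "(\<lambda>i. ennreal (b (A i))) \<longlonglongrightarrow> 0"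
      using tendsto_ennrealI[of "\<lambda>i. b (A i)" 0] by simp
  qed simp
  then have em: "emeasure N B = ennreal (b B)" if "B \<in> sets M" for B
    using that pos sets.space_closed[of M] sets.sigma_sets_eq unfolding N_def
    by (intro emeasure_measure_of_sigma) (auto simp: sets.sigma_algebra_axioms)
  have sN: "sets N = sets M" "space N = space M"
    unfolding N_def using sets.space_closed[of M] by (auto simp: sets.sigma_sets_eq)
  have m: "measure N B = b B" if "B \<in> sets M" for B
    using em[OF that] b0[OF that] by (simp add: measure_def)
  have "measure (\<mu> n) (space M) = 1" for n
    using prob_space.prob_space[OF \<mu>(1)] sets_eq_imp_space_eq[OF \<mu>(2)] by metis
  then have "(\<lambda>n. measure (\<mu> n) (space M)) \<longlonglongrightarrow> 1" by simp
  then have "b (space M) = 1" using LIMSEQ_unique[OF conv] by blast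
  then have "prob_space N" using em[of "space M"] sN(2) by (intro prob_spaceI) simp
  then show ?thesis using sN conv m by (intro exI[of _ N]) auto
qed

section \<open>Contraction rates in terms of elapsed time\<close>

context conditioned_semigroup
begin

definition steps :: "real \<Rightarrow> nat" where "steps t = nat \<lfloor>t / t0\<rfloor>"

lemma steps_le: "0 \<le> t \<Longrightarrow> real (steps t) * t0 \<le> t"
  using t0 unfolding steps_def by (simp add: pos_le_divide_eq[symmetric])

lemma steps_filterlim: "filterlim steps sequentially at_top"
proof -
  have "filterlim (\<lambda>t. t / t0) at_top at_top"
    using t0 filterlim_tendsto_pos_mult_at_top[of "\<lambda>_. 1 / t0" "1 / t0" at_top "\<lambda>t. t"]
    by (simp add: filterlim_ident)
  then show ?thesis unfolding steps_def
    by (intro filterlim_compose[OF filterlim_nat_sequentially] filterlim_compose[OF filterlim_floor_sequentially])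
qed

definition rate :: "real \<Rightarrow> real" where "rate t = (1 - c) ^ steps t"

lemma rate_at_top: "(rate \<longlongrightarrow> 0) at_top"
  unfolding rate_def using filterlim_compose[OF rate_tendsto steps_filterlim] .

end

section \<open>Initial laws, marginals of the transformed chain and its invariant measure\<close>

context periodic_semigroup
begin

definition start :: "'e measure \<Rightarrow> bool" where
  "start \<mu> \<longleftrightarrow> prob_space \<mu> \<and> sets \<mu> = sets M \<and> (AE x in \<mu>. x \<in> E 0)"

lemma startD:
  assumes "start \<mu>"
  shows "prob_space \<mu>" "sets \<mu> = sets M" "AE x in \<mu>. x \<in> E 0" "space \<mu> = UNIV" "finite_measure \<mu>"
  using assms sets_eq_imp_space_eq[of \<mu> M] prob_space.finite_measure unfolding start_def by auto

lemma start_integrable: "start \<mu> \<Longrightarrow> bm f \<Longrightarrow> integrable \<mu> f"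
  using integrable_bounded_measurable[OF startD(5,2)] by blast

text \<open>The expectation of \<open>f (X\<^sub>s)\<close> under \<open>\<P>\<^sub>\<mu>\<close> conditionally on \<open>\<tau>\<^sub>A > T\<close>.\<close>

definition surv_law :: "'e measure \<Rightarrow> real \<Rightarrow> real \<Rightarrow> ('e \<Rightarrow> real) \<Rightarrow> real" where
  "surv_law \<mu> s T f = (\<integral>x. P 0 s (\<lambda>y. f y * Z s T y) x \<partial>\<mu>) / (\<integral>x. Z 0 T x \<partial>\<mu>)"

context
  fixes \<eta> assumes \<eta>: "profile \<eta>"
begin

abbreviation "Q \<equiv> doob \<eta> 0"

lemmas harm = harmonic_profile[OF \<eta>]

lemma bm_Q: "t \<in> I \<Longrightarrow> bm f \<Longrightarrow> bm (Q t f)"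
  using bm_doob[OF harm[of t], of 0 f] I_nonneg by auto

lemma Q_off: "t \<in> I \<Longrightarrow> x \<notin> E 0 \<Longrightarrow> Q t f x = 0"
  using doob_off[OF harm[of t], of 0 x] I_nonneg by auto

lemma Q_bounds: "t \<in> I \<Longrightarrow> bm f \<Longrightarrow> (\<And>x. x \<in> E t \<Longrightarrow> a \<le> f x \<and> f x \<le> b) \<Longrightarrow> x \<in> E 0 \<Longrightarrow>
    a \<le> Q t f x \<and> Q t f x \<le> b"
  using doob_bounds[OF harm[of t], of 0 f a b x] I_nonneg by auto

text \<open>\<open>contraction\<close> with as many stretches of length \<open>t0\<close> as fit
  into \<open>t\<close>.\<close>

lemma forget:
  assumes "t \<in> I" "bm f" "\<And>x. x \<in> E t \<Longrightarrow> a \<le> f x \<and> f x \<le> b"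
  obtains a' b' where "b' - a' = rate t * (b - a)"
    "\<And>x. x \<in> E 0 \<Longrightarrow> a' \<le> Q t f x \<and> Q t f x \<le> b'"
  using contraction[OF assms(1) harm assms(2,3), of 0 "steps t"] steps_le[OF I_nonneg[OF assms(1)]]
  unfolding rate_def by auto

text \<open>The measure behind the functional \<open>Q t\<close>. It is a probability only for
  \<open>x \<in> E 0\<close>; elsewhere the divisor \<open>\<eta> 0 x\<close> is 0 and so is the
  density. Hence the restrictions to \<open>E 0\<close> in \<open>q_kernel\<close> and
  \<open>Qm\<close>.\<close>

definition q :: "real \<Rightarrow> 'e \<Rightarrow> 'e measure" where
  "q t x = density (K 0 t x) (\<lambda>y. ennreal (\<eta> t y / \<eta> 0 x))"

lemma sets_q: "t \<in> I \<Longrightarrow> sets (q t x) = sets M"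
  unfolding q_def using I_nonneg[of t] by simp

lemma integral_q:
  assumes "t \<in> I" "bm f" "x \<in> E 0"
  shows "(\<integral>y. f y \<partial>q t x) = Q t f x"
proof -
  have t: "0 \<le> t" using I_nonneg assms by auto
  have m: "g \<in> borel_measurable (K 0 t x)" if "bm g" for g
    using that bounded_measurable_cong_sets[OF K_sets[OF I_zero assms(1) t]] by blast
  have "(\<integral>y. f y \<partial>q t x) = (\<integral>y. (\<eta> t y / \<eta> 0 x) *\<^sub>R f y \<partial>K 0 t x)"
    unfolding q_def using profileD[OF \<eta>] assms
    by (intro integral_density m bounded_measurable_divide_const) auto
  also have "\<dots> = Q t f x" by (simp add: doob_def P_def mult.commute)
  finally show ?thesis .
qed

lemma prob_q:
  assumes "t \<in> I" "x \<in> E 0"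
  shows "prob_space (q t x)"
proof (rule prob_spaceI)
  have t: "0 \<le> t" using I_nonneg assms by auto
  have "emeasure (q t x) (space (q t x)) = (\<integral>\<^sup>+y. ennreal (\<eta> t y / \<eta> 0 x) \<partial>K 0 t x)"
  proof -
    have m: "\<eta> t \<in> borel_measurable (K 0 t x)"
      using profileD(1)[OF \<eta> assms(1)] bounded_measurable_cong_sets[OF K_sets[OF I_zero assms(1) t], of x]
      by blast
    then have "(\<lambda>y. ennreal (\<eta> t y / \<eta> 0 x)) \<in> borel_measurable (K 0 t x)" by measurable
    from emeasure_density[OF this sets.top] show ?thesis
      unfolding q_def by (simp add: nn_integral_set_ennreal[symmetric] cong: nn_integral_cong)
  qed
  also have "\<dots> = ennreal (\<integral>y. \<eta> t y / \<eta> 0 x \<partial>K 0 t x)"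
    using profileD[OF \<eta>] assms t
    by (intro nn_integral_eq_integral K_integrable bounded_measurable_divide_const) auto
  also have "(\<integral>y. \<eta> t y / \<eta> 0 x \<partial>K 0 t x) = 1"
    using profile_P[OF \<eta> I_zero assms(1) t, of x] profileD(2)[OF \<eta> I_zero assms(2)] by (simp add: P_def)
  finally show "emeasure (q t x) (space (q t x)) = 1" by simp
qed

lemma measure_q: "t \<in> I \<Longrightarrow> B \<in> sets M \<Longrightarrow> x \<in> E 0 \<Longrightarrow> measure (q t x) B = Q t (indicator B) x"
  using integral_q[of t "indicator B" x] sets_q[of t x] by simp

lemma q_kernel:
  assumes "t \<in> I"
  shows "q t \<in> restrict_space M (E 0) \<rightarrow>\<^sub>M prob_algebra M"
proof (intro measurable_prob_algebraI measurable_subprob_algebra)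
  fix B assume B: "B \<in> sets M"
  have "Q t (indicator B) \<in> borel_measurable (restrict_space M (E 0))"
    using assms B by (intro measurable_restrict_space1 bounded_measurableD bm_Q) auto
  moreover have "emeasure (q t x) B = ennreal (Q t (indicator B) x)" if "x \<in> space (restrict_space M (E 0))" for x
  proof -
    have x: "x \<in> E 0" using that by (simp add: space_restrict_space)
    interpret prob_space "q t x" using assms x by (rule prob_q)
    show ?thesis using assms B x by (simp add: emeasure_eq_measure measure_q)
  qed
  ultimately show "(\<lambda>x. emeasure (q t x) B) \<in> borel_measurable (restrict_space M (E 0))"
    by (subst measurable_cong) auto
qed (auto simp: space_restrict_space prob_q prob_space_imp_subprob_space sets_q assms)

definition Qm :: "'e measure \<Rightarrow> real \<Rightarrow> 'e measure" where
  "Qm \<beta> t = restrict_space \<beta> (E 0) \<bind> q t"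

context
  fixes \<beta> t assumes \<beta>: "start \<beta>" and t: "t \<in> I"
begin

lemma E0_beta: "E 0 \<in> sets \<beta>" using E_sets[of 0] startD[OF \<beta>] by simp

lemma restrict_beta: "prob_space (restrict_space \<beta> (E 0))"
proof -
  interpret prob_space \<beta> using startD[OF \<beta>] by simp
  have "emeasure \<beta> (E 0) = 1" using startD(3)[OF \<beta>] E0_beta
    by (simp add: prob_eq_1[symmetric] emeasure_eq_measure)
  then show ?thesis using E0_beta
    by (intro prob_spaceI) (simp add: emeasure_restrict_space space_restrict_space)
qed

lemma q_kernel_beta: "q t \<in> restrict_space \<beta> (E 0) \<rightarrow>\<^sub>M prob_algebra M"
  using q_kernel[OF t] sets_restrict_space_cong[OF startD(2)[OF \<beta>], of "E 0"] measurable_cong_sets by blast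

lemma Qm_prob: "prob_space (Qm \<beta> t)" and Qm_sets: "sets (Qm \<beta> t) = sets M"
proof -
  have "restrict_space \<beta> (E 0) \<in> space (prob_algebra (restrict_space \<beta> (E 0)))"
    using restrict_beta by (simp add: space_prob_algebra)
  then show "prob_space (Qm \<beta> t)" unfolding Qm_def using q_kernel_beta by (rule prob_space_bind')
  show "sets (Qm \<beta> t) = sets M"
    unfolding Qm_def
    using E_nonempty[of 0] startD(4)[OF \<beta>] t
    by (intro sets_bind sets_q) (auto simp: space_restrict_space)
qed

lemma integral_Qm:
  assumes f: "bm f"
  shows "(\<integral>y. f y \<partial>Qm \<beta> t) = (\<integral>x. Q t f x \<partial>\<beta>)"
proof -
  interpret prob_space "restrict_space \<beta> (E 0)" by (rule restrict_beta)
  obtain b where b: "0 < b" "\<And>x. \<bar>f x\<bar> \<le> b"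
    using bounded_measurable_bound[OF f] by (metis UNIV_I space_M)
  have "(\<integral>y. f y \<partial>Qm \<beta> t) = (\<integral>x. (\<integral>y. f y \<partial>q t x) \<partial>restrict_space \<beta> (E 0))"
    unfolding Qm_def
  proof (rule integral_bind[where B' = 1 and B = b and K = M])
    show "AE x in restrict_space \<beta> (E 0). emeasure (q t x) (space (q t x)) \<le> ennreal 1"
      using prob_q[OF t] by (auto intro!: AE_I2 simp: space_restrict_space prob_space.emeasure_space_1)
  qed (use f b measurable_prob_algebraD[OF q_kernel_beta] finite_measure_axioms in auto)
  also have "\<dots> = (\<integral>x. indicator (E 0) x *\<^sub>R (\<integral>y. f y \<partial>q t x) \<partial>\<beta>)"
    using E0_beta by (intro integral_restrict_space) simp
  also have "\<dots> = (\<integral>x. Q t f x \<partial>\<beta>)"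
    using t f by (intro Bochner_Integration.integral_cong) (auto simp: indicator_def integral_q Q_off)
  finally show ?thesis .
qed

end

definition invariant :: "'e measure \<Rightarrow> bool" where
  "invariant \<beta> \<longleftrightarrow> start \<beta> \<and> (\<forall>n. \<beta> = Qm \<beta> (real n * \<gamma>))"

lemma start_average_bounds:
  assumes \<beta>: "start \<beta>" and f: "bm f" and ab: "\<And>x. x \<in> E 0 \<Longrightarrow> a \<le> f x \<and> f x \<le> b"
  shows "a \<le> (\<integral>x. f x \<partial>\<beta>) \<and> (\<integral>x. f x \<partial>\<beta>) \<le> b"
proof -
  interpret prob_space \<beta> using startD[OF \<beta>] by simp
  have "(\<integral>x. a \<partial>\<beta>) \<le> (\<integral>x. f x \<partial>\<beta>)" "(\<integral>x. f x \<partial>\<beta>) \<le> (\<integral>x. b \<partial>\<beta>)"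
    by (rule integral_mono_AE; use start_integrable[OF \<beta> f] startD(3)[OF \<beta>] ab in force)+
  then show ?thesis by (simp add: prob_space)
qed

lemma rate_period: "(\<lambda>n. rate (real n * \<gamma>)) \<longlonglongrightarrow> 0"
proof (rule filterlim_compose[OF rate_at_top])
  show "filterlim (\<lambda>n. real n * \<gamma>) at_top sequentially"
    by (rule filterlim_at_top_mult_tendsto_pos[OF tendsto_const period(2) filterlim_real_sequentially])
qed

text \<open>Either measure gives \<open>B\<close> the average of
  \<open>Q (real n * \<gamma>) (indicator B)\<close>, a function whose oscillation on
  \<open>E 0\<close> tends to 0 with growing \<open>n\<close>.\<close>

lemma invariant_unique:
  assumes "invariant \<beta>" "invariant \<beta>'"
  shows "\<beta> = \<beta>'"
proof (rule measure_eqI)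
  have s: "start \<beta>" "start \<beta>'" using assms by (auto simp: invariant_def)
  show "sets \<beta> = sets \<beta>'" using s startD(2) by simp
  fix B assume "B \<in> sets \<beta>"
  then have B: "B \<in> sets M" using startD(2)[OF s(1)] by simp
  have m: "measure L B = (\<integral>x. Q (real n * \<gamma>) (indicator B) x \<partial>L)" if "invariant L" for L n
  proof -
    have L: "start L" "L = Qm L (real n * \<gamma>)" using that unfolding invariant_def by blast+
    have "measure L B = (\<integral>x. indicator B x \<partial>L)" using B startD(2)[OF L(1)] by simp
    also have "\<dots> = (\<integral>x. indicator B x \<partial>Qm L (real n * \<gamma>))" using L(2) by simp
    also have "\<dots> = (\<integral>x. Q (real n * \<gamma>) (indicator B) x \<partial>L)"
      using B by (intro integral_Qm L period_mult) auto
    finally show ?thesis .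
  qed
  have "\<bar>measure \<beta> B - measure \<beta>' B\<bar> \<le> rate (real n * \<gamma>)" for n
  proof -
    have "\<And>x. 0 \<le> (indicator B x :: real) \<and> indicator B x \<le> (1 :: real)" by (simp add: indicator_def)
    from forget[OF period_mult(1)[of n] bounded_measurable_indicator[OF B] this]
    obtain a b where ab: "b - a = rate (real n * \<gamma>) * (1 - 0)"
      "\<And>x. x \<in> E 0 \<Longrightarrow> a \<le> Q (real n * \<gamma>) (indicator B) x \<and> Q (real n * \<gamma>) (indicator B) x \<le> b" by blast
    have f: "bm (Q (real n * \<gamma>) (indicator B))" using B by (intro bm_Q period_mult) auto
    have "a \<le> measure L B \<and> measure L B \<le> b" if "invariant L" for L
      using m[OF that, of n] start_average_bounds[OF _ f, of L a b] ab(2) that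
      unfolding invariant_def by auto
    from this[OF assms(1)] this[OF assms(2)] show ?thesis using ab(1) by (auto simp: abs_le_iff)
  qed
  then have "\<bar>measure \<beta> B - measure \<beta>' B\<bar> \<le> 0"
    by (intro tendsto_lowerbound[OF rate_period]) auto
  then show "emeasure \<beta> B = emeasure \<beta>' B"
    using s startD(5) finite_measure.emeasure_eq_measure by (metis abs_le_zero_iff eq_iff_diff_eq_0)
qed

text \<open>The laws \<open>\<mu> n\<close> of the skeleton started from one state \<open>x0\<close>
  converge: for \<open>m \<ge> n\<close> the value of \<open>\<mu> m\<close> on \<open>B\<close> is
  an average of \<open>Q (real n * \<gamma>) (indicator B)\<close>, whose oscillation is at most
  \<open>rate (real n * \<gamma>)\<close> whatever \<open>B\<close> is. This uniformity makes the
  setwise limit a measure.\<close>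

lemma ex_invariant: "\<exists>\<beta>. invariant \<beta>"
proof -
  obtain x0 where x0: "x0 \<in> E 0" using E_nonempty[of 0] by auto
  define \<mu> where "\<mu> n = q (real n * \<gamma>) x0" for n :: nat
  have \<mu>: "prob_space (\<mu> n)" "sets (\<mu> n) = sets M" for n
    using prob_q[OF period_mult(1) x0] sets_q[OF period_mult(1)] by (auto simp: \<mu>_def)
  have cauchy: "\<bar>measure (\<mu> m) B - measure (\<mu> n) B\<bar> \<le> rate (real n * \<gamma>)"
    if nm: "n \<le> m" and B: "B \<in> sets M" for n m B
  proof -
    have "\<And>x. 0 \<le> (indicator B x :: real) \<and> indicator B x \<le> (1 :: real)" by (simp add: indicator_def)
    from forget[OF period_mult(1)[of n] bounded_measurable_indicator[OF B] this]
    obtain a b where ab: "b - a = rate (real n * \<gamma>) * (1 - 0)"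
      "\<And>x. x \<in> E 0 \<Longrightarrow> a \<le> Q (real n * \<gamma>) (indicator B) x \<and> Q (real n * \<gamma>) (indicator B) x \<le> b" by blast
    have "real m * \<gamma> = real (m - n) * \<gamma> + real n * \<gamma>" using nm by (simp add: of_nat_diff algebra_simps)
    then have "Q (real m * \<gamma>) (indicator B) x0 = Q (real (m - n) * \<gamma>) (Q (real n * \<gamma>) (indicator B)) x0"
      using doob_Chapman_period[OF \<eta> period_mult(1)[of n] bounded_measurable_indicator[OF B], of "m - n" x0]
      by simp
    then have "measure (\<mu> m) B = Q (real (m - n) * \<gamma>) (Q (real n * \<gamma>) (indicator B)) x0"
      unfolding \<mu>_def measure_q[OF period_mult(1) B x0] .
    moreover have "bm (Q (real n * \<gamma>) (indicator B))" using B by (intro bm_Q period_mult) auto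
    ultimately have "a \<le> measure (\<mu> m) B \<and> measure (\<mu> m) B \<le> b"
      using Q_bounds[OF period_mult(1)[of "m - n"], of "Q (real n * \<gamma>) (indicator B)" a b x0] ab(2) x0
        E_periodic[of "m - n"] by auto
    moreover have "a \<le> measure (\<mu> n) B \<and> measure (\<mu> n) B \<le> b"
      unfolding \<mu>_def using measure_q[OF period_mult(1) B x0] ab(2)[OF x0] by simp
    ultimately show ?thesis using ab(1) by (auto simp: abs_le_iff)
  qed
  obtain \<beta> where \<beta>: "prob_space \<beta>" "sets \<beta> = sets M"
    "\<And>B. B \<in> sets M \<Longrightarrow> (\<lambda>n. measure (\<mu> n) B) \<longlonglongrightarrow> measure \<beta> B"
    using ex_uniform_setwise_limit[OF \<mu> cauchy rate_period] by blast
  have lim: "(\<lambda>n. Q (real n * \<gamma>) f x0) \<longlonglongrightarrow> (\<integral>x. f x \<partial>\<beta>)" if f: "bm f" for f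
    using integral_setwise_limit[OF \<mu> \<beta> f] unfolding \<mu>_def by (simp add: integral_q[OF period_mult(1) f x0])
  interpret \<beta>: prob_space \<beta> by (rule \<beta>(1))
  \<comment> \<open>All the laws \<open>\<mu> n\<close> live on
    \<open>E (real n * \<gamma>) = E 0\<close>, so the limit does.\<close>
  have "Q (real n * \<gamma>) (indicator (E 0)) x0 = 1" for n
    using Q_bounds[OF period_mult(1)[of n], of "indicator (E 0)" 1 1 x0] x0 E_sets[of 0] E_periodic[of n] by auto
  then have "measure \<beta> (E 0) = 1"
    using lim[of "indicator (E 0)"] E_sets[of 0] \<beta>(2) LIMSEQ_unique[of "\<lambda>_. 1" 1] by auto
  then have st: "start \<beta>" unfolding start_def using \<beta> E_sets[of 0] \<beta>.prob_eq_1[of "E 0"] by auto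
  have "\<beta> = Qm \<beta> (real k * \<gamma>)" for k
  proof (rule measure_eqI)
    show "sets \<beta> = sets (Qm \<beta> (real k * \<gamma>))" using \<beta>(2) Qm_sets[OF st period_mult(1)] by simp
    fix B assume "B \<in> sets \<beta>"
    then have B: "B \<in> sets M" using \<beta>(2) by simp
    let ?f = "Q (real k * \<gamma>) (indicator B)"
    interpret k: prob_space "Qm \<beta> (real k * \<gamma>)" by (rule Qm_prob[OF st period_mult(1)])
    have f: "bm ?f" using B by (intro bm_Q period_mult) auto
    \<comment> \<open>Dropping the first \<open>k\<close> terms keeps the limit, while
      Chapman-Kolmogorov moves the last \<open>k\<close> periods onto the test function; equality of
      the two limits is invariance.\<close>
    have "(\<lambda>n. Q (real (n + k) * \<gamma>) (indicator B) x0) \<longlonglongrightarrow> (\<integral>x. indicator B x \<partial>\<beta>)"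
      using lim[OF bounded_measurable_indicator[OF B]] by (rule LIMSEQ_ignore_initial_segment)
    moreover have "Q (real (n + k) * \<gamma>) (indicator B) x0 = Q (real n * \<gamma>) ?f x0" for n
      using doob_Chapman_period[OF \<eta> period_mult(1)[of k] bounded_measurable_indicator[OF B], of n x0]
      by (simp add: distrib_right)
    ultimately have "(\<integral>x. indicator B x \<partial>\<beta>) = (\<integral>x. ?f x \<partial>\<beta>)"
      using lim[OF f] LIMSEQ_unique by auto
    also have "\<dots> = (\<integral>x. indicator B x \<partial>Qm \<beta> (real k * \<gamma>))"
      using B by (intro integral_Qm[symmetric] st period_mult) auto
    finally have "measure \<beta> B = measure (Qm \<beta> (real k * \<gamma>)) B"
      using B \<beta>(2) Qm_sets[OF st period_mult(1)] by simp
    then show "emeasure \<beta> B = emeasure (Qm \<beta> (real k * \<gamma>)) B"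
      by (simp add: \<beta>.emeasure_eq_measure k.emeasure_eq_measure)
  qed
  then show ?thesis using st unfolding invariant_def by blast
qed

text \<open>The \<open>n\<close> whole periods are run before the time \<open>s\<close>, where the
  invariance of \<open>\<beta>\<close> swallows them.\<close>

lemma invariant_periodic:
  assumes \<beta>: "invariant \<beta>" and s: "s \<in> I" and f: "bm f"
  shows "(\<integral>x. Q (s + real n * \<gamma>) f x \<partial>\<beta>) = (\<integral>x. Q s f x \<partial>\<beta>)"
proof -
  have st: "start \<beta>" "Qm \<beta> (real n * \<gamma>) = \<beta>" using \<beta> unfolding invariant_def by auto
  have "(\<integral>x. Q (s + real n * \<gamma>) f x \<partial>\<beta>) = (\<integral>x. Q (real n * \<gamma>) (Q s f) x \<partial>\<beta>)"
    using doob_Chapman_period[OF \<eta> s f, of n] by (simp add: add.commute)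
  also have "\<dots> = (\<integral>x. Q s f x \<partial>Qm \<beta> (real n * \<gamma>))"
    using s f by (intro integral_Qm[symmetric] st bm_Q period_mult)
  finally show ?thesis using st by simp
qed

text \<open>Two errors add up. Replacing the weight \<open>Z s T\<close> by \<open>\<eta> s\<close>
  costs the term with \<open>gap\<close>, governed by the remaining time \<open>T - s\<close>. What
  results is an expectation under the \<open>Q\<close>-process started from \<open>\<mu>\<close>
  reweighted by \<open>\<eta> 0\<close>; changing that initial law into \<open>\<beta>\<close> costs
  the oscillation of \<open>Q s f\<close>, governed by the elapsed time \<open>s\<close>, where
  \<open>2 * b\<close> bounds the oscillation of \<open>f\<close>.\<close>

lemma surv_law_vs_invariant:
  assumes \<mu>: "start \<mu>" and \<beta>: "start \<beta>" and f: "bm f" "\<And>x. \<bar>f x\<bar> \<le> b"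
    and s: "s \<in> I" and T: "T \<in> I" "s + t0 \<le> T"
  shows "\<bar>surv_law \<mu> s T f - (\<integral>x. Q s f x \<partial>\<beta>)\<bar> \<le> b * gap (steps (T - s)) + 2 * b * rate s"
proof -
  interpret \<mu>: prob_space \<mu> using startD[OF \<mu>] by simp
  have s0: "0 \<le> s" "s \<le> T" using I_nonneg[OF s] T t0 by auto
  have b0: "0 \<le> b" using f(2) abs_ge_zero order_trans by blast
  note K0 = K_kernel[OF I_zero s s0(1)]
  have Kmu: "K 0 s \<in> \<mu> \<rightarrow>\<^sub>M subprob_algebra M" using K0 measurable_cong_sets[OF startD(2)[OF \<mu>] refl] by blast
  \<comment> \<open>The law of the state at time \<open>s\<close> on survival up to \<open>s\<close>
    under \<open>\<mu>\<close>; \<open>survival_weight_vs_profile\<close> applies to it with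
    \<open>Y\<close> the identity.\<close>
  define N where "N = \<mu> \<bind> K 0 s"
  have N_sets: "sets N = sets M"
    unfolding N_def using startD(4)[OF \<mu>] s s0 by (intro sets_bind) auto
  have "subprob_space N" unfolding N_def
    using \<mu>.prob_space_axioms Kmu by (intro subprob_space_bind prob_space_imp_subprob_space)
  then have N_fin: "finite_measure N" by (simp add: subprob_space_def)
  have int_N: "(\<integral>y. g y \<partial>N) = (\<integral>x. P 0 s g x \<partial>\<mu>)" if g: "bm g" for g
  proof -
    obtain B where B: "0 < B" "\<And>x. \<bar>g x\<bar> \<le> B"
      using bounded_measurable_bound[OF g] by (metis UNIV_I space_M)
    show ?thesis unfolding N_def P_def
      using g B s s0
      by (intro integral_bind[where B = B and B' = 1 and K = M] Kmu \<mu>.finite_measure_axioms)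
         (auto intro!: AE_I2 subprob_space.subprob_emeasure_le_1 K_subprob)
  qed
  have id: "(\<lambda>y. y) \<in> N \<rightarrow>\<^sub>M M" using N_sets by (simp add: measurable_ident_sets)
  have fN: "bounded_measurable N f" using f(1) bounded_measurable_cong_sets[OF N_sets] by blast
  note \<eta>D = profileD[OF \<eta>]
  have eta_N: "(\<integral>y. \<eta> s y \<partial>N) = (\<integral>x. \<eta> 0 x \<partial>\<mu>)"
    using profile_P[OF \<eta> I_zero s s0(1)] \<eta>D(1)[OF s] by (simp add: int_N)
  have eta_pos: "0 < (\<integral>x. \<eta> 0 x \<partial>\<mu>)"
  proof -
    have "0 \<le> (\<integral>x. \<eta> 0 x \<partial>\<mu>)" using \<eta>D(4)[OF I_zero] by (auto intro!: Bochner_Integration.integral_nonneg)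
    moreover have "(\<integral>x. \<eta> 0 x \<partial>\<mu>) \<noteq> 0"
    proof
      assume "(\<integral>x. \<eta> 0 x \<partial>\<mu>) = 0"
      then have "AE x in \<mu>. \<eta> 0 x = 0"
        using \<eta>D(1,4)[OF I_zero] start_integrable[OF \<mu>] by (subst (asm) integral_nonneg_eq_0_iff_AE) auto
      then have "AE x in \<mu>. False" using startD(3)[OF \<mu>]
        by eventually_elim (use \<eta>D(2)[OF I_zero] in force)
      then show False by simp
    qed
    ultimately show ?thesis by simp
  qed
  have A: "\<bar>surv_law \<mu> s T f - (\<integral>x. P 0 s (\<lambda>y. f y * \<eta> s y) x \<partial>\<mu>) / (\<integral>x. \<eta> 0 x \<partial>\<mu>)\<bar> \<le> b * gap (steps (T - s))"
  proof -
    have "s + real (steps (T - s)) * t0 \<le> T" using steps_le[of "T - s"] s0 by simp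
    from survival_weight_vs_profile[OF \<eta> N_fin id fN f(2) b0 s T this]
    have "\<bar>(\<integral>w. f w * Z s T w \<partial>N) / (\<integral>w. Z s T w \<partial>N) -
      (\<integral>w. f w * \<eta> s w \<partial>N) / (\<integral>w. \<eta> s w \<partial>N)\<bar> \<le> b * gap (steps (T - s))" using eta_pos eta_N by simp
    moreover have "(\<integral>w. f w * Z s T w \<partial>N) = (\<integral>x. P 0 s (\<lambda>y. f y * Z s T y) x \<partial>\<mu>)"
      using s T s0 f by (intro int_N bounded_measurable_mult bm_Z)
    moreover have "(\<integral>w. Z s T w \<partial>N) = (\<integral>x. Z 0 T x \<partial>\<mu>)"
      using s T s0 by (simp add: int_N bm_Z P_Z)
    moreover have "(\<integral>w. f w * \<eta> s w \<partial>N) = (\<integral>x. P 0 s (\<lambda>y. f y * \<eta> s y) x \<partial>\<mu>)"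
      using f \<eta>D(1)[OF s] by (intro int_N bounded_measurable_mult)
    ultimately show ?thesis using eta_N by (simp add: surv_law_def)
  qed
  have fb: "\<And>x. - b \<le> f x \<and> f x \<le> b" using f(2) by (simp add: abs_le_iff) (metis minus_le_iff)
  from forget[OF s f(1) fb] obtain a' b' where
    ab: "b' - a' = rate s * (b - - b)" "\<And>x. x \<in> E 0 \<Longrightarrow> a' \<le> Q s f x \<and> Q s f x \<le> b'" by blast
  \<comment> \<open>\<open>P 0 s (\<lambda>y. f y * \<eta> s y)\<close> is \<open>Q s f\<close>
    times \<open>\<eta> 0\<close>, so the reweighted expectation lies between the bounds of
    \<open>Q s f\<close>.\<close>
  have "a' * (\<integral>x. \<eta> 0 x \<partial>\<mu>) \<le> (\<integral>x. P 0 s (\<lambda>y. f y * \<eta> s y) x \<partial>\<mu>) \<and>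
    (\<integral>x. P 0 s (\<lambda>y. f y * \<eta> s y) x \<partial>\<mu>) \<le> b' * (\<integral>x. \<eta> 0 x \<partial>\<mu>)"
  proof -
    have "a' * \<eta> 0 x \<le> P 0 s (\<lambda>y. f y * \<eta> s y) x \<and> P 0 s (\<lambda>y. f y * \<eta> s y) x \<le> b' * \<eta> 0 x" for x
      using doob_mult[OF harm s I_zero s0(1), of f x] ab(2)[of x] \<eta>D(3,4)[OF I_zero, of x]
      by (cases "x \<in> E 0") (metis mult_right_mono, simp add: P_dead[OF I_zero s s0(1)])
    moreover have "bm (P 0 s (\<lambda>y. f y * \<eta> s y))" using f \<eta>D(1)[OF s] s s0 by (intro bm_P bounded_measurable_mult) auto
    ultimately have "(\<integral>x. a' * \<eta> 0 x \<partial>\<mu>) \<le> (\<integral>x. P 0 s (\<lambda>y. f y * \<eta> s y) x \<partial>\<mu>)"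
      "(\<integral>x. P 0 s (\<lambda>y. f y * \<eta> s y) x \<partial>\<mu>) \<le> (\<integral>x. b' * \<eta> 0 x \<partial>\<mu>)"
      using \<eta>D(1)[OF I_zero] by (intro integral_mono start_integrable[OF \<mu>] bounded_measurable_mult
          bounded_measurable_const; simp)+
    then show ?thesis by simp
  qed
  then have "a' \<le> (\<integral>x. P 0 s (\<lambda>y. f y * \<eta> s y) x \<partial>\<mu>) / (\<integral>x. \<eta> 0 x \<partial>\<mu>) \<and>
    (\<integral>x. P 0 s (\<lambda>y. f y * \<eta> s y) x \<partial>\<mu>) / (\<integral>x. \<eta> 0 x \<partial>\<mu>) \<le> b'"
    using eta_pos by (simp add: pos_le_divide_eq pos_divide_le_eq)
  moreover have "a' \<le> (\<integral>x. Q s f x \<partial>\<beta>) \<and> (\<integral>x. Q s f x \<partial>\<beta>) \<le> b'"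
    using ab(2) by (intro start_average_bounds[OF \<beta>] bm_Q s f)
  ultimately show ?thesis using A ab(1) by (simp add: algebra_simps) linarith
qed

lemma surv_law_uniform:
  assumes \<mu>: "start \<mu>" and \<beta>: "start \<beta>" and f: "bm f" and e: "0 < e"
  obtains N where "0 < N" "\<And>s T. s \<in> I \<Longrightarrow> T \<in> I \<Longrightarrow> N \<le> s \<Longrightarrow> s + N \<le> T \<Longrightarrow>
    \<bar>surv_law \<mu> s T f - (\<integral>x. Q s f x \<partial>\<beta>)\<bar> \<le> e"
proof -
  obtain b where b: "0 < b" "\<And>x. \<bar>f x\<bar> \<le> b"
    using bounded_measurable_bound[OF f] by (metis UNIV_I space_M)
  have "((\<lambda>t. b * gap (steps t)) \<longlongrightarrow> b * 0) at_top"
    by (intro tendsto_mult tendsto_const filterlim_compose[OF gap_tendsto[OF \<eta>] steps_filterlim])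
  then have "\<forall>\<^sub>F t in at_top. b * gap (steps t) < e / 2" using e by (intro order_tendstoD(2)) auto
  then obtain N1 where N1: "\<And>t. N1 \<le> t \<Longrightarrow> b * gap (steps t) < e / 2"
    unfolding eventually_at_top_linorder by blast
  have "((\<lambda>t. 2 * b * rate t) \<longlongrightarrow> 2 * b * 0) at_top"
    by (intro tendsto_mult tendsto_const rate_at_top)
  then have "\<forall>\<^sub>F t in at_top. 2 * b * rate t < e / 2" using e by (intro order_tendstoD(2)) auto
  then obtain N2 where N2: "\<And>t. N2 \<le> t \<Longrightarrow> 2 * b * rate t < e / 2"
    unfolding eventually_at_top_linorder by blast
  \<comment> \<open>The entry \<open>t0\<close> secures the hypothesis \<open>s + t0 \<le> T\<close>
    of the estimate.\<close>
  define N where "N = max (max N1 N2) t0"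
  show ?thesis
  proof (rule that[of N])
    show "0 < N" using t0 by (simp add: N_def)
    fix s T assume "s \<in> I" "T \<in> I" "N \<le> s" "s + N \<le> T"
    moreover from this have "s + t0 \<le> T" "N1 \<le> T - s" "N2 \<le> s" unfolding N_def by linarith+
    ultimately show "\<bar>surv_law \<mu> s T f - (\<integral>x. Q s f x \<partial>\<beta>)\<bar> \<le> e"
      using surv_law_vs_invariant[OF \<mu> \<beta> f b(2), of s T] N1[of "T - s"] N2[of s] by linarith
  qed
qed

end

end

section \<open>The kernels of an absorbed Markov process\<close>

context absorbed_markov_process
begin

abbreviation "\<Omega> \<equiv> space (Sample S)"

lemma Time_zero: "0 \<in> Time S"
  using time by (elim disjE) simp_all
lemma Time_nonneg: "t \<in> Time S \<Longrightarrow> 0 \<le> t"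
  using time by (elim disjE) (auto simp: Nats_altdef1)
lemma Time_add: "s \<in> Time S \<Longrightarrow> t \<in> Time S \<Longrightarrow> s + t \<in> Time S"
  using time by (elim disjE) simp_all

lemma Pr_prob: "s \<in> Time S \<Longrightarrow> prob_space (Pr S s x)"
  and Pr_sets: "s \<in> Time S \<Longrightarrow> sets (Pr S s x) = sets (Sample S)"
  using measurable_space[OF Pr_kernel, of s x] state_space by (auto simp: space_prob_algebra)

lemma Pr_space: "s \<in> Time S \<Longrightarrow> space (Pr S s x) = \<Omega>"
  using Pr_sets[of s x] sets_eq_imp_space_eq by blast

lemma measurable_Pr:
  assumes "s \<in> Time S" "f \<in> Sample S \<rightarrow>\<^sub>M R"
  shows "f \<in> Pr S s x \<rightarrow>\<^sub>M R"
  using assms(2) unfolding measurable_cong_sets[OF Pr_sets[OF assms(1)] refl] .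

lemma coord_meas:
  assumes "t \<in> Time S"
  shows "coord S t \<in> Sample S \<rightarrow>\<^sub>M State S"
proof -
  have "(\<lambda>w. (t, w)) \<in> Sample S \<rightarrow>\<^sub>M restrict_space borel (Time S) \<Otimes>\<^sub>M Sample S"
    using assms by (intro measurable_Pair1') (simp add: space_restrict_space)
  from measurable_compose[OF this coord_measurable] show ?thesis by simp
qed

lemma space_generated [simp]: "space (generated S J) = \<Omega>"
  unfolding generated_def by (rule space_measure_of) auto

lemma sets_generated: "sets (generated S J) = sigma_sets \<Omega>
     {coord S u -` B \<inter> \<Omega> | u B. u \<in> Time S \<inter> J \<and> B \<in> sets (State S)}"
  unfolding generated_def by (rule sets_measure_of) auto

lemma generated_Sample: "sets (generated S J) \<subseteq> sets (Sample S)"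
  unfolding sets_generated
  by (intro sets.sigma_sets_subset) (auto intro!: measurable_sets[OF coord_meas])

lemma generated_mono: "J \<subseteq> J' \<Longrightarrow> sets (generated S J) \<subseteq> sets (generated S J')"
  unfolding sets_generated by (intro sigma_sets_mono') auto

lemma coord_generated:
  assumes "u \<in> Time S" "u \<in> J"
  shows "coord S u \<in> generated S J \<rightarrow>\<^sub>M State S"
proof (rule measurableI)
  fix B assume "B \<in> sets (State S)"
  then show "coord S u -` B \<inter> space (generated S J) \<in> sets (generated S J)"
    unfolding sets_generated space_generated using assms by (intro sigma_sets.Basic) auto
qed (simp add: state_space)

text \<open>A strict inequality for the infimum leaves room: surviving up to \<open>T\<close> means
  avoiding the absorbing sets up to some \<open>r\<close> strictly after \<open>T\<close>. In this
  form events of survival can be split and shifted.\<close>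

lemma survives_iff:
  "ereal T < hit S s w \<longleftrightarrow>
     (\<exists>r>T. \<forall>t\<in>Time S. s \<le> t \<longrightarrow> t < r \<longrightarrow> coord S t w \<notin> absorbing S t)"
proof
  assume "ereal T < hit S s w"
  then obtain r where r: "ereal T < ereal r" "ereal r < hit S s w" using ereal_dense2 by blast
  have "coord S t w \<notin> absorbing S t" if "t \<in> Time S" "s \<le> t" "t < r" for t
  proof
    assume "coord S t w \<in> absorbing S t"
    then have "hit S s w \<le> ereal t" unfolding hit_def using that by (intro INF_lower) auto
    also have "\<dots> < ereal r" using that by simp
    finally show False using r(2) by simp
  qed
  then show "\<exists>r>T. \<forall>t\<in>Time S. s \<le> t \<longrightarrow> t < r \<longrightarrow> coord S t w \<notin> absorbing S t"
    using r(1) by auto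
next
  assume "\<exists>r>T. \<forall>t\<in>Time S. s \<le> t \<longrightarrow> t < r \<longrightarrow> coord S t w \<notin> absorbing S t"
  then obtain r where r: "T < r" "\<forall>t\<in>Time S. s \<le> t \<longrightarrow> t < r \<longrightarrow> coord S t w \<notin> absorbing S t" by blast
  have "ereal T < ereal r" using r(1) by simp
  also have "ereal r \<le> hit S s w"
    unfolding hit_def using r(2) by (intro INF_greatest) (auto simp: not_less[symmetric])
  finally show "ereal T < hit S s w" .
qed

lemma surviving_space: "surviving S s t \<subseteq> \<Omega>"
  unfolding surviving_def by auto

text \<open>The witness of the first event reaches beyond \<open>u\<close>, where the second event
  takes over; the witness of the second then serves for the whole.\<close>

lemma surviving_split:
  assumes "s \<le> u" "u \<le> t"
  shows "surviving S s t = surviving S s u \<inter> surviving S u t"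
proof (intro set_eqI iffI)
  fix w assume "w \<in> surviving S s t"
  then obtain r where r: "w \<in> \<Omega>" "t < r" "\<forall>t\<in>Time S. s \<le> t \<longrightarrow> t < r \<longrightarrow> coord S t w \<notin> absorbing S t"
    unfolding surviving_def survives_iff by auto
  then show "w \<in> surviving S s u \<inter> surviving S u t"
    unfolding surviving_def survives_iff using assms by (auto intro!: exI[of _ r])
next
  fix w assume "w \<in> surviving S s u \<inter> surviving S u t"
  then obtain r r' where r: "w \<in> \<Omega>" "u < r" "\<forall>t\<in>Time S. s \<le> t \<longrightarrow> t < r \<longrightarrow> coord S t w \<notin> absorbing S t"
    "t < r'" "\<forall>t\<in>Time S. u \<le> t \<longrightarrow> t < r' \<longrightarrow> coord S t w \<notin> absorbing S t"
    unfolding surviving_def survives_iff by auto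
  then have "\<forall>t\<in>Time S. s \<le> t \<longrightarrow> t < r' \<longrightarrow> coord S t w \<notin> absorbing S t"
    by (metis less_trans not_le)
  then show "w \<in> surviving S s t"
    unfolding surviving_def survives_iff using r by auto
qed

lemma surviving_generated:
  assumes "s \<in> Time S" "t \<in> Time S"
  shows "surviving S s t \<in> sets (generated S {s..t})"
proof -
  have "surviving S s t = space (generated S {s..t}) - {w \<in> \<Omega>. hit S s w \<le> ereal t}"
    unfolding surviving_def by (auto simp: not_le)
  then show ?thesis using hit_stopping_time[OF assms] by (simp only:) (rule sets.compl_sets)
qed

lemma surviving_sets:
  "s \<in> Time S \<Longrightarrow> t \<in> Time S \<Longrightarrow> surviving S s t \<in> sets (Sample S)"
  using surviving_generated generated_Sample by blast

lemma surviving_alive: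
  "t \<in> Time S \<Longrightarrow> s \<le> t \<Longrightarrow> w \<in> surviving S s t \<Longrightarrow> coord S t w \<in> alive S t"
  unfolding surviving_def survives_iff alive_def state_space by auto

lemma alive_sets: "t \<in> Time S \<Longrightarrow> alive S t \<in> sets (State S)"
  unfolding alive_def using absorbing_sets by auto

lemma Pr_measurable:
  assumes "t \<in> Time S" "B \<in> sets (Sample S)"
  shows "(\<lambda>x. emeasure (Pr S t x) B) \<in> borel_measurable (State S)"
    "(\<lambda>x. measure (Pr S t x) B) \<in> borel_measurable (State S)"
  using measurable_compose[OF measurable_prob_algebraD[OF Pr_kernel[OF assms(1)]]] assms(2)
    measurable_emeasure_subprob_algebra measurable_measure_subprob_algebra by blast+

text \<open>The conditional expectation in \<open>markov\<close>, integrated over an event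
  \<open>A\<close> of the past.\<close>

lemma markov_sets:
  assumes "s \<in> Time S" "t \<in> Time S" "s \<le> t"
    and A: "A \<in> sets (generated S {s..t})" and B: "B \<in> sets (generated S {t..})"
  shows "emeasure (Pr S s x) (A \<inter> B) =
    (\<integral>\<^sup>+w. indicator A w * ennreal (measure (Pr S t (coord S t w)) B) \<partial>Pr S s x)"
proof -
  interpret prob_space "Pr S s x" using assms by (intro Pr_prob)
  let ?F = "generated S {s..t}"
  have sub: "subalgebra (Pr S s x) ?F"
    unfolding subalgebra_def using generated_Sample assms by (simp add: Pr_space Pr_sets)
  interpret finite_measure_subalgebra "Pr S s x" ?F by unfold_locales (rule sub)
  have B': "B \<in> sets (Sample S)" using B generated_Sample by auto
  have sets: "A \<in> sets (Pr S s x)" "B \<in> sets (Pr S s x)"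
    unfolding Pr_sets[OF assms(1)] using A B generated_Sample by auto
  have Bint: "integrable (Pr S s x) (indicator B :: _ \<Rightarrow> real)"
    by (intro integrable_const_bound[where B=1] borel_measurable_indicator sets) (auto simp: indicator_def)
  have cm: "(\<lambda>w. measure (Pr S t (coord S t w)) B) \<in> borel_measurable (Pr S s x)"
    by (intro measurable_Pr assms measurable_compose[OF coord_meas Pr_measurable(2)] B')
  have "measure (Pr S s x) (A \<inter> B) = (\<integral>w\<in>A. indicator B w \<partial>Pr S s x)"
    using sets by (simp add: set_lebesgue_integral_def indicator_inter_arith[symmetric])
  also have "\<dots> = (\<integral>w\<in>A. real_cond_exp (Pr S s x) ?F (indicator B) w \<partial>Pr S s x)"
    by (rule real_cond_exp_intA[OF Bint A])
  also have "\<dots> = (\<integral>w. indicator A w * measure (Pr S t (coord S t w)) B \<partial>Pr S s x)"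
    unfolding set_lebesgue_integral_def
  proof (rule integral_cong_AE)
    show "AE w in Pr S s x. indicator A w *\<^sub>R real_cond_exp (Pr S s x) ?F (indicator B) w =
      indicator A w * measure (Pr S t (coord S t w)) B"
      using markov[OF assms(1-3) B, of x] by eventually_elim simp
  qed (use sets cm borel_measurable_cond_exp2 in \<open>simp_all\<close>)
  finally have *: "measure (Pr S s x) (A \<inter> B) = (\<integral>w. indicator A w * measure (Pr S t (coord S t w)) B \<partial>Pr S s x)" .
  have "(\<integral>\<^sup>+w. indicator A w * ennreal (measure (Pr S t (coord S t w)) B) \<partial>Pr S s x) =
     (\<integral>\<^sup>+w. ennreal (indicator A w * measure (Pr S t (coord S t w)) B) \<partial>Pr S s x)"
    by (intro nn_integral_cong) (auto simp: indicator_def)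
  also have "\<dots> = ennreal (\<integral>w. indicator A w * measure (Pr S t (coord S t w)) B \<partial>Pr S s x)"
  proof (rule nn_integral_eq_integral)
    show "integrable (Pr S s x) (\<lambda>w. indicator A w * measure (Pr S t (coord S t w)) B)"
    proof (rule integrable_const_bound[where B=1])
      show "AE w in Pr S s x. norm (indicator A w * measure (Pr S t (coord S t w)) B) \<le> 1"
        using prob_space.prob_le_1[OF Pr_prob[OF assms(2)]] by (auto simp: indicator_def)
    qed (use sets cm in simp)
  qed auto
  finally show ?thesis using * by (simp add: emeasure_eq_measure)
qed

definition survival :: "real \<Rightarrow> real \<Rightarrow> 'e \<Rightarrow> real" where
  "survival s t x = measure (Pr S s x) (surviving S s t)"

lemma survival_measurable:
  "s \<in> Time S \<Longrightarrow> t \<in> Time S \<Longrightarrow> survival s t \<in> borel_measurable (State S)"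
  unfolding survival_def[abs_def] by (intro Pr_measurable surviving_sets)

lemma survival_coord_measurable:
  "t \<in> Time S \<Longrightarrow> T \<in> Time S \<Longrightarrow> (\<lambda>w. survival t T (coord S t w)) \<in> borel_measurable (Sample S)"
  using measurable_compose[OF coord_meas survival_measurable] by blast

text \<open>Survival after \<open>t\<close> is an event of the future; conditioning on the past
  replaces it by the weight \<open>survival t T\<close> at the state at time \<open>t\<close>. The
  observable \<open>\<Psi>\<close> of the past is left open, since both the state at time
  \<open>t\<close> and the whole trajectory are needed.\<close>

lemma markov_survival:
  assumes st: "s \<in> Time S" "t \<in> Time S" "T \<in> Time S" "s \<le> t" "t \<le> T"
    and \<Psi>: "\<Psi> \<in> generated S {s..t} \<rightarrow>\<^sub>M R"
  shows "distr (density (Pr S s x) (indicator (surviving S s T))) R \<Psi> =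
    distr (density (density (Pr S s x) (indicator (surviving S s t)))
      (\<lambda>w. ennreal (survival t T (coord S t w)))) R \<Psi>"
proof (rule measure_eqI)
  fix A assume "A \<in> sets (distr (density (Pr S s x) (indicator (surviving S s T))) R \<Psi>)"
  then have A: "A \<in> sets R" by simp
  note Ps = Pr_sets[OF st(1)] and sv = surviving_sets
  have "\<Psi> \<in> Sample S \<rightarrow>\<^sub>M R"
  proof (rule measurableI)
    show "\<Psi> w \<in> space R" if "w \<in> \<Omega>" for w using measurable_space[OF \<Psi>] that by simp
    show "\<Psi> -` C \<inter> \<Omega> \<in> sets (Sample S)" if "C \<in> sets R" for C
      using measurable_sets[OF \<Psi> that] generated_Sample by auto
  qed
  then have \<Psi>P: "\<Psi> \<in> Pr S s x \<rightarrow>\<^sub>M R" by (rule measurable_Pr[OF st(1)])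
  define D where "D = \<Psi> -` A \<inter> \<Omega>"
  have D: "D \<in> sets (generated S {s..t})" using measurable_sets[OF \<Psi> A] by (simp add: D_def)
  have D': "D \<in> sets (Pr S s x)" using D generated_Sample Ps by auto
  have m: "(\<lambda>w. ennreal (survival t T (coord S t w))) \<in> borel_measurable (Pr S s x)"
    by (intro measurable_compose[OF _ measurable_ennreal] measurable_Pr survival_coord_measurable st)
  have i: "(indicator (surviving S s t') :: _ \<Rightarrow> ennreal) \<in> borel_measurable (Pr S s x)" if "t' \<in> Time S" for t'
    using sv[OF st(1) that] unfolding Ps[symmetric, of x] by simp
  have "emeasure (distr (density (Pr S s x) (indicator (surviving S s T))) R \<Psi>) A =
      emeasure (density (Pr S s x) (indicator (surviving S s T))) D"
    using \<Psi>P A by (subst emeasure_distr) (auto simp: D_def Pr_space st)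
  also have "\<dots> = (\<integral>\<^sup>+w. indicator (surviving S s T) w * indicator D w \<partial>Pr S s x)"
    using D' i[OF st(3)] by (simp add: emeasure_density)
  also have "\<dots> = (\<integral>\<^sup>+w. indicator (surviving S s T \<inter> D) w \<partial>Pr S s x)"
    by (simp add: indicator_inter_arith)
  also have "\<dots> = emeasure (Pr S s x) ((D \<inter> surviving S s t) \<inter> surviving S t T)"
  proof -
    have "surviving S s T \<inter> D = D \<inter> surviving S s t \<inter> surviving S t T"
      using surviving_split[OF st(4,5)] by auto
    moreover have "surviving S s T \<inter> D \<in> sets (Pr S s x)"
      using sv[OF st(1,3)] D' Ps by (intro sets.Int) simp_all
    ultimately show ?thesis by simp
  qed
  also have "\<dots> = (\<integral>\<^sup>+w. indicator (D \<inter> surviving S s t) w * ennreal (survival t T (coord S t w)) \<partial>Pr S s x)"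
    unfolding survival_def
    using D surviving_generated[OF st(1,2)] surviving_generated[OF st(2,3)] generated_mono[of "{t..T}" "{t..}"]
    by (intro markov_sets st) auto
  also have "\<dots> = (\<integral>\<^sup>+w. indicator (surviving S s t) w * (ennreal (survival t T (coord S t w)) * indicator D w) \<partial>Pr S s x)"
    by (intro nn_integral_cong) (auto simp: indicator_def)
  also have "\<dots> = (\<integral>\<^sup>+w. ennreal (survival t T (coord S t w)) * indicator D w \<partial>density (Pr S s x) (indicator (surviving S s t)))"
    using i[OF st(2)] m D' by (subst nn_integral_density) auto
  also have "\<dots> = emeasure (density (density (Pr S s x) (indicator (surviving S s t)))
      (\<lambda>w. ennreal (survival t T (coord S t w)))) D"
    using m D' by (subst emeasure_density) auto
  also have "\<dots> = emeasure (distr (density (density (Pr S s x) (indicator (surviving S s t)))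
      (\<lambda>w. ennreal (survival t T (coord S t w)))) R \<Psi>) A"
    using \<Psi>P A by (subst emeasure_distr) (auto simp: D_def Pr_space st)
  finally show "emeasure (distr (density (Pr S s x) (indicator (surviving S s T))) R \<Psi>) A =
    emeasure (distr (density (density (Pr S s x) (indicator (surviving S s t)))
      (\<lambda>w. ennreal (survival t T (coord S t w)))) R \<Psi>) A" .
qed simp

text \<open>Two times, since conditioning on survival looks beyond the time \<open>t\<close> of
  observation. For \<open>T = t\<close> this is the killed semigroup.\<close>

definition joint :: "real \<Rightarrow> real \<Rightarrow> real \<Rightarrow> 'e \<Rightarrow> 'e measure" where
  "joint s t T x = distr (density (Pr S s x) (indicator (surviving S s T))) (State S) (coord S t)"

abbreviation "killed s t \<equiv> joint s t t"

lemma sets_joint [simp]: "sets (joint s t T x) = sets (State S)"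
  unfolding joint_def by simp

context
  fixes s t T assumes sT: "s \<in> Time S" "t \<in> Time S" "T \<in> Time S"
begin

lemma coord_Pr: "coord S t \<in> Pr S s x \<rightarrow>\<^sub>M State S"
  by (intro measurable_Pr coord_meas sT)

lemma surviving_Pr: "surviving S s T \<in> sets (Pr S s x)"
  using surviving_sets[OF sT(1,3)] Pr_sets[OF sT(1)] by simp

lemma emeasure_joint:
  assumes "B \<in> sets (State S)"
  shows "emeasure (joint s t T x) B = emeasure (Pr S s x) (surviving S s T \<inter> (coord S t -` B \<inter> \<Omega>))"
proof -
  have C: "coord S t -` B \<inter> \<Omega> \<in> sets (Pr S s x)"
    using measurable_sets[OF coord_Pr assms] Pr_space[OF sT(1)] by simp
  have "emeasure (joint s t T x) B = emeasure (density (Pr S s x) (indicator (surviving S s T))) (coord S t -` B \<inter> \<Omega>)"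
    unfolding joint_def using assms coord_Pr by (subst emeasure_distr) (auto simp: Pr_space sT)
  also have "\<dots> = emeasure (Pr S s x) (surviving S s T \<inter> (coord S t -` B \<inter> \<Omega>))"
    using C surviving_Pr by (simp add: emeasure_density indicator_inter_arith[symmetric] sets.Int)
  finally show ?thesis .
qed

lemma integral_joint:
  fixes f :: "'e \<Rightarrow> real"
  assumes "f \<in> borel_measurable (State S)"
  shows "(\<integral>y. f y \<partial>joint s t T x) = (\<integral>w. indicator (surviving S s T) w * f (coord S t w) \<partial>Pr S s x)"
proof -
  have "(\<integral>y. f y \<partial>joint s t T x) = (\<integral>w. f (coord S t w) \<partial>density (Pr S s x) (indicator (surviving S s T)))"
    unfolding joint_def using coord_Pr assms by (intro integral_distr) auto
  also have "density (Pr S s x) (indicator (surviving S s T)) =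
      density (Pr S s x) (\<lambda>w. ennreal (indicator (surviving S s T) w))"
    by (intro arg_cong2[where f = density]) (auto simp: indicator_def)
  also have "(\<integral>w. f (coord S t w) \<partial>\<dots>) = (\<integral>w. indicator (surviving S s T) w *\<^sub>R f (coord S t w) \<partial>Pr S s x)"
    using surviving_Pr coord_Pr assms by (intro integral_density) auto
  finally show ?thesis by simp
qed

lemma measure_joint_UNIV: "measure (joint s t T x) UNIV = survival s T x"
proof -
  have "coord S t -` UNIV \<inter> \<Omega> = \<Omega>" by auto
  moreover have "UNIV \<in> sets (State S)" using sets.top[of "State S"] state_space by simp
  ultimately show ?thesis
    using emeasure_joint[of UNIV x] surviving_space[of s T]
    by (simp add: survival_def measure_def Int_absorb2)
qed

lemma joint_subprob: "subprob_space (joint s t T x)"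
proof (rule subprob_spaceI)
  interpret prob_space "Pr S s x" using sT by (intro Pr_prob)
  have "UNIV \<in> sets (State S)" using sets.top[of "State S"] state_space by simp
  then show "emeasure (joint s t T x) (space (joint s t T x)) \<le> 1"
    using emeasure_joint[of UNIV x] state_space measure_le_1 by (simp add: joint_def)
  show "space (joint s t T x) \<noteq> {}" by (simp add: joint_def state_space)
qed

lemma joint_kernel: "joint s t T \<in> State S \<rightarrow>\<^sub>M subprob_algebra (State S)"
proof (rule measurable_subprob_algebra)
  fix B assume B: "B \<in> sets (State S)"
  have "surviving S s T \<inter> (coord S t -` B \<inter> \<Omega>) \<in> sets (Sample S)"
    using surviving_sets[OF sT(1,3)] measurable_sets[OF coord_meas[OF sT(2)] B] by auto
  then show "(\<lambda>x. emeasure (joint s t T x) B) \<in> borel_measurable (State S)"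
    unfolding emeasure_joint[OF B] by (intro Pr_measurable sT)
qed (auto intro: joint_subprob)

lemma joint_eq_density:
  assumes "s \<le> t" "t \<le> T"
  shows "joint s t T x = density (killed s t x) (\<lambda>y. ennreal (survival t T y))"
proof -
  have "joint s t T x = distr (density (density (Pr S s x) (indicator (surviving S s t)))
      (\<lambda>w. ennreal (survival t T (coord S t w)))) (State S) (coord S t)"
    unfolding joint_def using assms by (intro markov_survival sT coord_generated) auto
  also have "\<dots> = density (killed s t x) (\<lambda>y. ennreal (survival t T y))"
    unfolding joint_def using coord_Pr survival_measurable[OF sT(2,3)]
    by (subst density_distr) auto
  finally show ?thesis .
qed

end

lemma integral_joint_killed:
  fixes f :: "'e \<Rightarrow> real"
  assumes st: "s \<in> Time S" "t \<in> Time S" "T \<in> Time S" "s \<le> t" "t \<le> T"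
    and f: "f \<in> borel_measurable (State S)"
  shows "(\<integral>y. f y \<partial>joint s t T x) = (\<integral>y. f y * survival t T y \<partial>killed s t x)"
proof -
  have "(\<integral>y. f y \<partial>joint s t T x) = (\<integral>y. survival t T y *\<^sub>R f y \<partial>killed s t x)"
    unfolding joint_eq_density[OF st]
  proof (rule integral_density)
    show "f \<in> borel_measurable (killed s t x)" "survival t T \<in> borel_measurable (killed s t x)"
      using f survival_measurable[OF st(2,3)] unfolding measurable_cong_sets[OF sets_joint refl] by auto
  qed (simp add: survival_def)
  then show ?thesis by (simp add: mult.commute)
qed

text \<open>Survival up to \<open>u\<close> splits at \<open>t\<close>; its second half together
  with the state at \<open>u\<close> is an event of the future of \<open>t\<close>, to which the
  Markov property applies.\<close>

lemma killed_Chapman: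
  assumes "s \<in> Time S" "t \<in> Time S" "u \<in> Time S" "s \<le> t" "t \<le> u"
  shows "killed s u x = killed s t x \<bind> killed t u"
proof (rule measure_eqI)
  note k = joint_kernel[OF assms(2,3,3)]
  have k': "killed t u \<in> killed s t x \<rightarrow>\<^sub>M subprob_algebra (State S)"
    using k unfolding measurable_cong_sets[OF sets_joint refl] .
  have ne: "space (killed s t x) \<noteq> {}" by (simp add: joint_def state_space)
  show "sets (killed s u x) = sets (killed s t x \<bind> killed t u)"
    using ne by (subst sets_bind[where N = "State S"]) auto
  fix B assume "B \<in> sets (killed s u x)"
  then have B: "B \<in> sets (State S)" by simp
  note Ps = Pr_sets[OF assms(1)]
  define C where "C = coord S u -` B \<inter> \<Omega>"
  have C: "C \<in> sets (generated S {t..})"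
    using measurable_sets[OF coord_generated[of u "{t..}"] B] assms by (simp add: C_def)
  have tu: "surviving S t u \<in> sets (generated S {t..})"
    using surviving_generated[OF assms(2,3)] generated_mono[of "{t..u}" "{t..}"] by auto
  have "emeasure (killed s u x) B = emeasure (Pr S s x) (surviving S s t \<inter> (surviving S t u \<inter> C))"
    using emeasure_joint[OF assms(1,3,3) B] surviving_split[OF assms(4,5)] by (simp add: C_def Int_assoc)
  also have "\<dots> = (\<integral>\<^sup>+w. indicator (surviving S s t) w * ennreal (measure (Pr S t (coord S t w)) (surviving S t u \<inter> C)) \<partial>Pr S s x)"
    using C tu by (intro markov_sets assms surviving_generated) auto
  also have "\<dots> = (\<integral>\<^sup>+w. indicator (surviving S s t) w * emeasure (killed t u (coord S t w)) B \<partial>Pr S s x)"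
    using Pr_prob[OF assms(2)] emeasure_joint[OF assms(2,3,3) B]
    by (simp add: C_def finite_measure.emeasure_eq_measure prob_space_def)
  also have "\<dots> = (\<integral>\<^sup>+w. emeasure (killed t u (coord S t w)) B \<partial>density (Pr S s x) (indicator (surviving S s t)))"
  proof (rule nn_integral_density[symmetric])
    show "indicator (surviving S s t) \<in> borel_measurable (Pr S s x)"
      using surviving_sets[OF assms(1,2)] Ps by (intro borel_measurable_indicator) simp
    show "(\<lambda>w. emeasure (killed t u (coord S t w)) B) \<in> borel_measurable (Pr S s x)"
      by (rule measurable_compose[OF coord_Pr[OF assms(1,2,2)]
            measurable_compose[OF k measurable_emeasure_subprob_algebra[OF B]]])
  qed
  also have "\<dots> = (\<integral>\<^sup>+y. emeasure (killed t u y) B \<partial>killed s t x)"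
    unfolding joint_def[of s t t]
    using coord_Pr[OF assms(1,2,2)] measurable_compose[OF k measurable_emeasure_subprob_algebra[OF B]]
    by (intro nn_integral_distr[symmetric]) simp_all
  also have "\<dots> = emeasure (killed s t x \<bind> killed t u) B"
    using ne k' B by (rule emeasure_bind[symmetric])
  finally show "emeasure (killed s u x) B = emeasure (killed s t x \<bind> killed t u) B" .
qed

text \<open>The event of surviving at the starting time is determined by \<open>X\<^sub>s\<close>, hence trivial.\<close>

lemma survival_start:
  assumes s: "s \<in> Time S" and x: "x \<in> alive S s"
  shows "AE w in Pr S s x. w \<in> surviving S s s"
proof -
  interpret prob_space "Pr S s x" using s by (rule Pr_prob)
  \<comment> \<open>An event determined by \<open>coord S s\<close> alone contains all sample points
    with value \<open>x\<close> or none of them. For survival the second case contradicts its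
    positive probability.\<close>
  have *: "(\<forall>w\<in>\<Omega>. coord S s w = x \<longrightarrow> w \<in> D) \<or> (\<forall>w\<in>\<Omega>. coord S s w = x \<longrightarrow> w \<notin> D)"
    if "D \<in> sigma_sets \<Omega> {coord S u -` B \<inter> \<Omega> | u B. u \<in> Time S \<inter> {s..s} \<and> B \<in> sets (State S)}" for D
    using that
  proof induction
    case (Union A)
    then show ?case by blast
  qed auto
  have "(\<forall>w\<in>\<Omega>. coord S s w = x \<longrightarrow> w \<in> surviving S s s) \<or>
    (\<forall>w\<in>\<Omega>. coord S s w = x \<longrightarrow> w \<notin> surviving S s s)"
    using surviving_generated[OF s s] unfolding sets_generated by (rule *)
  moreover have "\<not> (\<forall>w\<in>\<Omega>. coord S s w = x \<longrightarrow> w \<notin> surviving S s s)"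
  proof
    assume dead: "\<forall>w\<in>\<Omega>. coord S s w = x \<longrightarrow> w \<notin> surviving S s s"
    have "AE w in Pr S s x. w \<notin> surviving S s s"
      using Pr_start[OF s, of x] AE_space[of "Pr S s x"] by eventually_elim (use dead Pr_space[OF s] in auto)
    then have "measure (Pr S s x) (surviving S s s) = 0"
      using surviving_Pr[OF s s s] prob_eq_0 by blast
    then show False using survival_pos[OF s s order.refl x] by simp
  qed
  ultimately have alive: "\<forall>w\<in>\<Omega>. coord S s w = x \<longrightarrow> w \<in> surviving S s s" by blast
  show ?thesis
    using Pr_start[OF s, of x] AE_space[of "Pr S s x"] by eventually_elim (use alive Pr_space[OF s] in auto)
qed

lemma killed_refl:
  assumes s: "s \<in> Time S" and x: "x \<in> alive S s"
  shows "killed s s x = return (State S) x"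
proof (rule measure_eqI)
  interpret prob_space "Pr S s x" using s by (rule Pr_prob)
  fix B assume "B \<in> sets (killed s s x)"
  then have B: "B \<in> sets (State S)" by simp
  have "emeasure (killed s s x) B = emeasure (Pr S s x) (surviving S s s \<inter> (coord S s -` B \<inter> \<Omega>))"
    by (rule emeasure_joint[OF s s s B])
  also have "\<dots> = emeasure (Pr S s x) (if x \<in> B then \<Omega> else {})"
  proof (rule emeasure_eq_AE)
    show "AE w in Pr S s x. (w \<in> surviving S s s \<inter> (coord S s -` B \<inter> \<Omega>)) = (w \<in> (if x \<in> B then \<Omega> else {}))"
      using survival_start[OF assms] Pr_start[OF s, of x] AE_space[of "Pr S s x"]
      by eventually_elim (auto simp: Pr_space[OF s])
    show "surviving S s s \<inter> (coord S s -` B \<inter> \<Omega>) \<in> events"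
      using measurable_sets[OF coord_Pr[OF s s s] B, of x] unfolding Pr_space[OF s]
      by (rule sets.Int[OF surviving_Pr[OF s s s]])
    show "(if x \<in> B then \<Omega> else {}) \<in> events" using sets.top[of "Pr S s x"] Pr_space[OF s] by simp
  qed
  also have "\<dots> = emeasure (return (State S) x) B"
    using B emeasure_space_1 Pr_space[OF s] by simp
  finally show "emeasure (killed s s x) B = emeasure (return (State S) x) B" .
qed simp

lemma survival_dead:
  assumes "s \<in> Time S" "t \<in> Time S" "s \<le> t" "x \<notin> alive S s"
  shows "survival s t x = 0"
proof -
  interpret prob_space "Pr S s x" using assms by (intro Pr_prob)
  have "AE w in Pr S s x. w \<notin> surviving S s t"
    using Pr_start[OF assms(1), of x]
  proof eventually_elim
    case (elim w)
    show ?case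
      using surviving_alive[OF assms(1) order.refl, of w] surviving_split[of s s t] elim assms by auto
  qed
  then show ?thesis unfolding survival_def using prob_eq_0[OF surviving_Pr[OF assms(1,1,2)]] by blast
qed

lemma surviving_shift:
  assumes p: "p \<in> Time S" and per: "\<And>t. t \<in> Time S \<Longrightarrow> absorbing S (p + t) = absorbing S t"
  shows "surviving S p (p + T) = shift S p -` surviving S 0 T \<inter> \<Omega>"
proof (intro set_eqI iffI)
  have diff: "t - p \<in> Time S" if "t \<in> Time S" "p \<le> t" for t
    using time that p by (elim disjE) simp_all
  fix w
  {
    assume "w \<in> surviving S p (p + T)"
    then obtain r where r: "w \<in> \<Omega>" "p + T < r" "\<And>t. t\<in>Time S \<Longrightarrow> p \<le> t \<Longrightarrow> t < r \<Longrightarrow> coord S t w \<notin> absorbing S t"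
      unfolding surviving_def survives_iff by auto
    have "coord S t (shift S p w) \<notin> absorbing S t" if "t \<in> Time S" "t < r - p" for t
      using r(3)[of "p + t"] that p r(1) Time_nonneg[OF that(1)] by (simp add: coord_shift Time_add per)
    then show "w \<in> shift S p -` surviving S 0 T \<inter> \<Omega>"
      using r p shift_space unfolding surviving_def survives_iff by (auto intro!: exI[of _ "r - p"])
  next
    assume "w \<in> shift S p -` surviving S 0 T \<inter> \<Omega>"
    then obtain r where r: "w \<in> \<Omega>" "T < r" "\<And>t. t\<in>Time S \<Longrightarrow> t < r \<Longrightarrow> coord S t (shift S p w) \<notin> absorbing S t"
      unfolding surviving_def survives_iff using Time_nonneg by auto
    have "coord S t w \<notin> absorbing S t" if "t \<in> Time S" "p \<le> t" "t < p + r" for t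
      using r(3)[OF diff[OF that(1,2)]] that p r(1) diff[OF that(1,2)] per[OF diff[OF that(1,2)]]
      by (simp add: coord_shift)
    then show "w \<in> surviving S p (p + T)"
      using r unfolding surviving_def survives_iff by (auto intro!: exI[of _ "p + r"])
  }
qed

text \<open>The shift aligns the coordinates and periodicity the absorbing sets, so the event on the
  left is the preimage under \<open>shift S p\<close> of an event generated by the coordinates, to
  which homogeneity applies.\<close>

lemma joint_shift:
  assumes p: "p \<in> Time S" and per: "\<And>t. t \<in> Time S \<Longrightarrow> absorbing S (p + t) = absorbing S t"
    and st: "s \<in> Time S" "T \<in> Time S"
  shows "joint p (p + s) (p + T) x = joint 0 s T x"
proof (rule measure_eqI)
  fix B assume "B \<in> sets (joint p (p + s) (p + T) x)"
  then have B: "B \<in> sets (State S)" by simp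
  let ?D = "surviving S 0 T \<inter> (coord S s -` B \<inter> \<Omega>)"
  have "surviving S p (p + T) \<inter> (coord S (p + s) -` B \<inter> \<Omega>) = shift S p -` ?D \<inter> \<Omega>"
    using surviving_shift[OF p per, of T] p st shift_space coord_shift by auto
  moreover have "?D \<in> sets (generated S UNIV)"
    using surviving_generated[OF Time_zero st(2)] generated_mono[of "{0..T}" UNIV]
      measurable_sets[OF coord_generated[OF st(1), of UNIV] B] by auto
  ultimately have "measure (Pr S p x) (surviving S p (p + T) \<inter> (coord S (p + s) -` B \<inter> \<Omega>)) = measure (Pr S 0 x) ?D"
    by (simp only: homogeneous[OF p])
  then show "emeasure (joint p (p + s) (p + T) x) B = emeasure (joint 0 s T x) B"
    using Pr_prob[OF p] Pr_prob[OF Time_zero] emeasure_joint[OF p Time_add[OF p st(1)] Time_add[OF p st(2)] B]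
      emeasure_joint[OF Time_zero st B] by (simp add: finite_measure.emeasure_eq_measure prob_space_def)
qed simp

end

section \<open>The killed semigroup of a periodic absorbed process\<close>

locale periodic_absorbed_process = absorbed_markov_process S
  for S :: "('w, 'e::metric_space) process" +
  fixes \<nu> :: "real \<Rightarrow> 'e measure" and \<gamma> t\<^sub>0 c\<^sub>1 c\<^sub>2 :: real
  assumes gamma: "\<gamma> \<in> Time S" "0 < \<gamma>"
    and periodic: "\<And>t. t \<in> Time S \<Longrightarrow> absorbing S (t + \<gamma>) = absorbing S t"
    and nu: "\<And>s. s \<in> Time S \<Longrightarrow> \<nu> s \<in> probs_on S (alive S s)"
    and pos: "t\<^sub>0 \<in> Time S" "0 < t\<^sub>0" "0 < c\<^sub>1" "0 < c\<^sub>2"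
    and A1_law: "\<And>s x B. s \<in> Time S \<Longrightarrow> x \<in> alive S s \<Longrightarrow> B \<in> sets (State S) \<Longrightarrow>
      c\<^sub>1 * measure (\<nu> (s + t\<^sub>0)) B
        \<le> measure (cond_law S (Pr S s x) s (s + t\<^sub>0) (s + t\<^sub>0)) B"
    and A2_law: "\<And>s t x. s \<in> Time S \<Longrightarrow> t \<in> Time S \<Longrightarrow> s \<le> t \<Longrightarrow> x \<in> alive S s \<Longrightarrow>
      c\<^sub>2 * measure (Pr S s x) (surviving S s t)
        \<le> measure (Pr_mix S s (\<nu> s)) (surviving S s t)"
begin

lemma probs_onD:
  assumes "\<mu> \<in> probs_on S F"
  shows "prob_space \<mu>" "sets \<mu> = sets (State S)" "space \<mu> = UNIV" "emeasure \<mu> F = 1"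
  using assms sets_eq_imp_space_eq[of \<mu> "State S"] state_space
  unfolding probs_on_def by (auto simp: space_prob_algebra)

lemma Pr_mix_sets:
  "s \<in> Time S \<Longrightarrow> \<mu> \<in> probs_on S F \<Longrightarrow> Pr S s \<in> \<mu> \<rightarrow>\<^sub>M subprob_algebra (Sample S)"
  using measurable_prob_algebraD[OF Pr_kernel, of s] by (simp add: measurable_cong_sets[OF probs_onD(2) refl])

lemma measure_Pr_mix:
  assumes s: "s \<in> Time S" and \<mu>: "\<mu> \<in> probs_on S F" and B: "B \<in> sets (Sample S)"
  shows "measure (Pr_mix S s \<mu>) B = (\<integral>x. measure (Pr S s x) B \<partial>\<mu>)"
    "integrable \<mu> (\<lambda>x. measure (Pr S s x) B)"
proof -
  interpret prob_space \<mu> using probs_onD[OF \<mu>] by simp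
  show int: "integrable \<mu> (\<lambda>x. measure (Pr S s x) B)"
    using Pr_measurable(2)[OF s B] probs_onD(2)[OF \<mu>] Pr_prob[OF s]
    by (intro integrable_const_bound[where B=1]) (auto simp: prob_space.prob_le_1 cong: measurable_cong_sets)
  have "emeasure (Pr_mix S s \<mu>) B = (\<integral>\<^sup>+x. ennreal (measure (Pr S s x) B) \<partial>\<mu>)"
    unfolding Pr_mix_def using probs_onD(3)[OF \<mu>] Pr_mix_sets[OF s \<mu>] B Pr_prob[OF s]
    by (subst emeasure_bind) (auto simp: finite_measure.emeasure_eq_measure prob_space_def)
  also have "\<dots> = ennreal (\<integral>x. measure (Pr S s x) B \<partial>\<mu>)"
    using int by (intro nn_integral_eq_integral) auto
  finally show "measure (Pr_mix S s \<mu>) B = (\<integral>x. measure (Pr S s x) B \<partial>\<mu>)"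
    by (simp add: measure_def Bochner_Integration.integral_nonneg)
qed

lemma period_mult_Time: "real n * \<gamma> \<in> Time S"
  using time gamma by (elim disjE) simp_all

lemma absorbing_period: "t \<in> Time S \<Longrightarrow> absorbing S (real n * \<gamma> + t) = absorbing S t"
proof (induction n)
  case (Suc n)
  then show ?case
    using periodic[of "real n * \<gamma> + t"] Time_add[OF period_mult_Time[of n], of t]
    by (simp add: algebra_simps)
qed simp

text \<open>Gives the process all results of the abstract part. (A'1) becomes a statement on the
  killed kernel once multiplied by the survival probability, (A'2) once the mixture over
  \<open>\<nu> s\<close> is written as an integral, and the periodicity of \<open>P\<close> comes
  from \<open>joint_shift\<close>.\<close>

sublocale periodic_semigroup "State S" "Time S" "alive S" "\<lambda>s t. joint s t t" \<nu> t\<^sub>0 c\<^sub>1 c\<^sub>2 \<gamma>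
proof -
  interpret CS: conditioned_semigroup "State S" "Time S" "alive S" "\<lambda>s t. joint s t t" \<nu> t\<^sub>0 c\<^sub>1 c\<^sub>2
  proof (rule conditioned_semigroup.intro)
    show "alive S s \<noteq> {}" if "s \<in> Time S" for s
      using probs_onD(4)[OF nu[OF that]] by auto
    fix s t u x assume st: "s \<in> Time S" "t \<in> Time S" "s \<le> t"
    show "joint s t t \<in> State S \<rightarrow>\<^sub>M subprob_algebra (State S)"
      using st by (intro joint_kernel)
    show "measure (joint s t t x) UNIV = 0" if "x \<notin> alive S s"
      using measure_joint_UNIV[OF st(1,2,2)] survival_dead[OF st that] by simp
    show "0 < measure (joint s t t x) UNIV" if "x \<in> alive S s"
      using measure_joint_UNIV[OF st(1,2,2)] survival_pos[OF st that] by (simp add: survival_def)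
    show "c\<^sub>2 * measure (joint s t t x) UNIV \<le> (\<integral>y. measure (joint s t t y) UNIV \<partial>\<nu> s)" if "x \<in> alive S s"
      using A2_law[OF st that] measure_Pr_mix(1)[OF st(1) nu[OF st(1)] surviving_sets[OF st(1,2)]]
      unfolding measure_joint_UNIV[OF st(1,2,2)] survival_def by simp
  next
    fix s t u x assume "s \<in> Time S" "t \<in> Time S" "u \<in> Time S" "s \<le> t" "t \<le> u"
    then show "joint s u u x = joint s t t x \<bind> joint t u u" by (rule killed_Chapman)
  next
    fix s x assume "s \<in> Time S" "x \<in> alive S s"
    then show "joint s s s x = return (State S) x" by (rule killed_refl)
  next
    show "prob_space (\<nu> s)" if "s \<in> Time S" for s using probs_onD(1)[OF nu[OF that]] .
    show "sets (\<nu> s) = sets (State S)" if "s \<in> Time S" for s using probs_onD(2)[OF nu[OF that]] .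
  next
    fix s x B assume s: "s \<in> Time S" and x: "x \<in> alive S s" and B: "B \<in> sets (State S)"
    define t where "t = s + t\<^sub>0"
    have t: "t \<in> Time S" "s \<le> t" using s pos Time_add by (auto simp: t_def)
    interpret prob_space "Pr S s x" using s by (rule Pr_prob)
    note sv = surviving_Pr[OF s s t(1)]
    have p: "0 < measure (Pr S s x) (surviving S s t)" by (rule survival_pos[OF s t x])
    have "measure (cond_law S (Pr S s x) s t t) B
        = measure (uniform_measure (Pr S s x) (surviving S s t)) (coord S t -` B \<inter> \<Omega>)"
      unfolding cond_law_def using coord_Pr[OF s t(1,1)] B
      by (subst measure_distr) (auto simp: Pr_space[OF s])
    also have "\<dots> = measure (Pr S s x) (surviving S s t \<inter> (coord S t -` B \<inter> \<Omega>)) / survival s t x"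
      using p measurable_sets[OF coord_Pr[OF s t(1,1)] B]
      by (simp add: survival_def emeasure_eq_measure Pr_space[OF s])
    also have "measure (Pr S s x) (surviving S s t \<inter> (coord S t -` B \<inter> \<Omega>)) = measure (joint s t t x) B"
      using emeasure_joint[OF s t(1,1) B] by (simp add: measure_def)
    finally have "measure (cond_law S (Pr S s x) s t t) B = measure (joint s t t x) B / survival s t x" .
    then have "c\<^sub>1 * measure (\<nu> t) B \<le> measure (joint s t t x) B / survival s t x"
      using A1_law[OF s x B] by (simp add: t_def)
    then show "c\<^sub>1 * measure (joint s (s + t\<^sub>0) (s + t\<^sub>0) x) UNIV * measure (\<nu> (s + t\<^sub>0)) B
       \<le> measure (joint s (s + t\<^sub>0) (s + t\<^sub>0) x) B"
      using p measure_joint_UNIV[OF s t(1,1)] by (simp add: t_def[symmetric] survival_def field_simps)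
  qed (use time state_space pos in simp_all)
  show "periodic_semigroup (State S) (Time S) (alive S) (\<lambda>s t. joint s t t) \<nu> t\<^sub>0 c\<^sub>1 c\<^sub>2 \<gamma>"
  proof
    show "\<gamma> \<in> Time S" "0 < \<gamma>" using gamma by auto
    show "alive S (real n * \<gamma>) = alive S 0" for n
      using absorbing_period[OF Time_zero, of n] by (simp add: alive_def)
    fix s T f n x
    assume s: "s \<in> Time S" and T: "T \<in> Time S" "s \<le> T" and f: "bounded_measurable (State S) f"
    \<comment> \<open>Integrating \<open>f\<close> times the survival probability from
      \<open>t\<close> to \<open>u\<close> against the killed kernel is integrating \<open>f\<close>
      against \<open>joint\<close>, whose shifts are known.\<close>
    have J: "CS.P r t (\<lambda>y. f y * CS.Z t u y) x = (\<integral>y. f y \<partial>joint r t u x)"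
      if r: "r \<in> Time S" "t \<in> Time S" "u \<in> Time S" "r \<le> t" "t \<le> u" for r t u
      using integral_joint_killed[OF r, of f x] f measure_joint_UNIV[OF r(2,3,3)]
      by (auto simp: CS.P_def CS.Z_def)
    define p where "p = real n * \<gamma>"
    have p: "p \<in> Time S" "0 \<le> p" using period_mult_Time Time_nonneg by (auto simp: p_def)
    have per: "\<And>t. t \<in> Time S \<Longrightarrow> absorbing S (p + t) = absorbing S t"
      using absorbing_period by (simp add: p_def)
    have s0: "0 \<le> s" using Time_nonneg s .
    have "CS.P p (p + s) (\<lambda>y. f y * CS.Z (p + s) (p + T) y) x = (\<integral>y. f y \<partial>joint p (p + s) (p + T) x)"
      using p s T s0 by (intro J Time_add) auto
    also have "\<dots> = (\<integral>y. f y \<partial>joint 0 s T x)" using joint_shift[OF p(1) per s T(1)] by simp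
    also have "\<dots> = CS.P 0 s (\<lambda>y. f y * CS.Z s T y) x"
      using s T s0 by (intro J[symmetric] Time_zero)
    finally show "CS.P (real n * \<gamma>) (real n * \<gamma> + s) (\<lambda>y. f y * CS.Z (real n * \<gamma> + s) (real n * \<gamma> + T) y) x
       = CS.P 0 s (\<lambda>y. f y * CS.Z s T y) x" by (simp add: p_def)
  qed
qed

end

section \<open>The Q-process\<close>

lemma integral_uniform_measure:
  fixes g :: "'a \<Rightarrow> real"
  assumes "finite_measure N" "A \<in> sets N" "g \<in> borel_measurable N" "0 < measure N A"
  shows "(\<integral>w. g w \<partial>uniform_measure N A) = (\<integral>w. indicator A w * g w \<partial>N) / measure N A"
proof -
  interpret finite_measure N by fact
  have "uniform_measure N A = density N (\<lambda>w. ennreal (indicator A w / measure N A))"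
    unfolding uniform_measure_def using assms(4)
    by (intro arg_cong2[where f = density] refl ext)
       (auto simp: emeasure_eq_measure indicator_def divide_ennreal[symmetric] ennreal_1[symmetric]
         simp del: ennreal_1)
  then have "(\<integral>w. g w \<partial>uniform_measure N A) = (\<integral>w. (indicator A w / measure N A) *\<^sub>R g w \<partial>N)"
    using assms by (simp add: integral_density)
  then show ?thesis by simp
qed

context absorbed_markov_process
begin

abbreviation alive_part :: "real \<Rightarrow> real \<Rightarrow> 'e \<Rightarrow> 'w measure" where
  "alive_part s t x \<equiv> density (Pr S s x) (indicator (surviving S s t))"

lemma alive_part_finite:
  assumes "s \<in> Time S" "t \<in> Time S"
  shows "finite_measure (alive_part s t x)"
proof (rule finite_measureI)
  interpret prob_space "Pr S s x" using assms by (intro Pr_prob)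
  have "emeasure (alive_part s t x) (space (Pr S s x)) = emeasure (Pr S s x) (surviving S s t)"
    using surviving_Pr[OF assms(1,1,2)] sets.sets_into_space[OF surviving_Pr[OF assms(1,1,2)]]
    by (subst emeasure_density)
       (auto simp: indicator_inter_arith[symmetric] Int_absorb2 intro!: borel_measurable_indicator)
  then show "emeasure (alive_part s t x) (space (alive_part s t x)) \<noteq> \<infinity>"
    by (simp add: emeasure_eq_measure)
qed

lemma measurable_alive_part:
  assumes "s \<in> Time S" "f \<in> Sample S \<rightarrow>\<^sub>M R"
  shows "f \<in> alive_part s t x \<rightarrow>\<^sub>M R"
  using measurable_Pr[OF assms, of x] by simp

lemma integral_alive_part:
  fixes g :: "'w \<Rightarrow> real"
  assumes "s \<in> Time S" "t \<in> Time S" "g \<in> borel_measurable (Pr S s x)"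
  shows "(\<integral>w. g w \<partial>alive_part s t x) = (\<integral>w. indicator (surviving S s t) w * g w \<partial>Pr S s x)"
proof -
  have "alive_part s t x = density (Pr S s x) (\<lambda>w. ennreal (indicator (surviving S s t) w))"
    by (intro arg_cong2[where f = density]) (auto simp: indicator_def)
  then show ?thesis
    using assms surviving_Pr[OF assms(1,1,2)] by (simp add: integral_density)
qed

lemma path_generated:
  "path S s t \<in> generated S {s..t} \<rightarrow>\<^sub>M path_space S s t"
  unfolding path_def[abs_def] path_space_def by (intro measurable_restrict coord_generated) auto

lemma path_measurable: "path S s t \<in> Sample S \<rightarrow>\<^sub>M path_space S s t"
  unfolding path_def[abs_def] path_space_def by (intro measurable_restrict coord_meas) auto

lemma integral_alive_path:
  fixes f :: "(real \<Rightarrow> 'e) \<Rightarrow> real"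
  assumes st: "s \<in> Time S" "t \<in> Time S" "T \<in> Time S" "s \<le> t" "t \<le> T"
    and f: "f \<in> borel_measurable (path_space S s t)"
  shows "(\<integral>w. f (path S s t w) \<partial>alive_part s T x) =
    (\<integral>w. f (path S s t w) * survival t T (coord S t w) \<partial>alive_part s t x)"
proof -
  note pm = measurable_alive_part[OF st(1) path_measurable]
  have "(\<integral>w. f (path S s t w) \<partial>alive_part s T x) = (\<integral>p. f p \<partial>distr (alive_part s T x) (path_space S s t) (path S s t))"
    by (rule integral_distr[symmetric, OF pm f])
  also have "\<dots> = (\<integral>p. f p \<partial>distr (density (alive_part s t x) (\<lambda>w. ennreal (survival t T (coord S t w))))
      (path_space S s t) (path S s t))"
    by (simp only: markov_survival[OF st path_generated])
  also have "\<dots> = (\<integral>w. f (path S s t w) \<partial>density (alive_part s t x) (\<lambda>w. ennreal (survival t T (coord S t w))))"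
    using pm f by (intro integral_distr) auto
  also have "\<dots> = (\<integral>w. survival t T (coord S t w) *\<^sub>R f (path S s t w) \<partial>alive_part s t x)"
    using measurable_alive_part[OF st(1) survival_coord_measurable[OF st(2,3)]] measurable_compose[OF pm f]
    by (intro integral_density) (auto simp: survival_def)
  finally show ?thesis by (simp add: mult.commute)
qed

end

context periodic_absorbed_process
begin

lemma F_time: "F = time_at_top S"
  unfolding F_def time_at_top_def ..

lemma Z_survival: "s \<in> Time S \<Longrightarrow> t \<in> Time S \<Longrightarrow> Z s t = survival s t"
  unfolding Z_def using measure_joint_UNIV by auto

lemma P_integral:
  assumes "s \<in> Time S" "t \<in> Time S" "s \<le> t" "bm f"
  shows "P s t f x = (\<integral>w. indicator (surviving S s t) w * f (coord S t w) \<partial>Pr S s x)"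
  unfolding P_def using assms by (intro integral_joint) auto

lemma coord_indicator_cong:
  assumes "t \<in> Time S" "s \<le> t" "\<And>x. x \<in> alive S t \<Longrightarrow> f x = g x"
  shows "indicator (surviving S s t) w * f (coord S t w) = indicator (surviving S s t) w * (g (coord S t w) :: real)"
  using surviving_alive[OF assms(1,2), of w] assms(3) by (auto simp: indicator_def)

lemma profile_survival_profile:
  assumes \<eta>: "profile \<eta>"
  shows "survival_profile S \<eta>"
  unfolding survival_profile_def
proof (intro ballI conjI impI)
  fix s assume s: "s \<in> Time S"
  note D = profileD[OF \<eta> s]
  show "\<eta> s \<in> borel_measurable (restrict_space (State S) (alive S s))"
    using D(1) by (intro measurable_restrict_space1) auto
  show "bounded (\<eta> s ` alive S s)"
  proof -
    obtain b where "\<And>x. \<bar>\<eta> s x\<bar> \<le> b"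
      using bounded_measurable_bound[OF D(1)] by (metis UNIV_I state_space)
    then show ?thesis unfolding bounded_iff by auto
  qed
  show "0 < \<eta> s x" if "x \<in> alive S s" for x using D(2)[OF that] .
  show "((\<lambda>t. measure (Pr S s x) (surviving S s t) / measure (Pr S s y) (surviving S s t))
           \<longlongrightarrow> \<eta> s x / \<eta> s y) (time_at_top S)" if "x \<in> alive S s" "y \<in> alive S s" for x y
    using D(5)[OF that] unfolding F_time
  proof (rule Lim_transform_eventually)
    show "\<forall>\<^sub>F t in time_at_top S. Z s t x / Z s t y =
       measure (Pr S s x) (surviving S s t) / measure (Pr S s y) (surviving S s t)"
      using eventually_F_ge[of 0] unfolding F_time
      by eventually_elim (simp add: Z_survival s survival_def)
  qed
  fix t x assume t: "t \<in> Time S" "x \<in> alive S s" "s \<le> t"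
  show "(\<integral>w. indicator (surviving S s t) w * \<eta> t (coord S t w) \<partial>Pr S s x) = \<eta> s x"
    using profile_P[OF \<eta> s t(1,3), of x] P_integral[OF s t(1,3) profileD(1)[OF \<eta> t(1)], of x] by simp
qed

text \<open>A survival profile is arbitrary off the alive states and measurable only on them; its
  extension by 0 fits \<open>profile\<close> and yields the same path laws from alive
  states.\<close>

definition cut :: "(real \<Rightarrow> 'e \<Rightarrow> real) \<Rightarrow> real \<Rightarrow> 'e \<Rightarrow> real" where
  "cut \<eta> s x = (if x \<in> alive S s then \<eta> s x else 0)"

lemma weight_cut:
  assumes "t \<in> Time S" "s \<le> t"
  shows "indicator (surviving S s t) w * cut \<eta> t (coord S t w) = indicator (surviving S s t) w * \<eta> t (coord S t w)"
  using assms by (intro coord_indicator_cong) (auto simp: cut_def)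

lemma survival_profile_cut:
  assumes "survival_profile S \<eta>"
  shows "profile (cut \<eta>)"
proof -
  have H: "\<eta> s \<in> borel_measurable (restrict_space (State S) (alive S s))"
     "bounded (\<eta> s ` alive S s)" "\<And>x. x \<in> alive S s \<Longrightarrow> 0 < \<eta> s x"
     "\<And>x y. x \<in> alive S s \<Longrightarrow> y \<in> alive S s \<Longrightarrow>
        ((\<lambda>t. measure (Pr S s x) (surviving S s t) / measure (Pr S s y) (surviving S s t))
           \<longlongrightarrow> \<eta> s x / \<eta> s y) (time_at_top S)"
     "\<And>t x. t \<in> Time S \<Longrightarrow> x \<in> alive S s \<Longrightarrow> s \<le> t \<Longrightarrow>
        (\<integral>w. indicator (surviving S s t) w * \<eta> t (coord S t w) \<partial>Pr S s x) = \<eta> s x"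
    if s: "s \<in> Time S" for s
  proof -
    note * = bspec[OF assms[unfolded survival_profile_def] s]
    show "\<eta> s \<in> borel_measurable (restrict_space (State S) (alive S s))" using * by (elim conjE)
    show "bounded (\<eta> s ` alive S s)" using * by (elim conjE)
    show "0 < \<eta> s x" if "x \<in> alive S s" for x using * that by blast
    show "((\<lambda>t. measure (Pr S s x) (surviving S s t) / measure (Pr S s y) (surviving S s t))
           \<longlongrightarrow> \<eta> s x / \<eta> s y) (time_at_top S)" if "x \<in> alive S s" "y \<in> alive S s" for x y
      using * that by blast
    show "(\<integral>w. indicator (surviving S s t) w * \<eta> t (coord S t w) \<partial>Pr S s x) = \<eta> s x"
      if "t \<in> Time S" "x \<in> alive S s" "s \<le> t" for t x
      using * that by blast
  qed
  have bmc: "bm (cut \<eta> s)" if s: "s \<in> Time S" for s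
  proof -
    obtain b where b: "\<And>x. x \<in> alive S s \<Longrightarrow> \<bar>\<eta> s x\<bar> \<le> b"
      using H(2)[OF s] unfolding bounded_iff by auto
    have "alive S s \<inter> space (State S) \<in> sets (State S)" using alive_sets[OF s] by (simp add: state_space)
    from borel_measurable_restrict_space_iff[OF this, of "\<eta> s"]
    have "(\<lambda>x. indicator (alive S s) x *\<^sub>R \<eta> s x) \<in> borel_measurable (State S)" using H(1)[OF s] by simp
    also have "(\<lambda>x. indicator (alive S s) x *\<^sub>R \<eta> s x) = cut \<eta> s" by (auto simp: cut_def)
    finally show ?thesis
      by (rule bounded_measurableI[where b = "max b 0"])
         (use b in \<open>auto simp: cut_def le_max_iff_disj\<close>)
  qed
  show ?thesis
    unfolding profile_def ratio_limit_def
  proof (intro conjI ballI allI impI)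
    fix s assume s: "s \<in> Time S"
    show "bm (cut \<eta> s)" by (rule bmc[OF s])
    show "0 < cut \<eta> s x" if "x \<in> alive S s" for x using H(3)[OF s that] that by (simp add: cut_def)
    show "cut \<eta> s x = 0" if "x \<notin> alive S s" for x using that by (simp add: cut_def)
    show "((\<lambda>t. Z s t x / Z s t y) \<longlongrightarrow> cut \<eta> s x / cut \<eta> s y) F" if xy: "x \<in> alive S s" "y \<in> alive S s" for x y
    proof (rule Lim_transform_eventually)
      show "((\<lambda>t. measure (Pr S s x) (surviving S s t) / measure (Pr S s y) (surviving S s t))
           \<longlongrightarrow> cut \<eta> s x / cut \<eta> s y) F"
        using H(4)[OF s xy] xy by (simp add: F_time cut_def)
      show "\<forall>\<^sub>F t in F. measure (Pr S s x) (surviving S s t) / measure (Pr S s y) (surviving S s t) =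
         Z s t x / Z s t y"
        using eventually_F_ge[of 0] by eventually_elim (simp add: Z_survival s survival_def)
    qed
    fix t x assume t: "t \<in> Time S" "s \<le> t" and x: "x \<in> alive S s"
    have "P s t (cut \<eta> t) x = (\<integral>w. indicator (surviving S s t) w * cut \<eta> t (coord S t w) \<partial>Pr S s x)"
      by (rule P_integral[OF s t bmc[OF t(1)]])
    also have "\<dots> = (\<integral>w. indicator (surviving S s t) w * \<eta> t (coord S t w) \<partial>Pr S s x)"
      by (simp only: weight_cut[OF t])
    also have "\<dots> = cut \<eta> s x" using H(5)[OF s t(1) x t(2)] x by (simp add: cut_def)
    finally show "P s t (cut \<eta> t) x = cut \<eta> s x" .
  qed
qed

definition Q_path :: "(real \<Rightarrow> 'e \<Rightarrow> real) \<Rightarrow> real \<Rightarrow> real \<Rightarrow> 'e \<Rightarrow> (real \<Rightarrow> 'e) measure" where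
  "Q_path \<eta> s t x = distr (density (Pr S s x)
     (\<lambda>w. ennreal (indicator (surviving S s t) w * \<eta> t (coord S t w) / \<eta> s x)))
     (path_space S s t) (path S s t)"

lemma Q_path_cut:
  assumes "s \<in> Time S" "t \<in> Time S" "s \<le> t" "x \<in> alive S s"
  shows "Q_path \<eta> s t x = Q_path (cut \<eta>) s t x"
  unfolding Q_path_def weight_cut[OF assms(2,3)] using assms(4) by (simp add: cut_def)

context
  fixes \<eta> s t assumes \<eta>: "profile \<eta>" and st: "s \<in> Time S" "t \<in> Time S" "s \<le> t"
begin

lemma eta_coord_measurable: "(\<lambda>w. \<eta> t (coord S t w)) \<in> borel_measurable (Sample S)"
  using profileD(1)[OF \<eta> st(2)] by (intro measurable_compose[OF coord_meas[OF st(2)]]) auto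

lemma weight_measurable:
  "(\<lambda>w. indicator (surviving S s t) w * \<eta> t (coord S t w)) \<in> borel_measurable (Sample S)"
  using eta_coord_measurable surviving_sets[OF st(1,2)] by measurable

lemma weight_nonneg: "0 \<le> indicator (surviving S s t) w * \<eta> t (coord S t w)"
  using profileD(4)[OF \<eta> st(2)] by simp

lemma integral_eta_alive: "(\<integral>w. \<eta> t (coord S t w) \<partial>alive_part s t x) = \<eta> s x"
  using integral_alive_part[OF st(1,2) measurable_Pr[OF st(1) eta_coord_measurable], of x]
    profile_P[OF \<eta> st, of x] P_integral[OF st profileD(1)[OF \<eta> st(2)], of x] by simp

text \<open>The conditional expectation of a function of the path is an expectation on survival up
  to \<open>t\<close>, weighted by the survival probability from \<open>t\<close> to
  \<open>T\<close> at the current state and normalized. So \<open>survival_weight_tendsto\<close>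
  applies, with \<open>alive_part\<close> as the measure.\<close>

lemma Q_path_weak:
  assumes x: "x \<in> alive S s"
  shows "weakly_converges (product_topology (\<lambda>_. euclidean) (Time S \<inter> {s..t}))
          (\<lambda>T. cond_path_law S (Pr S s x) s T t) (Q_path \<eta> s t x) (time_at_top S)"
  unfolding weakly_converges_def
proof (intro allI impI, elim conjE)
  fix f :: "(real \<Rightarrow> 'e) \<Rightarrow> real"
  assume fm: "f \<in> borel_measurable (Q_path \<eta> s t x)"
    and fb: "bounded (f ` topspace (product_topology (\<lambda>_. euclidean) (Time S \<inter> {s..t})))"
  have f: "f \<in> borel_measurable (path_space S s t)" using fm by (simp add: Q_path_def)
  have "topspace (product_topology (\<lambda>_. euclidean) (Time S \<inter> {s..t})) = space (path_space S s t)"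
    by (simp add: path_space_def space_PiM state_space)
  with fb obtain b where b: "\<And>p. p \<in> space (path_space S s t) \<Longrightarrow> \<bar>f p\<bar> \<le> b"
    unfolding bounded_iff by auto
  note N = alive_part_finite[OF st(1,2), of x]
  note pm = measurable_alive_part[OF st(1) path_measurable]
  have bf: "bounded_measurable (alive_part s t x) (\<lambda>w. f (path S s t w))"
    using f b by (intro bounded_measurable_compose[OF _ pm] bounded_measurableI)
  have fp: "(\<lambda>w. f (path S s t w)) \<in> borel_measurable (Pr S s x)"
    by (rule measurable_compose[OF measurable_Pr[OF st(1) path_measurable] f])
  have lim: "((\<lambda>T. (\<integral>w. f (path S s t w) * Z t T (coord S t w) \<partial>alive_part s t x) /
      (\<integral>w. Z t T (coord S t w) \<partial>alive_part s t x)) \<longlongrightarrow>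
    (\<integral>w. f (path S s t w) * \<eta> t (coord S t w) \<partial>alive_part s t x) /
      (\<integral>w. \<eta> t (coord S t w) \<partial>alive_part s t x)) F"
    using profileD(2)[OF \<eta> st(1) x]
    by (intro survival_weight_tendsto[OF \<eta> N measurable_alive_part[OF st(1) coord_meas[OF st(2)]] bf st(2)])
       (simp add: integral_eta_alive)
  have lim_eq: "(\<integral>w. f (path S s t w) * \<eta> t (coord S t w) \<partial>alive_part s t x) /
      (\<integral>w. \<eta> t (coord S t w) \<partial>alive_part s t x) = (\<integral>p. f p \<partial>Q_path \<eta> s t x)"
  proof -
    have "(\<integral>p. f p \<partial>Q_path \<eta> s t x) = (\<integral>w. f (path S s t w) \<partial>density (Pr S s x)
        (\<lambda>w. ennreal (indicator (surviving S s t) w * \<eta> t (coord S t w) / \<eta> s x)))"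
      unfolding Q_path_def using f measurable_Pr[OF st(1) path_measurable] by (intro integral_distr) auto
    also have "\<dots> = (\<integral>w. (indicator (surviving S s t) w * \<eta> t (coord S t w) / \<eta> s x) *\<^sub>R f (path S s t w) \<partial>Pr S s x)"
      using fp measurable_Pr[OF st(1) weight_measurable] weight_nonneg profileD(2)[OF \<eta> st(1) x]
      by (intro integral_density) (auto intro!: divide_nonneg_pos)
    also have "\<dots> = (\<integral>w. indicator (surviving S s t) w * (f (path S s t w) * \<eta> t (coord S t w)) / \<eta> s x \<partial>Pr S s x)"
      by (intro Bochner_Integration.integral_cong) auto
    also have "\<dots> = (\<integral>w. indicator (surviving S s t) w * (f (path S s t w) * \<eta> t (coord S t w)) \<partial>Pr S s x) / \<eta> s x"
      by simp
    also have "(\<integral>w. indicator (surviving S s t) w * (f (path S s t w) * \<eta> t (coord S t w)) \<partial>Pr S s x)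
        = (\<integral>w. f (path S s t w) * \<eta> t (coord S t w) \<partial>alive_part s t x)"
      using fp measurable_Pr[OF st(1) eta_coord_measurable]
      by (intro integral_alive_part[symmetric] st borel_measurable_times)
    finally show ?thesis by (simp add: integral_eta_alive)
  qed
  have ev: "\<forall>\<^sub>F T in F. (\<integral>w. f (path S s t w) * Z t T (coord S t w) \<partial>alive_part s t x) /
      (\<integral>w. Z t T (coord S t w) \<partial>alive_part s t x) = (\<integral>p. f p \<partial>cond_path_law S (Pr S s x) s T t)"
    using eventually_F_ge[of t]
  proof eventually_elim
    case (elim T)
    then have T: "T \<in> Time S" "t \<le> T" by auto
    interpret prob_space "Pr S s x" using st by (intro Pr_prob)
    have surv: "measure (Pr S s x) (surviving S s T) = (\<integral>w. Z t T (coord S t w) \<partial>alive_part s t x)"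
    proof -
      have "(\<integral>w. Z t T (coord S t w) \<partial>alive_part s t x) = (\<integral>w. 1 \<partial>alive_part s T x)"
        using integral_alive_path[OF st(1,2) T(1) st(3) T(2), of "\<lambda>_. 1" x] T st by (simp add: Z_survival)
      also have "\<dots> = (\<integral>w. indicator (surviving S s T) w \<partial>Pr S s x)"
        using integral_alive_part[OF st(1) T(1), of "\<lambda>_. 1" x] by simp
      also have "\<dots> = measure (Pr S s x) (surviving S s T)"
        using surviving_Pr[OF st(1,1) T(1)] by simp
      finally show ?thesis ..
    qed
    have "(\<integral>p. f p \<partial>cond_path_law S (Pr S s x) s T t) =
        (\<integral>w. f (path S s t w) \<partial>uniform_measure (Pr S s x) (surviving S s T))"
      unfolding cond_path_law_def using f measurable_Pr[OF st(1) path_measurable, of s t x]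
      by (intro integral_distr) auto
    also have "\<dots> = (\<integral>w. indicator (surviving S s T) w * f (path S s t w) \<partial>Pr S s x) / measure (Pr S s x) (surviving S s T)"
      using fp surviving_Pr[OF st(1,1) T(1)] survival_pos[OF st(1) T(1) _ x] st T
      by (intro integral_uniform_measure finite_measure_axioms) auto
    also have "(\<integral>w. indicator (surviving S s T) w * f (path S s t w) \<partial>Pr S s x) =
        (\<integral>w. f (path S s t w) * Z t T (coord S t w) \<partial>alive_part s t x)"
      using integral_alive_part[OF st(1) T(1) fp] integral_alive_path[OF st(1,2) T(1) st(3) T(2) f, of x] T st
      by (simp add: Z_survival)
    finally show ?case using surv by simp
  qed
  show "((\<lambda>T. \<integral>p. f p \<partial>cond_path_law S (Pr S s x) s T t) \<longlongrightarrow>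
      (\<integral>p. f p \<partial>Q_path \<eta> s t x)) (time_at_top S)"
    unfolding F_time[symmetric] by (rule Lim_transform_eventually[OF lim[unfolded lim_eq] ev])
qed

lemma sets_Q_path: "sets (Q_path \<eta> s t x) = sets (path_space S s t)"
  unfolding Q_path_def by simp

lemma Q_path_prob:
  assumes x: "x \<in> alive S s"
  shows "prob_space (Q_path \<eta> s t x)"
proof -
  have "prob_space (density (Pr S s x)
     (\<lambda>w. ennreal (indicator (surviving S s t) w * \<eta> t (coord S t w) / \<eta> s x)))" (is "prob_space ?D")
  proof (rule prob_spaceI)
    interpret prob_space "Pr S s x" using st by (intro Pr_prob)
    have m: "(\<lambda>w. indicator (surviving S s t) w * \<eta> t (coord S t w)) \<in> borel_measurable (Pr S s x)"
      by (rule measurable_Pr[OF st(1) weight_measurable])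
    obtain b where b: "0 < b" "\<And>x. \<bar>\<eta> t x\<bar> \<le> b"
      using bounded_measurable_bound[OF profileD(1)[OF \<eta> st(2)]] by (metis UNIV_I state_space)
    have int: "integrable (Pr S s x) (\<lambda>w. indicator (surviving S s t) w * \<eta> t (coord S t w) / \<eta> s x)"
      using m b by (intro integrable_divide integrable_const_bound[where B = b])
        (auto simp: indicator_def less_imp_le)
    have "emeasure ?D (space ?D) = (\<integral>\<^sup>+w. ennreal (indicator (surviving S s t) w * \<eta> t (coord S t w) / \<eta> s x) \<partial>Pr S s x)"
      using m by (subst emeasure_density) (auto intro!: nn_integral_cong)
    also have "\<dots> = ennreal (\<integral>w. indicator (surviving S s t) w * \<eta> t (coord S t w) / \<eta> s x \<partial>Pr S s x)"
      using int weight_nonneg profileD(2)[OF \<eta> st(1) x]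
      by (intro nn_integral_eq_integral) (auto intro!: divide_nonneg_pos)
    also have "(\<integral>w. indicator (surviving S s t) w * \<eta> t (coord S t w) / \<eta> s x \<partial>Pr S s x) = 1"
      using profile_P[OF \<eta> st, of x] P_integral[OF st profileD(1)[OF \<eta> st(2)], of x]
        profileD(2)[OF \<eta> st(1) x] by simp
    finally show "emeasure ?D (space ?D) = 1" by simp
  qed
  then show ?thesis unfolding Q_path_def
    using measurable_Pr[OF st(1) path_measurable] by (intro prob_space.prob_space_distr) auto
qed

text \<open>The factor \<open>1 / \<eta> s x\<close> does not depend on the sample point and comes
  out of the integral; what is left is measurable in \<open>x\<close> because \<open>Pr S s\<close>
  is a kernel.\<close>

lemma Q_path_kernel:
  "Q_path \<eta> s t \<in> restrict_space (State S) (alive S s) \<rightarrow>\<^sub>M subprob_algebra (path_space S s t)"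
proof (rule measurable_subprob_algebra)
  fix A assume A: "A \<in> sets (path_space S s t)"
  define D where "D = path S s t -` A \<inter> \<Omega>"
  have D: "D \<in> sets (Sample S)" using measurable_sets[OF path_measurable A] by (simp add: D_def)
  define g where "g w = ennreal (indicator (surviving S s t) w * \<eta> t (coord S t w)) * indicator D w" for w
  have g: "g \<in> borel_measurable (Sample S)"
    unfolding g_def using weight_measurable D by measurable
  have "(\<lambda>x. \<integral>\<^sup>+w. g w \<partial>Pr S s x) \<in> borel_measurable (State S)"
    by (rule measurable_compose[OF measurable_prob_algebraD[OF Pr_kernel[OF st(1)]]
          nn_integral_measurable_subprob_algebra[OF g]])
  moreover have "(\<lambda>x. ennreal (1 / \<eta> s x)) \<in> borel_measurable (State S)"
    using profileD(1)[OF \<eta> st(1)] by (intro measurable_compose[OF _ measurable_ennreal] borel_measurable_divide) auto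
  ultimately have m: "(\<lambda>x. ennreal (1 / \<eta> s x) * (\<integral>\<^sup>+w. g w \<partial>Pr S s x)) \<in> borel_measurable (restrict_space (State S) (alive S s))"
    by (intro measurable_restrict_space1 borel_measurable_times_ennreal)
  have eq: "emeasure (Q_path \<eta> s t x) A = ennreal (1 / \<eta> s x) * (\<integral>\<^sup>+w. g w \<partial>Pr S s x)"
    if x: "x \<in> alive S s" for x
  proof -
    have wm: "(\<lambda>w. ennreal (indicator (surviving S s t) w * \<eta> t (coord S t w) / \<eta> s x)) \<in> borel_measurable (Pr S s x)"
      using measurable_Pr[OF st(1) weight_measurable, of x] by measurable
    have "emeasure (Q_path \<eta> s t x) A = emeasure (density (Pr S s x)
     (\<lambda>w. ennreal (indicator (surviving S s t) w * \<eta> t (coord S t w) / \<eta> s x))) D"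
      unfolding Q_path_def D_def using A measurable_Pr[OF st(1) path_measurable, of s t x]
      by (subst emeasure_distr) (auto simp: Pr_space st)
    also have "\<dots> = (\<integral>\<^sup>+w. ennreal (indicator (surviving S s t) w * \<eta> t (coord S t w) / \<eta> s x) * indicator D w \<partial>Pr S s x)"
      using wm D Pr_sets[OF st(1), of x] by (subst emeasure_density) auto
    also have "\<dots> = (\<integral>\<^sup>+w. ennreal (1 / \<eta> s x) * g w \<partial>Pr S s x)"
    proof (rule nn_integral_cong)
      fix w
      show "ennreal (indicator (surviving S s t) w * \<eta> t (coord S t w) / \<eta> s x) * indicator D w = ennreal (1 / \<eta> s x) * g w"
        using ennreal_mult[of "1 / \<eta> s x" "indicator (surviving S s t) w * \<eta> t (coord S t w)"]
          weight_nonneg[of w] profileD(2)[OF \<eta> st(1) x]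
        by (simp add: g_def mult.assoc[symmetric])
    qed
    also have "\<dots> = ennreal (1 / \<eta> s x) * (\<integral>\<^sup>+w. g w \<partial>Pr S s x)"
      by (rule nn_integral_cmult[OF measurable_Pr[OF st(1) g]])
    finally show ?thesis .
  qed
  have "(\<lambda>x. emeasure (Q_path \<eta> s t x) A) \<in> borel_measurable (restrict_space (State S) (alive S s)) \<longleftrightarrow>
    (\<lambda>x. ennreal (1 / \<eta> s x) * (\<integral>\<^sup>+w. g w \<partial>Pr S s x)) \<in> borel_measurable (restrict_space (State S) (alive S s))"
    by (rule measurable_cong) (simp add: eq space_restrict_space)
  with m show "(\<lambda>x. emeasure (Q_path \<eta> s t x) A) \<in> borel_measurable (restrict_space (State S) (alive S s))" by blast
qed (auto simp: space_restrict_space sets_Q_path intro!: prob_space_imp_subprob_space Q_path_prob)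

end

text \<open>Connects path laws with the abstract kernel \<open>q\<close>: on survival the density
  depends only on the state at time \<open>t\<close>, so it passes to the image of the killed
  law.\<close>

lemma distr_Q_path:
  assumes \<eta>: "profile \<eta>" and t: "t \<in> Time S" and x: "x \<in> alive S 0"
  shows "distr (Q_path \<eta> 0 t x) (State S) (\<lambda>p. p t) = q \<eta> t x"
proof -
  have t0: "0 \<le> t" using Time_nonneg t .
  note st = Time_zero t t0
  have c: "(\<lambda>p. p t) \<in> path_space S 0 t \<rightarrow>\<^sub>M State S"
    unfolding path_space_def using t t0 by (intro measurable_component_singleton) auto
  have "(\<lambda>p. p t) \<circ> path S 0 t = coord S t" using t t0 by (auto simp: path_def)
  then have "distr (Q_path \<eta> 0 t x) (State S) (\<lambda>p. p t) = distr (density (Pr S 0 x)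
     (\<lambda>w. ennreal (indicator (surviving S 0 t) w * \<eta> t (coord S t w) / \<eta> 0 x))) (State S) (coord S t)"
    unfolding Q_path_def using c measurable_Pr[OF Time_zero path_measurable, of 0 t x]
    by (subst distr_distr) auto
  also have "density (Pr S 0 x) (\<lambda>w. ennreal (indicator (surviving S 0 t) w * \<eta> t (coord S t w) / \<eta> 0 x)) =
    density (alive_part 0 t x) (\<lambda>w. ennreal (\<eta> t (coord S t w) / \<eta> 0 x))"
  proof -
    have i: "(indicator (surviving S 0 t) :: _ \<Rightarrow> ennreal) \<in> borel_measurable (Pr S 0 x)"
      using surviving_Pr[OF Time_zero Time_zero t] by (rule borel_measurable_indicator)
    have e: "(\<lambda>w. ennreal (\<eta> t (coord S t w) / \<eta> 0 x)) \<in> borel_measurable (Pr S 0 x)"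
      using measurable_Pr[OF Time_zero eta_coord_measurable[OF \<eta> st], of x] by measurable
    show ?thesis
      unfolding density_density_eq[OF i e]
      by (intro arg_cong2[where f = density] refl ext) (auto simp: indicator_def)
  qed
  also have "distr \<dots> (State S) (coord S t) = density (killed 0 t x) (\<lambda>y. ennreal (\<eta> t y / \<eta> 0 x))"
    unfolding joint_def using coord_Pr[OF Time_zero t t] profileD(1)[OF \<eta> t]
    by (subst density_distr) (auto intro!: measurable_compose[OF _ measurable_ennreal] borel_measurable_divide)
  also have "\<dots> = q \<eta> t x" unfolding q_def[OF \<eta>] ..
  finally show ?thesis .
qed

lemma start_probs_on: "start \<mu> \<longleftrightarrow> \<mu> \<in> probs_on S (alive S 0)"
proof -
  have "(AE x in \<mu>. x \<in> alive S 0) \<longleftrightarrow> emeasure \<mu> (alive S 0) = 1" if "prob_space \<mu>" "sets \<mu> = sets (State S)"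
  proof -
    interpret prob_space \<mu> by fact
    show ?thesis using alive_sets[OF Time_zero] that prob_eq_1[of "alive S 0"] by (simp add: emeasure_eq_measure)
  qed
  then show ?thesis unfolding start_def probs_on_def space_prob_algebra by auto
qed

lemma Q_process_exists: "\<exists>Q. Q_process S Q"
proof -
  obtain \<eta> where \<eta>: "profile \<eta>" using ex_profile by blast
  have "Q_process S (Q_path \<eta>)"
    unfolding Q_process_def
    using Q_path_weak[OF \<eta>] profile_survival_profile[OF \<eta>]
    by (auto intro!: exI[of _ \<eta>] simp: Q_path_def)
  then show ?thesis by blast
qed

text \<open>Every \<open>Q\<close>-process, not just the constructed one, arises from a
  \<open>profile\<close>: the one that its definition provides, extended by 0.\<close>

lemma Q_process_profile:
  assumes "Q_process S QQ"
  obtains \<eta> where "profile \<eta>"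
    "\<And>s t x. s \<in> Time S \<Longrightarrow> t \<in> Time S \<Longrightarrow> s \<le> t \<Longrightarrow> x \<in> alive S s \<Longrightarrow> QQ s t x = Q_path \<eta> s t x"
proof -
  from assms obtain \<eta> where \<eta>: "survival_profile S \<eta>"
    "\<forall>s\<in>Time S. \<forall>t\<in>Time S. \<forall>x\<in>alive S s. s \<le> t \<longrightarrow> QQ s t x = Q_path \<eta> s t x"
    unfolding Q_process_def Q_path_def by blast
  show ?thesis
    using \<eta>(2) Q_path_cut[of _ _ _ \<eta>] by (intro that[OF survival_profile_cut[OF \<eta>(1)]]) simp
qed

context
  fixes QQ \<eta>
  assumes \<eta>: "profile \<eta>"
    and QQ: "\<And>s t x. s \<in> Time S \<Longrightarrow> t \<in> Time S \<Longrightarrow> s \<le> t \<Longrightarrow> x \<in> alive S s \<Longrightarrow> QQ s t x = Q_path \<eta> s t x"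
begin

text \<open>Taking the coordinate at time \<open>t\<close> commutes with mixing over the initial
  state.\<close>

lemma Q_law_Qm:
  assumes \<beta>: "start \<beta>" and t: "t \<in> Time S"
  shows "Q_law S QQ 0 \<beta> t = Qm \<eta> \<beta> t"
proof -
  have t0: "0 \<le> t" using Time_nonneg t .
  note st = Time_zero t t0
  let ?R = "restrict_space \<beta> (alive S 0)"
  have sp: "space ?R = alive S 0" using startD(4)[OF \<beta>] by (simp add: space_restrict_space)
  have ne: "space ?R \<noteq> {}" using sp E_nonempty[OF Time_zero] by simp
  have "?R \<bind> QQ 0 t = ?R \<bind> Q_path \<eta> 0 t"
    using QQ[OF st] sp by (intro bind_cong_All) auto
  moreover have "Q_path \<eta> 0 t \<in> ?R \<rightarrow>\<^sub>M subprob_algebra (path_space S 0 t)"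
    using Q_path_kernel[OF \<eta> st]
    unfolding measurable_cong_sets[OF sets_restrict_space_cong[OF startD(2)[OF \<beta>]] refl] .
  ultimately have "Q_law S QQ 0 \<beta> t = ?R \<bind> (\<lambda>x. distr (Q_path \<eta> 0 t x) (State S) (\<lambda>p. p t))"
    unfolding Q_law_def using ne t t0
    by (simp add: distr_bind path_space_def measurable_component_singleton)
  also have "\<dots> = ?R \<bind> q \<eta> t"
    using distr_Q_path[OF \<eta> t] sp by (intro bind_cong_All) auto
  finally show ?thesis unfolding Qm_def[OF \<eta>] .
qed

lemma Q_invariant_iff: "Q_invariant S QQ \<gamma> \<beta> \<longleftrightarrow> invariant \<eta> \<beta>"
  unfolding Q_invariant_def invariant_def[OF \<eta>] start_probs_on[symmetric]
  using Q_law_Qm period_mult_Time by auto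

end

end

section \<open>Time averages\<close>

context absorbed_markov_process
begin

text \<open>\<open>clock\<close> tests whether time is discrete, so in continuous time it has to be
  known that the half-line is not the set of naturals; \<open>1 / 2\<close> tells them
  apart.\<close>

lemma clock_cases:
  obtains (discrete) "Time S = \<nat>" "clock S = count_space \<nat>"
  | (continuous) "Time S = {0..}" "clock S = lborel"
proof -
  have "(1 / 2 :: real) \<notin> \<nat>"
  proof
    assume "(1 / 2 :: real) \<in> \<nat>"
    then obtain n where "(1 / 2 :: real) = real n" by (auto elim: Nats_cases)
    then have "real (2 * n) = real 1" by simp
    then show False by (simp only: of_nat_eq_iff) presburger
  qed
  moreover have "(1 / 2 :: real) \<in> {0..}" by simp
  ultimately have "{0::real..} \<noteq> \<nat>" by metis
  then show ?thesis using time that by (elim disjE) (simp_all add: clock_def)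
qed

lemma clock_borel: "J \<in> sets borel \<Longrightarrow> J \<inter> space (clock S) \<in> sets (clock S)"
  by (cases rule: clock_cases) simp_all

lemma clock_space_Time: "J \<subseteq> {0..} \<Longrightarrow> J \<inter> space (clock S) = J \<inter> Time S"
  by (cases rule: clock_cases) auto

lemma clock_measurable:
  assumes g: "g \<in> restrict_space borel (Time S) \<rightarrow>\<^sub>M N" and J: "J \<subseteq> {0..}"
  shows "g \<in> restrict_space (clock S) J \<rightarrow>\<^sub>M N"
proof (cases rule: clock_cases)
  case discrete
  have "g s \<in> space N" if "s \<in> \<nat>" for s
    using measurable_space[OF g, of s] that discrete(1) by (simp add: space_restrict_space)
  then show ?thesis unfolding discrete(2)
    by (intro measurableI) (auto simp: space_restrict_space sets_restrict_space)
next
  case continuous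
  have "g \<in> restrict_space borel J \<rightarrow>\<^sub>M N"
    using g J unfolding continuous(1) by (rule measurable_restrict_mono)
  then show ?thesis unfolding continuous(2)
    by (simp add: measurable_cong_sets[OF sets_restrict_space_cong[OF sets_lborel] refl])
qed

text \<open>The extra 1 is due to discrete time, where a closed interval can hold one integer more
  than its length. It is harmless after division by a large time.\<close>

lemma clock_mass:
  assumes "a \<le> b"
  shows "emeasure (clock S) ({a..b} \<inter> space (clock S)) \<le> ennreal (b - a + 1)"
proof (cases rule: clock_cases)
  case discrete
  have sub: "{a..b} \<inter> \<nat> \<subseteq> real_of_int ` {\<lceil>a\<rceil>..\<lfloor>b\<rfloor>}"
  proof
    fix s assume "s \<in> {a..b} \<inter> \<nat>"
    then obtain n where "s = real n" "a \<le> s" "s \<le> b" by (auto elim: Nats_cases)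
    then show "s \<in> real_of_int ` {\<lceil>a\<rceil>..\<lfloor>b\<rfloor>}"
      by (intro image_eqI[of _ _ "int n"]) (simp_all add: ceiling_le_iff le_floor_iff)
  qed
  have fin: "finite ({a..b} \<inter> (\<nat> :: real set))" by (rule finite_subset[OF sub]) simp
  have "card ({a..b} \<inter> (\<nat> :: real set)) \<le> card {\<lceil>a\<rceil>..\<lfloor>b\<rfloor>}"
    using surj_card_le[OF _ sub] by simp
  also have "real \<dots> \<le> b - a + 1"
    using assms by simp linarith
  finally have "real (card ({a..b} \<inter> (\<nat> :: real set))) \<le> b - a + 1" by simp
  then show ?thesis using fin unfolding discrete(2)
    by (simp add: ennreal_of_nat_eq_real_of_nat ennreal_leI)
next
  case continuous
  then show ?thesis using assms by (simp add: ennreal_leI)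
qed

context
  fixes g :: "real \<Rightarrow> real" and J :: "real set" and a b :: real
  assumes g: "g \<in> borel_measurable (restrict_space borel (Time S))"
    and J: "J \<in> sets borel" "J \<subseteq> {a..b}" and ab: "0 \<le> a" "a \<le> b"
begin

lemma J_nonneg: "J \<subseteq> {0..}" using J(2) ab(1) by auto

lemma set_borel_measurable_clock: "g \<in> borel_measurable (restrict_space (clock S) J)"
  by (rule clock_measurable[OF g J_nonneg])

lemma restrict_clock:
  "finite_measure (restrict_space (clock S) J)"
  "measure (restrict_space (clock S) J) (space (restrict_space (clock S) J)) \<le> b - a + 1"
proof -
  have "emeasure (restrict_space (clock S) J) (space (restrict_space (clock S) J)) = emeasure (clock S) (J \<inter> space (clock S))"
    using clock_borel[OF J(1)] by (subst emeasure_restrict_space) (auto simp: space_restrict_space)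
  also have "\<dots> \<le> emeasure (clock S) ({a..b} \<inter> space (clock S))"
    using J by (intro emeasure_mono clock_borel) auto
  also have "\<dots> \<le> ennreal (b - a + 1)" by (rule clock_mass[OF ab(2)])
  finally have le: "emeasure (restrict_space (clock S) J) (space (restrict_space (clock S) J)) \<le> ennreal (b - a + 1)" .
  then show "finite_measure (restrict_space (clock S) J)"
    by (intro finite_measureI) (metis ennreal_less_top infinity_ennreal_def leD)
  show "measure (restrict_space (clock S) J) (space (restrict_space (clock S) J)) \<le> b - a + 1"
    using le ab(2) unfolding measure_def by (intro enn2real_leI) auto
qed

lemma clock_integrable:
  assumes B: "\<And>s. s \<in> Time S \<Longrightarrow> s \<in> J \<Longrightarrow> \<bar>g s\<bar> \<le> B"
  shows "set_integrable (clock S) J g"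
proof -
  interpret finite_measure "restrict_space (clock S) J" by (rule restrict_clock)
  have "integrable (restrict_space (clock S) J) g"
    using B clock_space_Time[OF J_nonneg] set_borel_measurable_clock
    by (intro integrable_const_bound[where B = B] AE_I2) (auto simp: space_restrict_space)
  then show ?thesis
    using clock_borel[OF J(1)] by (simp add: integrable_restrict_space set_integrable_def)
qed

lemma clock_integral_bound:
  assumes B: "\<And>s. s \<in> Time S \<Longrightarrow> s \<in> J \<Longrightarrow> \<bar>g s\<bar> \<le> B" and "0 \<le> B"
  shows "\<bar>\<integral>s\<in>J. g s \<partial>clock S\<bar> \<le> B * (b - a + 1)"
proof -
  let ?R = "restrict_space (clock S) J"
  interpret finite_measure ?R by (rule restrict_clock)
  have "(\<integral>s\<in>J. g s \<partial>clock S) = (\<integral>s. g s \<partial>?R)"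
    using clock_borel[OF J(1)] by (simp add: integral_restrict_space set_lebesgue_integral_def)
  also have "\<bar>\<dots>\<bar> \<le> (\<integral>s. B \<partial>?R)"
  proof (rule order_trans[OF integral_abs_bound])
    have b: "\<bar>g s\<bar> \<le> B" if "s \<in> space ?R" for s
      using B that clock_space_Time[OF J_nonneg] by (auto simp: space_restrict_space)
    then have "integrable ?R g"
      using set_borel_measurable_clock by (intro integrable_const_bound[where B = B] AE_I2) auto
    then show "(\<integral>s. \<bar>g s\<bar> \<partial>?R) \<le> (\<integral>s. B \<partial>?R)"
      using b by (intro integral_mono) auto
  qed
  also have "\<dots> \<le> B * (b - a + 1)"
    using restrict_clock(2) \<open>0 \<le> B\<close> by (simp add: mult.commute mult_left_mono)
  finally show ?thesis .
qed

end

text \<open>The clock is invariant under translation by a time of the process. Half-open intervals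
  tile the line without counting common endpoints twice, which matters in discrete time.\<close>

lemma clock_shift:
  assumes p: "p \<in> Time S" and x: "0 \<le> x"
    and per: "\<And>s. s \<in> Time S \<Longrightarrow> G (s + p) = G s"
  shows "(\<integral>s\<in>{x + p..<y + p}. G s \<partial>clock S) = (\<integral>s\<in>{x..<y}. (G s :: real) \<partial>clock S)"
proof (cases rule: clock_cases)
  case discrete
  have fin: "finite ({u..<v} \<inter> (\<nat> :: real set))" for u v
  proof (rule finite_subset)
    show "{u..<v} \<inter> (\<nat> :: real set) \<subseteq> real ` {..nat \<lceil>v\<rceil>}"
    proof
      fix s assume "s \<in> {u..<v} \<inter> (\<nat> :: real set)"
      then obtain n where "s = real n" "s < v" by (auto elim: Nats_cases)
      then show "s \<in> real ` {..nat \<lceil>v\<rceil>}" by (intro image_eqI[of _ _ n]) (simp_all, linarith)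
    qed
  qed simp
  have sum: "(\<integral>s\<in>{u..<v}. G s \<partial>count_space \<nat>) = (\<Sum>s\<in>{u..<v} \<inter> \<nat>. G s)" for u v
  proof -
    have "(\<integral>s\<in>{u..<v}. G s \<partial>count_space \<nat>) = (\<Sum>s | s \<in> \<nat> \<and> indicator {u..<v} s *\<^sub>R G s \<noteq> 0. indicator {u..<v} s *\<^sub>R G s)"
      unfolding set_lebesgue_integral_def
      by (rule lebesgue_integral_count_space_finite_support)
         (rule finite_subset[OF _ fin[of u v]], auto simp: indicator_def split: if_splits)
    also have "\<dots> = (\<Sum>s\<in>{u..<v} \<inter> \<nat>. G s)"
      using fin[of u v] by (intro sum.mono_neutral_cong_left) (auto simp: indicator_def split: if_splits)
    finally show ?thesis .
  qed
  have pN: "p \<in> \<nat>" using p discrete(1) by simp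
  have img: "{x + p..<y + p} \<inter> \<nat> = (\<lambda>s. s + p) ` ({x..<y} \<inter> \<nat>)"
  proof (intro set_eqI iffI)
    fix s assume s: "s \<in> {x + p..<y + p} \<inter> \<nat>"
    then have "s - p \<in> \<nat>" using pN x by (intro Nats_diff) auto
    with s show "s \<in> (\<lambda>s. s + p) ` ({x..<y} \<inter> \<nat>)" by (intro image_eqI[of _ _ "s - p"]) auto
  qed (use pN in auto)
  show ?thesis
    unfolding discrete(2) sum img using per discrete(1) by (subst sum.reindex) auto
next
  case continuous
  have "(\<integral>s\<in>{x + p..<y + p}. G s \<partial>lborel) = (\<integral>s. indicator {x + p..<y + p} (p + 1 * s) *\<^sub>R G (p + 1 * s) \<partial>lborel)"
    unfolding set_lebesgue_integral_def
    using lborel_integral_real_affine[of 1 "\<lambda>s. indicator {x + p..<y + p} s *\<^sub>R G s" p] by simp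
  also have "\<dots> = (\<integral>s\<in>{x..<y}. G s \<partial>lborel)"
    unfolding set_lebesgue_integral_def
    using per x continuous(1)
    by (intro Bochner_Integration.integral_cong) (auto simp: indicator_def add.commute)
  finally show ?thesis unfolding continuous(2) .
qed

text \<open>Over \<open>{0..T}\<close> the integral of \<open>G\<close> is \<open>T / p\<close>
  times that over one period, up to the constant \<open>C\<close>. \<open>\<phi> T\<close> is within
  \<open>e / 4\<close> of \<open>G\<close> except on two windows of length \<open>N\<close> at the
  ends, where \<open>2 * B\<close> bounds the difference. The constants disappear on division by
  \<open>T\<close>.\<close>

lemma periodic_average:
  fixes \<phi> :: "real \<Rightarrow> real \<Rightarrow> real"
  assumes p: "p \<in> Time S" "0 < p"
    and per: "\<And>s. s \<in> Time S \<Longrightarrow> G (s + p) = G s"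
    and G: "G \<in> borel_measurable (restrict_space borel (Time S))" "\<And>s. s \<in> Time S \<Longrightarrow> \<bar>G s\<bar> \<le> B"
    and \<phi>: "\<And>T. T \<in> Time S \<Longrightarrow> \<phi> T \<in> borel_measurable (restrict_space borel (Time S))"
      "\<And>s T. s \<in> Time S \<Longrightarrow> T \<in> Time S \<Longrightarrow> \<bar>\<phi> T s\<bar> \<le> B"
    and close: "\<And>e. 0 < e \<Longrightarrow> \<exists>N>0. \<forall>s\<in>Time S. \<forall>T\<in>Time S. N \<le> s \<longrightarrow> s + N \<le> T \<longrightarrow> \<bar>\<phi> T s - G s\<bar> \<le> e"
  shows "((\<lambda>T. (1 / T) * (\<integral>s\<in>{0..T}. \<phi> T s \<partial>clock S)) \<longlongrightarrow>
    (1 / p) * (\<integral>s\<in>{0..<p}. G s \<partial>clock S)) (time_at_top S)"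
proof -
  have B: "0 \<le> B" using G(2)[OF Time_zero] abs_ge_zero order_trans by blast
  define A where "A = (\<integral>s\<in>{0..<p}. G s \<partial>clock S)"
  \<comment> \<open>One share \<open>B * (p + 1)\<close> for rounding \<open>T / p\<close> down to a
    whole number of periods, one for the incomplete last period.\<close>
  define C where "C = 2 * B * (p + 1)"
  have A_bound: "\<bar>A\<bar> \<le> B * (p + 1)"
  proof -
    have "{0..<p} \<subseteq> {0..p}" by auto
    from clock_integral_bound[OF G(1) _ this, of B] show ?thesis
      unfolding A_def using G(2) p B by simp
  qed
  have Gint: "set_integrable (clock S) J G" if "J \<in> sets borel" "J \<subseteq> {0..b}" "0 \<le> b" for J b
    using that G(2) by (intro clock_integrable[OF G(1)]) auto
  have multiples: "(\<integral>s\<in>{0..<real n * p}. G s \<partial>clock S) = real n * A" for n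
  proof (induction n)
    case (Suc n)
    have np: "real n * p \<in> Time S" using time p by (elim disjE) simp_all
    have per': "G (s + real n * p) = G s" if "s \<in> Time S" for s
    proof (induction n)
      case (Suc k)
      have "s + real k * p \<in> Time S" using time p that by (elim disjE) simp_all
      then show ?case using per[of "s + real k * p"] Suc by (simp add: algebra_simps)
    qed simp
    have "{0..<real (Suc n) * p} = {0..<real n * p} \<union> {0 + real n * p..<p + real n * p}"
    proof -
      have "{0..<x + p} = {0..<x} \<union> {0 + x..<p + x}" if "0 \<le> x" for x
        using p that by (auto intro: order_trans)
      from this[of "real n * p"] show ?thesis using p by (simp add: distrib_right add.commute)
    qed
    then have "(\<integral>s\<in>{0..<real (Suc n) * p}. G s \<partial>clock S) =
      (\<integral>s\<in>{0..<real n * p} \<union> {0 + real n * p..<p + real n * p}. G s \<partial>clock S)" by simp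
    also have "\<dots> = (\<integral>s\<in>{0..<real n * p}. G s \<partial>clock S) + (\<integral>s\<in>{0 + real n * p..<p + real n * p}. G s \<partial>clock S)"
    proof (intro set_integral_Un Gint[where b = "p + real n * p"])
      have np0: "0 \<le> real n * p" using p by simp
      show "{0 + real n * p..<p + real n * p} \<subseteq> {0..p + real n * p}"
        by (auto intro: order_trans[OF np0])
    qed (use p in auto)
    also have "(\<integral>s\<in>{0 + real n * p..<p + real n * p}. G s \<partial>clock S) = A"
      unfolding A_def using np per' by (intro clock_shift) auto
    finally show ?case using Suc by (simp add: algebra_simps)
  qed (simp add: set_lebesgue_integral_def)
  have G_avg: "\<bar>(\<integral>s\<in>{0..T}. G s \<partial>clock S) - T / p * A\<bar> \<le> C" if T: "0 \<le> T" for T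
  proof -
    define n where "n = nat \<lfloor>T / p\<rfloor>"
    have "real n \<le> T / p" "T / p < real n + 1" using T p unfolding n_def by (simp_all add: of_nat_nat)
    then have n: "real n * p \<le> T" "T \<le> real n * p + p" and n1: "\<bar>real n - T / p\<bar> \<le> 1"
      using p by (simp_all add: field_simps)
    have np0: "0 \<le> real n * p" using p by simp
    have "{0..T} = {0..<real n * p} \<union> {real n * p..T}"
      using n by (auto intro: order_trans[OF np0])
    then have "(\<integral>s\<in>{0..T}. G s \<partial>clock S) = (\<integral>s\<in>{0..<real n * p} \<union> {real n * p..T}. G s \<partial>clock S)" by simp
    also have "\<dots> = real n * A + (\<integral>s\<in>{real n * p..T}. G s \<partial>clock S)"
      unfolding multiples[symmetric] using n T
      by (intro set_integral_Un Gint[where b = T]) (auto intro: order_trans[OF np0])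
    finally have "(\<integral>s\<in>{0..T}. G s \<partial>clock S) - T / p * A = (real n - T / p) * A + (\<integral>s\<in>{real n * p..T}. G s \<partial>clock S)"
      by (simp add: algebra_simps)
    moreover have "\<bar>(real n - T / p) * A\<bar> \<le> 1 * (B * (p + 1))"
      unfolding abs_mult using n1 A_bound by (intro mult_mono) auto
    moreover have "\<bar>\<integral>s\<in>{real n * p..T}. G s \<partial>clock S\<bar> \<le> B * (T - real n * p + 1)"
      using n(1) np0 G(2) B by (intro clock_integral_bound[OF G(1)]) simp_all
    moreover have "B * (T - real n * p + 1) \<le> B * (p + 1)" using n B by (intro mult_left_mono) auto
    ultimately show ?thesis unfolding C_def by (auto simp: abs_le_iff)
  qed
  show ?thesis
  proof (rule tendstoI)
    fix e :: real assume e: "0 < e"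
    obtain N where N: "0 < N" "\<And>s T. s \<in> Time S \<Longrightarrow> T \<in> Time S \<Longrightarrow> N \<le> s \<Longrightarrow> s + N \<le> T \<Longrightarrow> \<bar>\<phi> T s - G s\<bar> \<le> e / 4"
      using close[of "e / 4"] e by auto
    \<comment> \<open>Each of the two end windows has mass at most \<open>N + 1\<close> and
      integrand at most \<open>2 * B\<close>; \<open>C\<close> is the error for
      \<open>G\<close>.\<close>
    define D where "D = 4 * B * (N + 1) + C"
    \<comment> \<open>Beyond \<open>T0\<close> the end windows lie in \<open>{0..T}\<close>, and
      each of \<open>e / 4 * T\<close>, \<open>e / 4\<close> and \<open>D\<close> is at most a
      quarter of \<open>e * T\<close>.\<close>
    define T0 where "T0 = max 1 (max N (4 * D / e))"
    have main: "dist ((1 / T) * (\<integral>s\<in>{0..T}. \<phi> T s \<partial>clock S)) ((1 / p) * A) < e"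
      if T: "T \<in> Time S" "T0 \<le> T" for T
    proof -
      have T1: "1 \<le> T" "N \<le> T" "4 * D / e \<le> T" using T(2) by (auto simp: T0_def)
      define h where "h s = e / 4 + 2 * B * indicator {0..N} s + 2 * B * indicator {T - N..T} s" for s
      have pint: "set_integrable (clock S) {0..T} (\<phi> T)"
        using T1 \<phi>(2) T by (intro clock_integrable[OF \<phi>(1), of _ _ 0 T B]) auto
      have Gi: "set_integrable (clock S) {0..T} G" using T1 by (intro Gint[where b = T]) auto
      have c_int: "set_integrable (clock S) {0..T} (\<lambda>_. k)" for k :: real
        using T1 by (intro clock_integrable[of _ _ 0 T "\<bar>k\<bar>"]) auto
      have i_meas: "(\<lambda>s. k * indicator {u..v} s) \<in> borel_measurable (restrict_space borel (Time S))"
        for k u v :: real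
        by (intro measurable_restrict_space1) measurable
      have i_int: "set_integrable (clock S) {0..T} (\<lambda>s. k * indicator {u..v} s)" for k u v :: real
        using T1 by (intro clock_integrable[OF i_meas, where a = 0 and b = T and B = "\<bar>k\<bar>"]) (auto simp: indicator_def)
      have i_bound: "(\<integral>s\<in>{0..T}. indicator {u..v} s \<partial>clock S) \<le> v - u + 1"
        if "0 \<le> u" "u \<le> v" "v \<le> T" for u v
      proof -
        have "(\<integral>s\<in>{0..T}. indicator {u..v} s \<partial>clock S) = (\<integral>s\<in>{u..v}. 1 \<partial>clock S)"
          unfolding set_lebesgue_integral_def using that
          by (intro Bochner_Integration.integral_cong) (auto simp: indicator_def)
        also have "\<dots> \<le> 1 * (v - u + 1)"
          using that clock_integral_bound[of "\<lambda>_. 1" "{u..v}" u v 1] by auto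
        finally show ?thesis by simp
      qed
      have c_bound: "(\<integral>s\<in>{0..T}. 1 \<partial>clock S) \<le> T + 1"
        using T1 clock_integral_bound[of "\<lambda>_. 1" "{0..T}" 0 T 1] by auto
      have hint: "set_integrable (clock S) {0..T} h"
        unfolding h_def by (intro set_integral_add c_int i_int)
      have "\<bar>(\<integral>s\<in>{0..T}. \<phi> T s \<partial>clock S) - (\<integral>s\<in>{0..T}. G s \<partial>clock S)\<bar> =
          \<bar>\<integral>s\<in>{0..T}. \<phi> T s - G s \<partial>clock S\<bar>"
        using pint Gi by simp
      also have "\<dots> \<le> (\<integral>s\<in>{0..T}. \<bar>\<phi> T s - G s\<bar> \<partial>clock S)"
        unfolding set_lebesgue_integral_def
        by (rule order_trans[OF integral_abs_bound]) (simp add: abs_mult)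
      also have "\<dots> \<le> (\<integral>s\<in>{0..T}. h s \<partial>clock S)"
        unfolding set_lebesgue_integral_def
      proof (rule integral_mono)
        show "integrable (clock S) (\<lambda>s. indicator {0..T} s *\<^sub>R \<bar>\<phi> T s - G s\<bar>)"
          using set_integrable_abs[OF set_integral_diff(1)[OF pint Gi]] by (simp add: set_integrable_def)
        show "integrable (clock S) (\<lambda>s. indicator {0..T} s *\<^sub>R h s)"
          using hint by (simp add: set_integrable_def)
        fix s assume "s \<in> space (clock S)"
        then have "\<bar>\<phi> T s - G s\<bar> \<le> h s" if "s \<in> {0..T}"
        proof -
          have "{0..T} \<subseteq> {0..}" by simp
          from clock_space_Time[OF this] have s: "s \<in> Time S"
            using that \<open>s \<in> space (clock S)\<close> by blast
          have "\<bar>\<phi> T s - G s\<bar> \<le> 2 * B" using \<phi>(2)[OF s T(1)] G(2)[OF s] by linarith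
          moreover have "\<bar>\<phi> T s - G s\<bar> \<le> e / 4" if "N < s" "s < T - N" using N(2)[OF s T(1)] that by simp
          ultimately show ?thesis
            unfolding h_def using that B e by (cases "N < s"; cases "s < T - N") (simp_all add: indicator_def)
        qed
        then show "indicator {0..T} s *\<^sub>R \<bar>\<phi> T s - G s\<bar> \<le> indicator {0..T} s *\<^sub>R h s"
          by (simp add: indicator_def)
      qed
      also have "\<dots> = e / 4 * (\<integral>s\<in>{0..T}. 1 \<partial>clock S) + 2 * B * (\<integral>s\<in>{0..T}. indicator {0..N} s \<partial>clock S)
          + 2 * B * (\<integral>s\<in>{0..T}. indicator {T - N..T} s \<partial>clock S)"
      proof -
        have "(\<integral>s\<in>{0..T}. e / 4 \<partial>clock S) = e / 4 * (\<integral>s\<in>{0..T}. 1 \<partial>clock S)"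
          unfolding set_lebesgue_integral_def by (simp add: mult.commute)
        then show ?thesis
          unfolding h_def set_integral_add(2)[OF set_integral_add(1)[OF c_int i_int] i_int]
            set_integral_add(2)[OF c_int i_int] by simp
      qed
      also have "\<dots> \<le> e / 4 * (T + 1) + 2 * B * (N - 0 + 1) + 2 * B * (T - (T - N) + 1)"
        using e B N(1) T1 by (intro add_mono mult_left_mono c_bound i_bound) auto
      finally have "\<bar>(\<integral>s\<in>{0..T}. \<phi> T s \<partial>clock S) - T / p * A\<bar> \<le> e / 4 * (T + 1) + D"
        using G_avg[of T] T1 unfolding D_def by (simp add: algebra_simps abs_le_iff)
      also have "\<dots> < e * T"
      proof -
        have "4 * D \<le> e * T" using T1(3) e by (simp add: field_simps)
        moreover have "e * 1 \<le> e * T" using T1(1) e by (intro mult_left_mono) auto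
        moreover have "0 < e * T" using e T1 by simp
        moreover have "e / 4 * (T + 1) = e * T / 4 + e / 4" by (simp add: field_simps)
        ultimately show ?thesis by linarith
      qed
      finally have "\<bar>(\<integral>s\<in>{0..T}. \<phi> T s \<partial>clock S) - T / p * A\<bar> / T < e" using T1 by (simp add: field_simps)
      moreover have "(1 / T) * (\<integral>s\<in>{0..T}. \<phi> T s \<partial>clock S) - (1 / p) * A = ((\<integral>s\<in>{0..T}. \<phi> T s \<partial>clock S) - T / p * A) / T"
        using T1 by (simp add: field_simps)
      ultimately show ?thesis using T1 by (simp add: dist_real_def abs_divide)
    qed
    have "\<forall>\<^sub>F T in time_at_top S. T \<in> Time S \<and> T0 \<le> T"
      unfolding time_at_top_def eventually_inf_principal
      using eventually_ge_at_top[of T0] by eventually_elim auto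
    then show "\<forall>\<^sub>F T in time_at_top S. dist ((1 / T) * (\<integral>s\<in>{0..T}. \<phi> T s \<partial>clock S))
        ((1 / p) * (\<integral>s\<in>{0..<p}. G s \<partial>clock S)) < e"
      unfolding A_def[symmetric] by eventually_elim (use main in blast)
  qed
qed

text \<open>The average is the mixture of \<open>\<kappa>\<close> over the clock on
  \<open>J\<close>, scaled by \<open>1 / a\<close>; so it is a measure, and its integrals follow
  from \<open>integral_bind\<close>. The point \<open>0 \<in> J\<close> makes the mixing space
  nonempty, as the rules for \<open>bind\<close> demand.\<close>

lemma integral_time_average:
  assumes \<kappa>: "\<kappa> \<in> restrict_space borel (Time S) \<rightarrow>\<^sub>M subprob_algebra (State S)"
    and J: "J \<in> sets borel" "0 \<in> J" "J \<subseteq> {0..b}" and "0 < a"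
    and f: "bounded_measurable (State S) f"
  shows "sets (time_average S a J \<kappa>) = sets (State S)"
    "(\<integral>x. f x \<partial>time_average S a J \<kappa>) = (1 / a) * (\<integral>s\<in>J. (\<integral>x. f x \<partial>\<kappa> s) \<partial>clock S)"
proof -
  have b: "0 \<le> b" using J by auto
  let ?R = "restrict_space (clock S) J"
  define D where "D = density ?R (\<lambda>_. ennreal (1 / a))"
  have J0: "J \<subseteq> {0..}" using J by auto
  have Jc: "J \<inter> space (clock S) \<in> sets (clock S)" by (rule clock_borel[OF J(1)])
  have \<kappa>R: "\<kappa> \<in> ?R \<rightarrow>\<^sub>M subprob_algebra (State S)" by (rule clock_measurable[OF \<kappa> J0])
  then have \<kappa>D: "\<kappa> \<in> D \<rightarrow>\<^sub>M subprob_algebra (State S)" by (simp add: D_def)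
  have "0 \<in> space ?R" using J(2) clock_space_Time[OF J0] Time_zero by (auto simp: space_restrict_space)
  then have ne: "space D \<noteq> {}" by (auto simp: D_def)
  interpret R: finite_measure ?R using J b by (intro restrict_clock(1)[of "\<lambda>_. 0" J 0 b]) auto
  have D_fin: "finite_measure D"
    by (rule finite_measureI) (simp add: D_def emeasure_density nn_integral_cmult ennreal_mult_eq_top_iff R.emeasure_eq_measure)
  have sets: "sets (D \<bind> \<kappa>) = sets (State S)"
    using \<kappa>D ne by (intro sets_bind) (auto dest: subprob_measurableD(2))
  have em: "emeasure (D \<bind> \<kappa>) A = ennreal (1 / a) * (\<integral>\<^sup>+s\<in>J. emeasure (\<kappa> s) A \<partial>clock S)"
    if A: "A \<in> sets (State S)" for A
  proof -
    have m: "(\<lambda>s. emeasure (\<kappa> s) A) \<in> borel_measurable ?R"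
      by (rule measurable_compose[OF \<kappa>R measurable_emeasure_subprob_algebra[OF A]])
    have "emeasure (D \<bind> \<kappa>) A = (\<integral>\<^sup>+s. emeasure (\<kappa> s) A \<partial>D)" by (rule emeasure_bind[OF ne \<kappa>D A])
    also have "\<dots> = ennreal (1 / a) * (\<integral>\<^sup>+s. emeasure (\<kappa> s) A \<partial>?R)"
      unfolding D_def using m by (simp add: nn_integral_density nn_integral_cmult)
    also have "(\<integral>\<^sup>+s. emeasure (\<kappa> s) A \<partial>?R) = (\<integral>\<^sup>+s\<in>J. emeasure (\<kappa> s) A \<partial>clock S)"
      by (rule nn_integral_restrict_space[OF Jc])
    finally show ?thesis .
  qed
  have "time_average S a J \<kappa> = measure_of (space (D \<bind> \<kappa>)) (sets (D \<bind> \<kappa>)) (emeasure (D \<bind> \<kappa>))"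
    unfolding time_average_def sets sets_eq_imp_space_eq[OF sets]
    using sets.space_closed[of "State S"] em by (intro measure_of_eq) (auto simp: sets.sigma_sets_eq)
  then have eq: "time_average S a J \<kappa> = D \<bind> \<kappa>" by (simp add: measure_of_of_measure)
  show "sets (time_average S a J \<kappa>) = sets (State S)" unfolding eq by (rule sets)
  obtain B where B: "0 < B" "\<And>x. x \<in> space (State S) \<Longrightarrow> \<bar>f x\<bar> \<le> B" using bounded_measurable_bound[OF f] by blast
  have "(\<integral>x. f x \<partial>(D \<bind> \<kappa>)) = (\<integral>s. (\<integral>x. f x \<partial>\<kappa> s) \<partial>D)"
  proof (rule integral_bind[where B = B and B' = 1 and K = "State S"])
    show "AE s in D. emeasure (\<kappa> s) (space (\<kappa> s)) \<le> ennreal 1"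
      using measurable_space[OF \<kappa>D] by (intro AE_I2) (simp add: space_subprob_algebra subprob_space.emeasure_space_le_1)
  qed (use f B \<kappa>D D_fin in auto)
  also have "\<dots> = (\<integral>s. (1 / a) *\<^sub>R (\<integral>x. f x \<partial>\<kappa> s) \<partial>?R)"
    unfolding D_def
    using measurable_compose[OF \<kappa>R integral_measurable_subprob_algebra[OF bounded_measurableD[OF f]]] \<open>0 < a\<close>
    by (intro integral_density) auto
  also have "\<dots> = (1 / a) * (\<integral>s\<in>J. (\<integral>x. f x \<partial>\<kappa> s) \<partial>clock S)"
    unfolding integral_restrict_space[OF Jc] set_lebesgue_integral_def by simp
  finally show "(\<integral>x. f x \<partial>time_average S a J \<kappa>) = (1 / a) * (\<integral>s\<in>J. (\<integral>x. f x \<partial>\<kappa> s) \<partial>clock S)" unfolding eq .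
qed

end

section \<open>Averages of the conditional laws and their limit\<close>

context periodic_absorbed_process
begin

lemma joint_P:
  assumes "r \<in> Time S" "t \<in> Time S" "u \<in> Time S" "r \<le> t" "t \<le> u" "bm f"
  shows "P r t (\<lambda>y. f y * Z t u y) x = (\<integral>y. f y \<partial>joint r t u x)"
  using integral_joint_killed[OF assms(1-5), of f x] assms(6) Z_survival[OF assms(2,3)]
  by (auto simp: P_def)

lemma Pr_mix_prob:
  assumes \<mu>: "start \<mu>"
  shows "prob_space (Pr_mix S 0 \<mu>)" "sets (Pr_mix S 0 \<mu>) = sets (Sample S)"
proof -
  have m: "Pr S 0 \<in> \<mu> \<rightarrow>\<^sub>M prob_algebra (Sample S)"
    using Pr_kernel[OF Time_zero] unfolding measurable_cong_sets[OF startD(2)[OF \<mu>] refl] .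
  have "\<mu> \<in> space (prob_algebra \<mu>)" using startD[OF \<mu>] by (simp add: space_prob_algebra)
  then show "prob_space (Pr_mix S 0 \<mu>)" unfolding Pr_mix_def using m by (rule prob_space_bind')
  show "sets (Pr_mix S 0 \<mu>) = sets (Sample S)"
    unfolding Pr_mix_def using startD(4)[OF \<mu>] Pr_sets[OF Time_zero] by (intro sets_bind) auto
qed

lemma integral_Pr_mix:
  fixes g :: "'w \<Rightarrow> real"
  assumes \<mu>: "start \<mu>" and g: "bounded_measurable (Sample S) g"
  shows "(\<integral>w. g w \<partial>Pr_mix S 0 \<mu>) = (\<integral>x. (\<integral>w. g w \<partial>Pr S 0 x) \<partial>\<mu>)"
proof -
  obtain B where B: "0 < B" "\<And>w. w \<in> \<Omega> \<Longrightarrow> \<bar>g w\<bar> \<le> B" using bounded_measurable_bound[OF g] by blast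
  have m: "Pr S 0 \<in> \<mu> \<rightarrow>\<^sub>M subprob_algebra (Sample S)"
    using measurable_prob_algebraD[OF Pr_kernel[OF Time_zero]]
    unfolding measurable_cong_sets[OF startD(2)[OF \<mu>] refl] .
  show ?thesis unfolding Pr_mix_def
  proof (rule integral_bind[where B = B and B' = 1 and K = "Sample S"])
    show "AE x in \<mu>. emeasure (Pr S 0 x) (space (Pr S 0 x)) \<le> ennreal 1"
      using prob_space.emeasure_space_1[OF Pr_prob[OF Time_zero]] by simp
  qed (use g B m startD(5)[OF \<mu>] in auto)
qed

lemma surviving_mix:
  assumes \<mu>: "start \<mu>" and T: "T \<in> Time S"
  shows "measure (Pr_mix S 0 \<mu>) (surviving S 0 T) = (\<integral>x. Z 0 T x \<partial>\<mu>)" "0 < (\<integral>x. Z 0 T x \<partial>\<mu>)"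
proof -
  show "measure (Pr_mix S 0 \<mu>) (surviving S 0 T) = (\<integral>x. Z 0 T x \<partial>\<mu>)"
    using measure_Pr_mix(1)[OF Time_zero \<mu>[unfolded start_probs_on] surviving_sets[OF Time_zero T]]
    by (simp add: Z_survival[OF Time_zero T] survival_def)
  have T0: "0 \<le> T" using Time_nonneg T .
  interpret prob_space \<mu> using startD[OF \<mu>] by simp
  have "0 \<le> (\<integral>x. Z 0 T x \<partial>\<mu>)" using Z_nonneg[OF Time_zero T T0] by (auto intro!: Bochner_Integration.integral_nonneg)
  moreover have "(\<integral>x. Z 0 T x \<partial>\<mu>) \<noteq> 0"
  proof
    assume "(\<integral>x. Z 0 T x \<partial>\<mu>) = 0"
    then have "AE x in \<mu>. Z 0 T x = 0"
      using Z_nonneg[OF Time_zero T T0] start_integrable[OF \<mu> bm_Z[OF Time_zero T T0]]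
      by (subst (asm) integral_nonneg_eq_0_iff_AE) auto
    then have "AE x in \<mu>. False" using startD(3)[OF \<mu>]
      by eventually_elim (use Z_pos[OF Time_zero T T0] in force)
    then show False by simp
  qed
  ultimately show "0 < (\<integral>x. Z 0 T x \<partial>\<mu>)" by simp
qed

lemma cond_law_sets: "sets (cond_law S N s T t) = sets (State S)"
  unfolding cond_law_def by simp

text \<open>Measurability in \<open>s\<close> is where \<open>coord\<close> must be measurable
  jointly in time and sample point; the conditioned measure itself does not depend on
  \<open>s\<close>.\<close>

lemma cond_law_kernel:
  assumes \<mu>: "start \<mu>" and T: "T \<in> Time S"
  shows "(\<lambda>s. cond_law S (Pr_mix S 0 \<mu>) 0 T s) \<in> restrict_space borel (Time S) \<rightarrow>\<^sub>M prob_algebra (State S)"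
proof -
  interpret prob_space "Pr_mix S 0 \<mu>" by (rule Pr_mix_prob[OF \<mu>])
  let ?U = "uniform_measure (Pr_mix S 0 \<mu>) (surviving S 0 T)"
  have U: "prob_space ?U"
    using surviving_mix[OF \<mu> T] by (intro prob_space_uniform_measure) (auto simp: emeasure_eq_measure)
  have Us: "sets ?U = sets (Sample S)" using Pr_mix_prob(2)[OF \<mu>] by simp
  show ?thesis
  proof (rule measurable_prob_algebraI)
    fix s assume "s \<in> space (restrict_space borel (Time S))"
    then have s: "s \<in> Time S" by (simp add: space_restrict_space)
    have "coord S s \<in> ?U \<rightarrow>\<^sub>M State S" using coord_meas[OF s] unfolding measurable_cong_sets[OF Us refl] .
    then show "prob_space (cond_law S (Pr_mix S 0 \<mu>) 0 T s)"
      unfolding cond_law_def by (rule prob_space.prob_space_distr[OF U])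
  next
    show "(\<lambda>s. cond_law S (Pr_mix S 0 \<mu>) 0 T s) \<in> restrict_space borel (Time S) \<rightarrow>\<^sub>M subprob_algebra (State S)"
      unfolding cond_law_def
    proof (rule measurable_distr2[where M = "Sample S"])
      show "case_prod (coord S) \<in> restrict_space borel (Time S) \<Otimes>\<^sub>M Sample S \<rightarrow>\<^sub>M State S"
        using coord_measurable by simp
      show "(\<lambda>s. ?U) \<in> restrict_space borel (Time S) \<rightarrow>\<^sub>M subprob_algebra (Sample S)"
        using prob_space_imp_subprob_space[OF U] Us by (intro measurable_const) (simp add: space_subprob_algebra)
    qed
  qed
qed

text \<open>The conditional law under a mixture is not the mixture of the conditional laws:
  numerator and denominator are integrated over \<open>\<mu>\<close> separately, as in
  \<open>surv_law\<close>.\<close>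

lemma integral_cond_law:
  assumes \<mu>: "start \<mu>" and s: "s \<in> Time S" and T: "T \<in> Time S" "s \<le> T" and f: "bm f"
  shows "(\<integral>y. f y \<partial>cond_law S (Pr_mix S 0 \<mu>) 0 T s) = surv_law \<mu> s T f"
proof -
  interpret prob_space "Pr_mix S 0 \<mu>" by (rule Pr_mix_prob[OF \<mu>])
  have s0: "0 \<le> s" using Time_nonneg s .
  note ms = Pr_mix_prob(2)[OF \<mu>]
  have c: "coord S s \<in> Pr_mix S 0 \<mu> \<rightarrow>\<^sub>M State S"
    using coord_meas[OF s] unfolding measurable_cong_sets[OF ms refl] .
  have fc: "bounded_measurable (Sample S) (\<lambda>w. f (coord S s w))"
    by (rule bounded_measurable_compose[OF f coord_meas[OF s]])
  have "(\<integral>y. f y \<partial>cond_law S (Pr_mix S 0 \<mu>) 0 T s) = (\<integral>w. f (coord S s w) \<partial>uniform_measure (Pr_mix S 0 \<mu>) (surviving S 0 T))"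
    unfolding cond_law_def using c f by (intro integral_distr) auto
  also have "\<dots> = (\<integral>w. indicator (surviving S 0 T) w * f (coord S s w) \<partial>Pr_mix S 0 \<mu>) / (\<integral>x. Z 0 T x \<partial>\<mu>)"
    using surviving_mix[OF \<mu> T(1)] surviving_sets[OF Time_zero T(1)] measurable_compose[OF c bounded_measurableD[OF f]] ms
    by (subst integral_uniform_measure) (auto simp: finite_measure_axioms)
  also have "(\<integral>w. indicator (surviving S 0 T) w * f (coord S s w) \<partial>Pr_mix S 0 \<mu>) =
    (\<integral>x. (\<integral>w. indicator (surviving S 0 T) w * f (coord S s w) \<partial>Pr S 0 x) \<partial>\<mu>)"
    using surviving_sets[OF Time_zero T(1)] fc by (intro integral_Pr_mix[OF \<mu>] bounded_measurable_mult) auto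
  also have "\<dots> = (\<integral>x. P 0 s (\<lambda>y. f y * Z s T y) x \<partial>\<mu>)"
    using joint_P[OF Time_zero s T(1) s0 T(2) f] integral_joint[OF Time_zero s T(1), of f] f by auto
  finally show ?thesis unfolding surv_law_def .
qed

context
  fixes \<eta> assumes \<eta>: "profile \<eta>"
begin

text \<open>Measurability in time is not visible from the formula for the \<open>Q\<close>-process: by periodicity
  the law at time \<open>s\<close> is the limit of the conditional laws at \<open>s + n * \<gamma>\<close>, where the joint
  measurability of \<open>coord\<close> applies.\<close>

lemma Qm_kernel:
  assumes \<beta>: "invariant \<eta> \<beta>"
  shows "Qm \<eta> \<beta> \<in> restrict_space borel (Time S) \<rightarrow>\<^sub>M prob_algebra (State S)"
proof -
  have st: "start \<beta>" using \<beta> unfolding invariant_def[OF \<eta>] by blast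
  show ?thesis
  proof (intro measurable_prob_algebraI measurable_subprob_algebra)
    fix B assume B: "B \<in> sets (State S)"
    note iB = bounded_measurable_indicator[OF B]
    \<comment> \<open>With a horizon of \<open>2 * n\<close> periods and observation at
      \<open>s + real n * \<gamma>\<close>, both the elapsed and the remaining time tend to
      infinity.\<close>
    define u where "u n s = measure (cond_law S (Pr_mix S 0 \<beta>) 0 (real (2 * n) * \<gamma>) (s + real n * \<gamma>)) B" for n s
    have um: "u n \<in> borel_measurable (restrict_space borel (Time S))" for n
    proof -
      have "(\<lambda>s. s + real n * \<gamma>) \<in> restrict_space borel (Time S) \<rightarrow>\<^sub>M restrict_space borel (Time S)"
        using Time_add period_mult_Time
        by (intro measurable_restrict_space2 measurable_restrict_space1) (auto simp: space_restrict_space)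
      from measurable_compose[OF this measurable_compose[OF cond_law_kernel[OF st period_mult_Time[of "2 * n"]]
            measurable_measure_prob_algebra[OF B]]]
      show ?thesis unfolding u_def[abs_def] .
    qed
    have lim: "(\<lambda>n. u n s) \<longlonglongrightarrow> measure (Qm \<eta> \<beta> s) B" if s: "s \<in> Time S" for s
    proof (rule tendstoI)
      fix e :: real assume e: "0 < e"
      obtain N where N: "0 < N" "\<And>s T. s \<in> Time S \<Longrightarrow> T \<in> Time S \<Longrightarrow> N \<le> s \<Longrightarrow> s + N \<le> T \<Longrightarrow>
        \<bar>surv_law \<beta> s T (indicator B) - (\<integral>x. doob \<eta> 0 s (indicator B) x \<partial>\<beta>)\<bar> \<le> e / 2"
        using surv_law_uniform[OF \<eta> st st iB, of "e / 2"] e by auto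
      obtain n0 where n0: "(N + s) / \<gamma> < real n0" using reals_Archimedean2 by blast
      have "dist (u n s) (measure (Qm \<eta> \<beta> s) B) < e" if n: "n0 \<le> n" for n
      proof -
        have "(N + s) / \<gamma> < real n" using n0 n by linarith
        then have big: "N + s < real n * \<gamma>" using gamma by (simp add: field_simps)
        define r where "r = s + real n * \<gamma>"
        define T where "T = real (2 * n) * \<gamma>"
        have T2: "T = real n * \<gamma> + real n * \<gamma>" by (simp add: T_def)
        have r: "r \<in> Time S" "N \<le> r" "T \<in> Time S" "r + N \<le> T" "r \<le> T"
        proof -
          show "r \<in> Time S" unfolding r_def by (intro Time_add s period_mult_Time)
          show "T \<in> Time S" unfolding T_def by (rule period_mult_Time)
          show "N \<le> r" "r + N \<le> T" "r \<le> T"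
            using big N(1) Time_nonneg[OF s] unfolding r_def T2 by linarith+
        qed
        have "u n s = (\<integral>y. indicator B y \<partial>cond_law S (Pr_mix S 0 \<beta>) 0 T r)"
          using B cond_law_sets by (simp add: u_def r_def T_def)
        also have "\<dots> = surv_law \<beta> r T (indicator B)"
          by (rule integral_cond_law[OF st r(1,3,5) iB])
        finally have "u n s = surv_law \<beta> r T (indicator B)" .
        \<comment> \<open>Started from \<open>\<beta>\<close>, the \<open>Q\<close>-process has the
          same law at time \<open>r\<close> as at time \<open>s\<close>, which is \<open>n\<close>
          periods earlier.\<close>
        moreover have "(\<integral>x. doob \<eta> 0 r (indicator B) x \<partial>\<beta>) = measure (Qm \<eta> \<beta> s) B"
          using invariant_periodic[OF \<eta> \<beta> s iB, of n] integral_Qm[OF \<eta> st s iB] Qm_sets[OF \<eta> st s] B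
          by (simp add: r_def)
        ultimately show ?thesis using N(2)[OF r(1,3,2,4)] e by (simp add: dist_real_def)
      qed
      then show "\<forall>\<^sub>F n in sequentially. dist (u n s) (measure (Qm \<eta> \<beta> s) B) < e"
        unfolding eventually_sequentially by blast
    qed
    have "(\<lambda>s. measure (Qm \<eta> \<beta> s) B) \<in> borel_measurable (restrict_space borel (Time S))"
    proof (rule borel_measurable_LIMSEQ_real)
      show "(\<lambda>n. u n s) \<longlonglongrightarrow> measure (Qm \<eta> \<beta> s) B" if "s \<in> space (restrict_space borel (Time S))" for s
        using that by (intro lim) (simp add: space_restrict_space)
    qed (rule um)
    then have "(\<lambda>s. ennreal (measure (Qm \<eta> \<beta> s) B)) \<in> borel_measurable (restrict_space borel (Time S))"
      by measurable
    moreover have "emeasure (Qm \<eta> \<beta> s) B = ennreal (measure (Qm \<eta> \<beta> s) B)" if "s \<in> Time S" for s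
      using Qm_prob[OF \<eta> st that] by (simp add: finite_measure.emeasure_eq_measure prob_space_def)
    ultimately show "(\<lambda>s. emeasure (Qm \<eta> \<beta> s) B) \<in> borel_measurable (restrict_space borel (Time S))"
      by (subst measurable_cong[where g = "\<lambda>s. ennreal (measure (Qm \<eta> \<beta> s) B)"]) (simp_all add: space_restrict_space)
  qed (use Qm_prob[OF \<eta> st] Qm_sets[OF \<eta> st] in \<open>auto simp: space_restrict_space intro: prob_space_imp_subprob_space\<close>)
qed

text \<open>\<open>periodic_average\<close> applies with \<open>G s\<close> the expectation under
  the \<open>Q\<close>-process started from \<open>\<beta>\<close>, periodic by invariance, and
  \<open>\<phi> T s\<close> the conditional expectation, uniformly close to it by
  \<open>surv_law_uniform\<close>.\<close>

lemma time_average_converges: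
  assumes \<beta>: "invariant \<eta> \<beta>" and \<mu>: "start \<mu>" and f: "bm f"
  shows "((\<lambda>T. \<integral>x. f x \<partial>time_average S T {0..T} (\<lambda>s. cond_law S (Pr_mix S 0 \<mu>) 0 T s)) \<longlongrightarrow>
    (\<integral>x. f x \<partial>time_average S \<gamma> {0..<\<gamma>} (Qm \<eta> \<beta>))) (time_at_top S)"
proof -
  have st: "start \<beta>" using \<beta> unfolding invariant_def[OF \<eta>] by blast
  obtain B where B: "0 < B" "\<And>x. \<bar>f x\<bar> \<le> B" using bounded_measurable_bound[OF f] by (metis UNIV_I state_space)
  define G where "G s = (\<integral>x. f x \<partial>Qm \<eta> \<beta> s)" for s
  define \<phi> where "\<phi> T s = (\<integral>x. f x \<partial>cond_law S (Pr_mix S 0 \<mu>) 0 T s)" for T s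
  have Geq: "G s = (\<integral>x. doob \<eta> 0 s f x \<partial>\<beta>)" if "s \<in> Time S" for s
    unfolding G_def by (rule integral_Qm[OF \<eta> st that f])
  have bound: "\<bar>\<integral>x. f x \<partial>L\<bar> \<le> B" if L: "L \<in> space (prob_algebra (State S))" for L
  proof -
    have Ls: "prob_space L" "sets L = sets (State S)" using L by (auto simp: space_prob_algebra)
    interpret prob_space L by (rule Ls)
    have "\<bar>\<integral>x. f x \<partial>L\<bar> \<le> (\<integral>x. B \<partial>L)"
      using B Ls f by (intro order_trans[OF integral_abs_bound] integral_mono
          integrable_bounded_measurable[OF finite_measure_axioms Ls(2)] bounded_measurable_abs) auto
    then show ?thesis by (simp add: prob_space)
  qed
  have fm: "(\<lambda>L. \<integral>x. f x \<partial>L) \<in> borel_measurable (subprob_algebra (State S))"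
    using f by (intro integral_measurable_subprob_algebra) auto
  note kG = Qm_kernel[OF \<beta>] and k\<phi> = cond_law_kernel[OF \<mu>]
  have "((\<lambda>T. (1 / T) * (\<integral>s\<in>{0..T}. \<phi> T s \<partial>clock S)) \<longlongrightarrow>
    (1 / \<gamma>) * (\<integral>s\<in>{0..<\<gamma>}. G s \<partial>clock S)) (time_at_top S)"
  proof (rule periodic_average[OF gamma, where B = B])
    fix s assume s: "s \<in> Time S"
    show "G (s + \<gamma>) = G s"
      using invariant_periodic[OF \<eta> \<beta> s f, of 1] Time_add[OF s gamma(1)] s by (simp add: Geq)
    show "\<bar>G s\<bar> \<le> B"
      unfolding G_def using measurable_space[OF kG, of s] s by (intro bound) (simp add: space_restrict_space)
  next
    show "G \<in> borel_measurable (restrict_space borel (Time S))"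
      unfolding G_def[abs_def] by (rule measurable_compose[OF measurable_prob_algebraD[OF kG] fm])
  next
    fix T assume T: "T \<in> Time S"
    show "\<phi> T \<in> borel_measurable (restrict_space borel (Time S))"
      unfolding \<phi>_def[abs_def] by (rule measurable_compose[OF measurable_prob_algebraD[OF k\<phi>[OF T]] fm])
    show "\<bar>\<phi> T s\<bar> \<le> B" if "s \<in> Time S" for s
      unfolding \<phi>_def using measurable_space[OF k\<phi>[OF T], of s] that by (intro bound) (simp add: space_restrict_space)
  next
    fix e :: real assume "0 < e"
    then obtain N where N: "0 < N" "\<And>s T. s \<in> Time S \<Longrightarrow> T \<in> Time S \<Longrightarrow> N \<le> s \<Longrightarrow> s + N \<le> T \<Longrightarrow>
        \<bar>surv_law \<mu> s T f - (\<integral>x. doob \<eta> 0 s f x \<partial>\<beta>)\<bar> \<le> e"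
      using surv_law_uniform[OF \<eta> \<mu> st f] by blast
    have "\<bar>\<phi> T s - G s\<bar> \<le> e" if s: "s \<in> Time S" and T: "T \<in> Time S" and sT: "N \<le> s" "s + N \<le> T" for s T
      using N(2)[OF s T sT] integral_cond_law[OF \<mu> s T _ f] N(1) sT by (simp add: \<phi>_def Geq s)
    then show "\<exists>N>0. \<forall>s\<in>Time S. \<forall>T\<in>Time S. N \<le> s \<longrightarrow> s + N \<le> T \<longrightarrow> \<bar>\<phi> T s - G s\<bar> \<le> e"
      using N(1) by blast
  qed
  moreover have "(\<integral>x. f x \<partial>time_average S \<gamma> {0..<\<gamma>} (Qm \<eta> \<beta>)) = (1 / \<gamma>) * (\<integral>s\<in>{0..<\<gamma>}. G s \<partial>clock S)"
    unfolding G_def using gamma f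
    by (intro integral_time_average(2)[where b = \<gamma>] measurable_prob_algebraD[OF kG]) auto
  moreover have "\<forall>\<^sub>F T in time_at_top S. (1 / T) * (\<integral>s\<in>{0..T}. \<phi> T s \<partial>clock S) =
    (\<integral>x. f x \<partial>time_average S T {0..T} (\<lambda>s. cond_law S (Pr_mix S 0 \<mu>) 0 T s))"
    using eventually_F_ge[of 1] unfolding F_time
  proof eventually_elim
    case (elim T)
    then show ?case
      unfolding \<phi>_def using f
      by (intro integral_time_average(2)[where b = T, symmetric] measurable_prob_algebraD[OF k\<phi>]) auto
  qed
  ultimately show ?thesis by (simp add: Lim_transform_eventually)
qed

lemma weak_convergence:
  assumes \<beta>: "invariant \<eta> \<beta>" and \<mu>: "start \<mu>"
  shows "weakly_converges euclidean
    (\<lambda>t. time_average S t {0..t} (\<lambda>s. cond_law S (Pr_mix S 0 \<mu>) 0 t s))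
    (time_average S \<gamma> {0..<\<gamma>} (Qm \<eta> \<beta>)) (time_at_top S)"
  unfolding weakly_converges_def
proof (intro allI impI, elim conjE)
  fix f :: "'e \<Rightarrow> real"
  assume fm: "f \<in> borel_measurable (time_average S \<gamma> {0..<\<gamma>} (Qm \<eta> \<beta>))"
    and fb: "bounded (f ` topspace euclidean)"
  have "sets (time_average S \<gamma> {0..<\<gamma>} (Qm \<eta> \<beta>)) = sets (State S)"
    using measurable_prob_algebraD[OF Qm_kernel[OF \<beta>]] gamma
    by (intro integral_time_average(1)[where b = \<gamma> and f = "\<lambda>_. 0"]) auto
  with fm have f: "f \<in> borel_measurable (State S)" using measurable_cong_sets by blast
  obtain b where "\<And>x. \<bar>f x\<bar> \<le> b" using fb unfolding bounded_iff by auto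
  with f have "bm f" by (rule bounded_measurableI)
  then show "((\<lambda>t. \<integral>x. f x \<partial>time_average S t {0..t} (\<lambda>s. cond_law S (Pr_mix S 0 \<mu>) 0 t s)) \<longlongrightarrow>
        (\<integral>x. f x \<partial>time_average S \<gamma> {0..<\<gamma>} (Qm \<eta> \<beta>))) (time_at_top S)"
    by (rule time_average_converges[OF \<beta> \<mu>])
qed

end

text \<open>\<open>Q_law\<close> is known to agree with \<open>Qm\<close> at the times of the
  process; within \<open>{0..<\<gamma>}\<close> the clock runs over such times only.\<close>

lemma time_average_Q_law:
  assumes "profile \<eta>"
    and QQ: "\<And>s t x. s \<in> Time S \<Longrightarrow> t \<in> Time S \<Longrightarrow> s \<le> t \<Longrightarrow> x \<in> alive S s \<Longrightarrow> QQ s t x = Q_path \<eta> s t x"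
    and \<beta>: "start \<beta>"
  shows "time_average S \<gamma> {0..<\<gamma>} (Q_law S QQ 0 \<beta>) = time_average S \<gamma> {0..<\<gamma>} (Qm \<eta> \<beta>)"
proof -
  have "(\<integral>\<^sup>+s\<in>{0..<\<gamma>}. emeasure (Q_law S QQ 0 \<beta> s) B \<partial>clock S) = (\<integral>\<^sup>+s\<in>{0..<\<gamma>}. emeasure (Qm \<eta> \<beta> s) B \<partial>clock S)" for B
  proof (rule nn_integral_cong)
    fix s assume s: "s \<in> space (clock S)"
    show "emeasure (Q_law S QQ 0 \<beta> s) B * indicator {0..<\<gamma>} s = emeasure (Qm \<eta> \<beta> s) B * indicator {0..<\<gamma>} s"
    proof (cases "s \<in> {0..<\<gamma>}")
      case True
      have "{0..<\<gamma>} \<subseteq> {0..}" by auto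
      from clock_space_Time[OF this] True s have "s \<in> Time S" by blast
      then show ?thesis using Q_law_Qm[OF assms] by simp
    qed simp
  qed
  then show ?thesis unfolding time_average_def by simp
qed

end

theorem theorem6:
  fixes S :: "('w, 'e::metric_space) process"
    and \<nu> :: "real \<Rightarrow> 'e measure"
    and \<gamma> t\<^sub>0 c\<^sub>1 c\<^sub>2 :: real
  assumes "absorbed_markov_process S"
    and "\<gamma> \<in> Time S" and "0 < \<gamma>"
    and periodic: "\<forall>t\<in>Time S. absorbing S (t + \<gamma>) = absorbing S t"
    and nu: "\<forall>s\<in>Time S. \<nu> s \<in> probs_on S (alive S s)"
    and "t\<^sub>0 \<in> Time S" and "0 < t\<^sub>0" and "0 < c\<^sub>1" and "0 < c\<^sub>2"
    and A1: "\<forall>s\<in>Time S. \<forall>x\<in>alive S s. \<forall>B\<in>sets (State S).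
      c\<^sub>1 * measure (\<nu> (s + t\<^sub>0)) B
        \<le> measure (cond_law S (Pr S s x) s (s + t\<^sub>0) (s + t\<^sub>0)) B"
    and A2: "\<forall>s\<in>Time S. \<forall>t\<in>Time S. s \<le> t \<longrightarrow> (\<forall>x\<in>alive S s.
      c\<^sub>2 * measure (Pr S s x) (surviving S s t)
        \<le> measure (Pr_mix S s (\<nu> s)) (surviving S s t))"
  shows "(\<exists>Q. Q_process S Q) \<and>
    (\<forall>Q. Q_process S Q \<longrightarrow>
      (\<exists>!\<beta>. Q_invariant S Q \<gamma> \<beta>) \<and>
      (\<forall>\<beta>. Q_invariant S Q \<gamma> \<beta> \<longrightarrow>
        (\<forall>\<mu>\<in>probs_on S (alive S 0).
          weakly_converges euclidean
            (\<lambda>t. time_average S t {0..t} (\<lambda>s. cond_law S (Pr_mix S 0 \<mu>) 0 t s))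
            (time_average S \<gamma> {0..<\<gamma>} (Q_law S Q 0 \<beta>))
            (time_at_top S))))"
proof -
  interpret absorbed_markov_process S by fact
  interpret periodic_absorbed_process S \<nu> \<gamma> t\<^sub>0 c\<^sub>1 c\<^sub>2
    using assms by unfold_locales auto
  show ?thesis
  proof (intro conjI allI impI ballI)
    show "\<exists>Q. Q_process S Q" by (rule Q_process_exists)
  next
    fix QQ assume "Q_process S QQ"
    then obtain \<eta> where \<eta>: "profile \<eta>" and QQ:
      "\<And>s t x. s \<in> Time S \<Longrightarrow> t \<in> Time S \<Longrightarrow> s \<le> t \<Longrightarrow> x \<in> alive S s \<Longrightarrow> QQ s t x = Q_path \<eta> s t x"
      using Q_process_profile by blast
    have inv: "Q_invariant S QQ \<gamma> \<beta> \<longleftrightarrow> invariant \<eta> \<beta>" for \<beta>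
      by (rule Q_invariant_iff[OF \<eta>]) (rule QQ)
    show "\<exists>!\<beta>. Q_invariant S QQ \<gamma> \<beta>"
      using ex_invariant[OF \<eta>] invariant_unique[OF \<eta>] inv by blast
    fix \<beta> \<mu> assume "Q_invariant S QQ \<gamma> \<beta>" and "\<mu> \<in> probs_on S (alive S 0)"
    then have \<beta>: "invariant \<eta> \<beta>" and \<mu>: "start \<mu>" using inv by (auto simp: start_probs_on)
    then have st: "start \<beta>" unfolding invariant_def[OF \<eta>] by blast
    have avg: "time_average S \<gamma> {0..<\<gamma>} (Q_law S QQ 0 \<beta>) = time_average S \<gamma> {0..<\<gamma>} (Qm \<eta> \<beta>)"
      by (rule time_average_Q_law[OF \<eta> _ st]) (rule QQ)
    show "weakly_converges euclidean
            (\<lambda>t. time_average S t {0..t} (\<lambda>s. cond_law S (Pr_mix S 0 \<mu>) 0 t s))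
            (time_average S \<gamma> {0..<\<gamma>} (Q_law S QQ 0 \<beta>)) (time_at_top S)"
      unfolding avg by (rule weak_convergence[OF \<eta> \<beta> \<mu>])
  qed
qed

end
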